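(* For every integer $s \ge 10$, there exist wonderful rays in $N^1(X_s)$. For every $s\ge 13$, there exist wonderful rays $R$ in $N^1(X_s)$ with $R\cdot K_s>0$. For $s=14$, for every $s\ge 13$ such that $s-4$ is a perfect square, and for every $s\ge 18$ such that $s-2$ is a perfect square, there exist De Fernex negative wonderful rays in $N^1(X_s)$.
   Context: $X_s$ denotes the blow-up of the complex projective plane at $s$ very general points; $H$ is the pullback of a line and $E_1,\dots,E_s$ are the exceptional divisors, so $\mathrm{Pic}(X_s)=\mathbb Z H\oplus\bigoplus_i \mathbb Z E_i$ with $H^2=1$, $E_i^2=-1$, $H\cdot E_i=E_i\cdot E_j=0$ ($i\ne j$). $N=N^1(X_s)=\mathrm{Pic}(X_s)\otimes_{\mathbb Z}\mathbb R$. A ray is the set of non-negative real multiples of a nonzero vector of $N$; it is rational if it contains a nonzero integral vector, irrational otherwise; it is effective if it contains an integral vector representing an effective divisor class. The degree of $dH-\sum m_iE_i$ is $d$ (its sign is well defined on rays). The Mori cone is the closure of the cone spanned by effective classes; a ray is nef if it meets every effective divisor non-negatively. A good ray is a rational, non-effective ray of non-negative degree and self-intersection zero. A wonderful ray is a nef, irrational ray of self-intersection zero. $K_s=-3H+\sum_{i=1}^s E_i$ is the canonical class. The De Fernex ray $F_s$ is the ray spanned by $\sqrt{s-1}\,H-\sum_{i=1}^sE_i$; a ray $R$ is De Fernex negative if $R\cdot F_s<0$. *)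

theory Defs
  imports Complex_Main "HOL-Library.Countable_Set"
begin

definition is_mpoly :: "nat \<Rightarrow> ((nat \<Rightarrow> nat) \<Rightarrow> complex) \<Rightarrow> bool" where
  "is_mpoly n f \<longleftrightarrow> finite {\<alpha>. f \<alpha> \<noteq> 0} \<and> (\<forall>\<alpha>. f \<alpha> \<noteq> 0 \<longrightarrow> (\<forall>j\<ge>n. \<alpha> j = 0))"

definition mpoly_eval :: "nat \<Rightarrow> ((nat \<Rightarrow> nat) \<Rightarrow> complex) \<Rightarrow> (nat \<Rightarrow> complex) \<Rightarrow> complex" where
  "mpoly_eval n f x = (\<Sum>\<alpha>\<in>{\<alpha>. f \<alpha> \<noteq> 0}. f \<alpha> * (\<Prod>j<n. x j ^ \<alpha> j))"

definition nonzero_mpoly :: "nat \<Rightarrow> ((nat \<Rightarrow> nat) \<Rightarrow> complex) \<Rightarrow> bool" where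
  "nonzero_mpoly n f \<longleftrightarrow> is_mpoly n f \<and> (\<exists>\<alpha>. f \<alpha> \<noteq> 0)"

text \<open>Points p_1,...,p_s of the affine chart z = 1 of P^2, and their coordinate vector in C^(2s).\<close>

definition point_coords :: "(nat \<Rightarrow> complex \<times> complex) \<Rightarrow> nat \<Rightarrow> complex" where
  "point_coords p j = (if even j then fst (p (j div 2 + 1)) else snd (p (j div 2 + 1)))"

text \<open>A property holds for very general s-tuples of points if it holds outside a countable
  union of proper Zariski closed subsets, i.e. outside a countable union of hypersurfaces.\<close>

definition very_general :: "nat \<Rightarrow> ((nat \<Rightarrow> complex \<times> complex) \<Rightarrow> bool) \<Rightarrow> bool" where
  "very_general s P \<longleftrightarrow>
     (\<exists>F. countable F \<and> (\<forall>f\<in>F. nonzero_mpoly (2 * s) f) \<and>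
        (\<forall>p. (\<forall>f\<in>F. mpoly_eval (2 * s) f (point_coords p) \<noteq> 0) \<longrightarrow> P p))"

text \<open>A form of degree d in x,y,z is given by coefficients c i j of x^i y^j z^(d-i-j),
  i + j \<le> d. It vanishes to order \<ge> m at the point [a:b:1] iff all Taylor coefficients of
  the dehomogenization at (a,b) of total degree < m vanish.\<close>

definition vanishes_to_order :: "nat \<Rightarrow> (nat \<Rightarrow> nat \<Rightarrow> complex) \<Rightarrow> complex \<times> complex \<Rightarrow> nat \<Rightarrow> bool" where
  "vanishes_to_order d c pt m \<longleftrightarrow>
     (\<forall>k l. k + l < m \<longrightarrow>
        (\<Sum>i\<le>d. \<Sum>j\<le>d - i. if k \<le> i \<and> l \<le> j
             then c i j * of_nat (i choose k) * of_nat (j choose l) * fst pt ^ (i - k) * snd pt ^ (j - l)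
             else 0) = 0)"

definition nonzero_form :: "nat \<Rightarrow> (nat \<Rightarrow> nat \<Rightarrow> complex) \<Rightarrow> bool" where
  "nonzero_form d c \<longleftrightarrow> (\<exists>i j. i + j \<le> d \<and> c i j \<noteq> 0)"

text \<open>A vector of N^1(X_s) is v : nat => real with v 0 the coefficient of H, v i the
  coefficient of E_i (1 \<le> i \<le> s), and v i = 0 for i > s. So dH - sum m_i E_i has
  v 0 = d and v i = - m_i.\<close>

definition in_N :: "nat \<Rightarrow> (nat \<Rightarrow> real) \<Rightarrow> bool" where
  "in_N s v \<longleftrightarrow> (\<forall>i>s. v i = 0)"

definition inter :: "nat \<Rightarrow> (nat \<Rightarrow> real) \<Rightarrow> (nat \<Rightarrow> real) \<Rightarrow> real" where
  "inter s v w = v 0 * w 0 - (\<Sum>i=1..s. v i * w i)"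

definition integral_vec :: "nat \<Rightarrow> (nat \<Rightarrow> real) \<Rightarrow> bool" where
  "integral_vec s v \<longleftrightarrow> in_N s v \<and> (\<forall>i. v i \<in> \<int>)"

text \<open>An integral class dH - sum m_i E_i is effective on X_s (blow-up at very general points)
  iff d \<ge> 0 and there is a nonzero plane curve of degree d with multiplicity
  \<ge> max(m_i,0) at p_i, for very general points p_1..p_s.\<close>

definition effective_class :: "nat \<Rightarrow> (nat \<Rightarrow> real) \<Rightarrow> bool" where
  "effective_class s D \<longleftrightarrow> integral_vec s D \<and> D 0 \<ge> 0 \<and>
     very_general s (\<lambda>p. \<exists>c. nonzero_form (nat \<lfloor>D 0\<rfloor>) c \<and>
        (\<forall>i\<in>{1..s}. vanishes_to_order (nat \<lfloor>D 0\<rfloor>) c (p i) (nat \<lfloor>- D i\<rfloor>)))"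

definition is_ray :: "nat \<Rightarrow> (nat \<Rightarrow> real) set \<Rightarrow> bool" where
  "is_ray s R \<longleftrightarrow> (\<exists>v. in_N s v \<and> v \<noteq> (\<lambda>_. 0) \<and> R = {(\<lambda>i. t * v i) | t. t \<ge> 0})"

definition rational_ray :: "nat \<Rightarrow> (nat \<Rightarrow> real) set \<Rightarrow> bool" where
  "rational_ray s R \<longleftrightarrow> (\<exists>x\<in>R. x \<noteq> (\<lambda>_. 0) \<and> integral_vec s x)"

definition nef_ray :: "nat \<Rightarrow> (nat \<Rightarrow> real) set \<Rightarrow> bool" where
  "nef_ray s R \<longleftrightarrow> (\<forall>x\<in>R. \<forall>D. effective_class s D \<longrightarrow> inter s x D \<ge> 0)"

definition self_int_zero :: "nat \<Rightarrow> (nat \<Rightarrow> real) set \<Rightarrow> bool" where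
  "self_int_zero s R \<longleftrightarrow> (\<forall>x\<in>R. inter s x x = 0)"

definition wonderful_ray :: "nat \<Rightarrow> (nat \<Rightarrow> real) set \<Rightarrow> bool" where
  "wonderful_ray s R \<longleftrightarrow> is_ray s R \<and> nef_ray s R \<and> \<not> rational_ray s R \<and> self_int_zero s R"

definition ray_dot_pos :: "nat \<Rightarrow> (nat \<Rightarrow> real) set \<Rightarrow> (nat \<Rightarrow> real) \<Rightarrow> bool" where
  "ray_dot_pos s R w \<longleftrightarrow> (\<forall>x\<in>R. x \<noteq> (\<lambda>_. 0) \<longrightarrow> inter s x w > 0)"

definition ray_dot_neg :: "nat \<Rightarrow> (nat \<Rightarrow> real) set \<Rightarrow> (nat \<Rightarrow> real) \<Rightarrow> bool" where
  "ray_dot_neg s R w \<longleftrightarrow> (\<forall>x\<in>R. x \<noteq> (\<lambda>_. 0) \<longrightarrow> inter s x w < 0)"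

definition canonical :: "nat \<Rightarrow> nat \<Rightarrow> real" where
  "canonical s i = (if i = 0 then -3 else if i \<le> s then 1 else 0)"

definition defernex :: "nat \<Rightarrow> nat \<Rightarrow> real" where
  "defernex s i = (if i = 0 then sqrt (real s - 1) else if i \<le> s then -1 else 0)"

definition defernex_negative :: "nat \<Rightarrow> (nat \<Rightarrow> real) set \<Rightarrow> bool" where
  "defernex_negative s R \<longleftrightarrow> ray_dot_neg s R (defernex s)"

end

theory Submission
  imports Defs "HOL-Analysis.Analysis" "HOL-Computational_Algebra.Polynomial"
begin

text \<open>If a class is effective for very general points then, forms of bounded degree being compact up to
  scaling, it is effective for every configuration of points. Two operations therefore preserve nefness of
  \<open>dH - \<Sum> m\<^sub>i E\<^sub>i\<close>: quadratic Cremona transformations, and replacing a point of multiplicity \<open>m\<close> by \<open>h\<^sup>2\<close> points of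
  multiplicity \<open>m / h\<close>; for the latter, let the \<open>h\<^sup>2\<close> points collide, arranged as a square grid, so that a
  curve of degree \<open>\<mu>\<close> has multiplicities of sum at most \<open>h \<mu>\<close> there.

  On ten points, every integral isotropic class orthogonal to \<open>K\<close> of positive degree is reduced by Cremona
  transformations to a multiple of \<open>3H - E\<^sub>1 - \<dots> - E\<^sub>9\<close>, hence is nef. These classes are dense in the real
  isotropic cone of \<open>K\<^sup>\<bottom>\<close>, so every isotropic class there is nef, and most are irrational. Splitting the \<open>i\<close>-th
  point into \<open>h\<^sub>i\<^sup>2\<close> points raises \<open>\<Sum> m\<^sub>i\<close> to \<open>\<Sum> m\<^sub>i h\<^sub>i\<close>: one \<open>h\<^sub>i = 2\<close> makes the ray \<open>K\<close>-positive, and a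
  vector \<open>h\<close> with \<open>\<Sum> h\<^sub>i\<^sup>2 = s\<close> nearly proportional to an isotropic class makes it De Fernex negative.\<close>

section \<open>Polynomial functions and orders of vanishing\<close>

text \<open>On nine points the isotropic vectors orthogonal to K are the multiples of K. Ten points
  are the first case with more: in degree 1 they form a sphere of squared radius 1/10 around the
  vector with all m_i = 3/10. If the m_i^2 sum to d^2 and the h_i^2 to s, Cauchy-Schwarz bounds the
  sum of m_i h_i by d sqrt(s). De Fernex negativity asks for more than d sqrt(s - 1), so h has to be
  almost proportional to m. For s = k^2 + 2 and s = k^2 + 4 the vector h is an integral class of
  degree k orthogonal to K, close to the isotropic cone because its self-intersection is k^2 - s.
  The numbers 14 and 20 are not sums of ten positive squares. For them a Cremona transformation
  based at two of the ten points and at an eleventh point of multiplicity 0 yields a nef class with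
  eleven multiplicities to split. Testing nefness against classes that are effective at every
  configuration frees both operations from generality assumptions: positions of points, and limits
  of positions, can be chosen at will.\<close>

definition form_eval :: "nat \<Rightarrow> (nat \<Rightarrow> nat \<Rightarrow> complex) \<Rightarrow> complex \<times> complex \<Rightarrow> complex" where
  "form_eval d c z = (\<Sum>i\<le>d. \<Sum>j\<le>d - i. c i j * fst z ^ i * snd z ^ j)"

text \<open>The degree bound is attached to the function and the coefficients stay hidden, so that
  sums, products and affine substitutions need no coefficient formulas.\<close>

definition bipoly :: "nat \<Rightarrow> (complex \<times> complex \<Rightarrow> complex) \<Rightarrow> bool" where
  "bipoly d f \<longleftrightarrow> (\<exists>c. f = form_eval d c)"

lemma form_eval_alt: "form_eval d c z = (\<Sum>(i,j)\<in>Sigma {..d} (\<lambda>i. {..d - i}). c i j * fst z ^ i * snd z ^ j)"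
  unfolding form_eval_def by (subst sum.Sigma) auto

lemma form_eval_alt2: "form_eval d c z = (\<Sum>(i,j)\<in>{(i,j). i + j \<le> d}. c i j * fst z ^ i * snd z ^ j)"
proof -
  have "Sigma {..d} (\<lambda>i. {..d - i}) = {(i,j). i + j \<le> d}"
    by auto
  then show ?thesis by (simp add: form_eval_alt)
qed

lemma finite_deg_le [simp]: "finite {(i::nat,j). i + j \<le> d}"
  by (rule finite_subset[of _ "{..d} \<times> {..d}"]) auto

lemma bipoly_monom:
  assumes "i + j \<le> d"
  shows "bipoly d (\<lambda>z. a * fst z ^ i * snd z ^ j)"
  unfolding bipoly_def
proof (intro exI ext)
  fix z :: "complex \<times> complex"
  let ?c = "\<lambda>k l. if (k,l) = (i,j) then a else 0"
  have "form_eval d ?c z = (\<Sum>x\<in>{(i,j). i + j \<le> d}. if x = (i,j) then a * fst z ^ i * snd z ^ j else 0)"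
    unfolding form_eval_alt2 by (intro sum.cong) (auto split: if_splits)
  also have "\<dots> = a * fst z ^ i * snd z ^ j"
    using assms by (simp add: sum.delta)
  finally show "a * fst z ^ i * snd z ^ j = form_eval d ?c z" by simp
qed

lemma bipoly_add: "bipoly d f \<Longrightarrow> bipoly d g \<Longrightarrow> bipoly d (\<lambda>z. f z + g z)"
  unfolding bipoly_def form_eval_alt2
  apply clarify
  subgoal for c c'
    by (rule exI[of _ "\<lambda>i j. c i j + c' i j"])
       (auto simp: fun_eq_iff sum.distrib[symmetric] algebra_simps intro!: sum.cong)
  done

lemma bipoly_zero: "bipoly d (\<lambda>z. 0)"
  using bipoly_monom[of 0 0 d 0] by simp

lemma bipoly_const: "bipoly d (\<lambda>z. a)"
  using bipoly_monom[of 0 0 d a] by simp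

lemma bipoly_fst: "bipoly (Suc 0) fst"
  using bipoly_monom[of 1 0 1 1] by simp

lemma bipoly_snd: "bipoly (Suc 0) snd"
  using bipoly_monom[of 0 1 1 1] by simp

lemma bipoly_sum: "(\<And>x. x \<in> A \<Longrightarrow> bipoly d (f x)) \<Longrightarrow> bipoly d (\<lambda>z. \<Sum>x\<in>A. f x z)"
  by (induction A rule: infinite_finite_induct) (auto intro: bipoly_zero bipoly_add)

lemma bipoly_mono:
  assumes "bipoly a f" "a \<le> b" shows "bipoly b f"
proof -
  from assms(1) obtain c where c: "f = form_eval a c" unfolding bipoly_def by blast
  have "bipoly b (\<lambda>z. \<Sum>x\<in>{(i,j). i + j \<le> a}. case x of (i,j) \<Rightarrow> c i j * fst z ^ i * snd z ^ j)"
    using assms(2) by (intro bipoly_sum) (auto intro!: bipoly_monom)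
  then show ?thesis by (simp add: c form_eval_alt2[abs_def])
qed

lemma bipoly_mult:
  assumes "bipoly a f" "bipoly b g" shows "bipoly (a + b) (\<lambda>z. f z * g z)"
proof -
  from assms obtain c c' where c: "f = form_eval a c" "g = form_eval b c'" unfolding bipoly_def by blast
  have "(\<lambda>z. f z * g z) = (\<lambda>z. \<Sum>x\<in>{(i,j). i + j \<le> a}. \<Sum>y\<in>{(i,j). i + j \<le> b}.
     (c (fst x) (snd x) * c' (fst y) (snd y)) * fst z ^ (fst x + fst y) * snd z ^ (snd x + snd y))"
    unfolding c form_eval_alt2 sum_product
    by (intro ext sum.cong refl) (auto simp: power_add mult_ac)
  moreover have "bipoly (a + b) \<dots>"
    by (intro bipoly_sum bipoly_monom) auto
  ultimately show ?thesis by simp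
qed

lemma bipoly_cmult: "bipoly d f \<Longrightarrow> bipoly d (\<lambda>z. a * f z)"
  using bipoly_mult[OF bipoly_const[of 0 a]] by simp

lemma bipoly_power: "bipoly a f \<Longrightarrow> bipoly (n * a) (\<lambda>z. f z ^ n)"
  by (induction n) (auto intro: bipoly_mult bipoly_const)

lemma bipoly_diff: "bipoly d f \<Longrightarrow> bipoly d g \<Longrightarrow> bipoly d (\<lambda>z. f z - g z)"
  using bipoly_add[OF _ bipoly_cmult, of d f g "-1"] by simp

lemma bipoly_compose_affine:
  assumes "bipoly d f" "bipoly 1 u" "bipoly 1 v"
  shows "bipoly d (\<lambda>z. f (u z, v z))"
proof -
  from assms(1) obtain c where c: "f = form_eval d c" unfolding bipoly_def by blast
  have 1: "bipoly d (\<lambda>z. c i j * (u z ^ i * v z ^ j))" if "i + j \<le> d" for i j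
  proof (rule bipoly_cmult, rule bipoly_mono)
    show "bipoly (i * 1 + j * 1) (\<lambda>z. u z ^ i * v z ^ j)"
      by (intro bipoly_mult bipoly_power assms)
  qed (use that in simp)
  have "bipoly d (\<lambda>z. \<Sum>x\<in>{(i,j). i + j \<le> d}. case x of (i,j) \<Rightarrow> c i j * (u z ^ i * v z ^ j))"
    using 1 by (intro bipoly_sum) auto
  then show ?thesis by (simp add: c form_eval_alt2 mult.assoc)
qed

lemma bipoly_nonzero_form:
  assumes "bipoly d f" "f z \<noteq> 0" obtains c where "f = form_eval d c" "nonzero_form d c"
proof -
  from assms(1) obtain c where c: "f = form_eval d c" unfolding bipoly_def by blast
  have "nonzero_form d c"
  proof (rule ccontr)
    assume "\<not> nonzero_form d c"
    then have "form_eval d c z = 0" unfolding form_eval_alt2 nonzero_form_def by (intro sum.neutral) auto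
    with assms c show False by simp
  qed
  with c that show ?thesis by blast
qed

section \<open>Taylor coefficients at a point\<close>

definition taylor :: "nat \<Rightarrow> (nat \<Rightarrow> nat \<Rightarrow> complex) \<Rightarrow> complex \<times> complex \<Rightarrow> nat \<Rightarrow> nat \<Rightarrow> complex" where
  "taylor d c pt k l = (\<Sum>i\<le>d. \<Sum>j\<le>d - i. if k \<le> i \<and> l \<le> j
             then c i j * of_nat (i choose k) * of_nat (j choose l) * fst pt ^ (i - k) * snd pt ^ (j - l)
             else 0)"

lemma vanishes_iff_taylor:
  "vanishes_to_order d c pt m \<longleftrightarrow> (\<forall>k l. k + l < m \<longrightarrow> taylor d c pt k l = 0)"
  unfolding vanishes_to_order_def taylor_def by simp

text \<open>Summing up to the common bound \<open>d\<close> instead of \<open>i\<close> makes the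
  index set independent of \<open>i\<close>; the sums over monomials and over derivatives can then
  be interchanged.\<close>

lemma binomial_bounded:
  fixes x y :: complex
  assumes "i \<le> d"
  shows "(x + y) ^ i = (\<Sum>k\<le>d. if k \<le> i then of_nat (i choose k) * x ^ (i - k) * y ^ k else 0)"
proof -
  have "(x + y) ^ i = (y + x) ^ i" by (simp add: add.commute)
  also have "\<dots> = (\<Sum>k\<le>i. of_nat (i choose k) * y ^ k * x ^ (i - k))"
    by (rule binomial_ring)
  also have "\<dots> = (\<Sum>k\<le>d. if k \<le> i then of_nat (i choose k) * x ^ (i - k) * y ^ k else 0)"
    using assms by (intro sum.mono_neutral_cong_left) (auto simp: mult_ac)
  finally show ?thesis .
qed

lemma taylor_eq_0: "d < k + l \<Longrightarrow> taylor d c p k l = 0"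
  unfolding taylor_def by (intro sum.neutral ballI) auto

lemma form_eval_taylor: "form_eval d c (p + u) = form_eval d (taylor d c p) u"
proof -
  let ?A = "Sigma {..d} (\<lambda>i. {..d - i})"
  let ?B = "{..d} \<times> {..d}"
  let ?g = "\<lambda>(i,j) (k,l). (if k \<le> i \<and> l \<le> j
             then c i j * of_nat (i choose k) * of_nat (j choose l) * fst p ^ (i - k) * snd p ^ (j - l)
             else 0) * fst u ^ k * snd u ^ l"
  have "form_eval d c (p + u) = (\<Sum>x\<in>?A. \<Sum>y\<in>?B. ?g x y)"
    unfolding form_eval_alt
  proof (intro sum.cong refl)
    fix x assume "x \<in> ?A"
    then obtain i j where x: "x = (i,j)" and "i \<le> d" "j \<le> d - i" by auto
    then have "c i j * fst (p + u) ^ i * snd (p + u) ^ j = c i j *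
     (\<Sum>k\<le>d. if k \<le> i then of_nat (i choose k) * fst p ^ (i - k) * fst u ^ k else 0) *
     (\<Sum>l\<le>d. if l \<le> j then of_nat (j choose l) * snd p ^ (j - l) * snd u ^ l else 0)"
      by (simp add: binomial_bounded[of _ d])
    also have "\<dots> = (\<Sum>k\<le>d. \<Sum>l\<le>d. ?g (i,j) (k,l))"
      unfolding mult.assoc[of "c i j"] sum_product unfolding sum_distrib_left
      by (intro sum.cong refl) (simp split: if_split)
    also have "\<dots> = (\<Sum>y\<in>?B. ?g (i,j) y)"
      by (simp add: sum.cartesian_product')
    finally show "(case x of (i,j) \<Rightarrow> c i j * fst (p + u) ^ i * snd (p + u) ^ j) = (\<Sum>y\<in>?B. ?g x y)"
      by (simp add: x)
  qed
  also have "\<dots> = (\<Sum>y\<in>?B. \<Sum>x\<in>?A. ?g x y)"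
    by (rule sum.swap)
  also have "\<dots> = (\<Sum>(k,l)\<in>?B. taylor d c p k l * fst u ^ k * snd u ^ l)"
    unfolding taylor_def sum_distrib_right
    by (intro sum.cong refl, clarify, subst sum.Sigma) (auto simp: case_prod_unfold intro!: sum.cong)
  also have "\<dots> = form_eval d (taylor d c p) u"
    unfolding form_eval_alt2 by (rule sum.mono_neutral_right) (auto, metis taylor_eq_0 not_le)
  finally show ?thesis .
qed

text \<open>Expressed as a growth bound, the order of vanishing is visibly preserved by composition with
  differentiable maps.\<close>

definition order_ge :: "(complex \<times> complex \<Rightarrow> complex) \<Rightarrow> complex \<times> complex \<Rightarrow> nat \<Rightarrow> bool" where
  "order_ge f p m \<longleftrightarrow> (\<exists>C. \<forall>\<^sub>F x in nhds p. norm (f x) \<le> C * dist x p ^ m)"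

lemma order_ge_pos:
  assumes "order_ge f p m"
  obtains C where "C > 0" "\<forall>\<^sub>F x in nhds p. norm (f x) \<le> C * dist x p ^ m"
proof -
  from assms obtain C where C: "\<forall>\<^sub>F x in nhds p. norm (f x) \<le> C * dist x p ^ m"
    unfolding order_ge_def by blast
  show ?thesis
  proof (rule that[of "max C 1"])
    show "\<forall>\<^sub>F x in nhds p. norm (f x) \<le> max C 1 * dist x p ^ m"
      using C
    proof eventually_elim
      case (elim x)
      have "C * dist x p ^ m \<le> max C 1 * dist x p ^ m" by (intro mult_right_mono) auto
      with elim show ?case by linarith
    qed
  qed auto
qed

lemma eventually_dist_less: "e > 0 \<Longrightarrow> \<forall>\<^sub>F x in nhds (p::'a::metric_space). dist x p < e"
  by (auto simp: eventually_nhds_metric)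

lemma order_ge_antimono:
  assumes "order_ge f p m" "n \<le> m" shows "order_ge f p n"
proof -
  from assms(1) obtain C where C: "C > 0" "\<forall>\<^sub>F x in nhds p. norm (f x) \<le> C * dist x p ^ m"
    by (rule order_ge_pos)
  have "\<forall>\<^sub>F x in nhds p. norm (f x) \<le> C * dist x p ^ n"
    using C(2) eventually_dist_less[OF zero_less_one, of p]
  proof eventually_elim
    case (elim x)
    have "dist x p ^ m \<le> dist x p ^ n" using assms(2) elim by (intro power_decreasing) auto
    then have "C * dist x p ^ m \<le> C * dist x p ^ n" using C(1) by simp
    with elim show ?case by linarith
  qed
  then show ?thesis unfolding order_ge_def by blast
qed

lemma order_ge_mult:
  assumes "order_ge f p m" "order_ge g p n" shows "order_ge (\<lambda>z. f z * g z) p (m + n)"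
proof -
  from assms(1) obtain C where C: "C > 0" "\<forall>\<^sub>F x in nhds p. norm (f x) \<le> C * dist x p ^ m"
    by (rule order_ge_pos)
  from assms(2) obtain D where D: "D > 0" "\<forall>\<^sub>F x in nhds p. norm (g x) \<le> D * dist x p ^ n"
    by (rule order_ge_pos)
  have "\<forall>\<^sub>F x in nhds p. norm (f x * g x) \<le> (C * D) * dist x p ^ (m + n)"
    using C(2) D(2)
  proof eventually_elim
    case (elim x)
    have "norm (f x * g x) = norm (f x) * norm (g x)" by (rule norm_mult)
    also have "\<dots> \<le> (C * dist x p ^ m) * (D * dist x p ^ n)"
      using elim C D by (intro mult_mono) auto
    finally show ?case by (simp add: power_add mult_ac)
  qed
  then show ?thesis unfolding order_ge_def by blast
qed

lemma order_ge_0: assumes "isCont f p" shows "order_ge f p 0"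
proof -
  have "(f \<longlongrightarrow> f p) (nhds p)" using assms by (simp add: isCont_def tendsto_nhds_iff)
  then have "\<forall>\<^sub>F x in nhds p. dist (f x) (f p) < 1" by (rule tendstoD) simp
  then have "\<forall>\<^sub>F x in nhds p. norm (f x) \<le> (norm (f p) + 1) * dist x p ^ 0"
  proof eventually_elim
    case (elim x)
    then show ?case using norm_triangle_sub[of "f x" "f p"] by (simp add: dist_norm)
  qed
  then show ?thesis unfolding order_ge_def by blast
qed

lemma order_ge_mult_cont:
  assumes "order_ge f p m" "isCont h p" shows "order_ge (\<lambda>z. h z * f z) p m"
  using order_ge_mult[OF order_ge_0[OF assms(2)] assms(1)] by simp

lemma order_ge_power: "order_ge f p 1 \<Longrightarrow> order_ge (\<lambda>z. f z ^ n) p n"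
proof (induction n)
  case 0
  show ?case by (simp add: order_ge_0)
next
  case (Suc n)
  then show ?case using order_ge_mult[of f p 1 "\<lambda>z. f z ^ n" n] by simp
qed

lemma order_ge_cong:
  assumes "order_ge f p m" "\<forall>\<^sub>F x in nhds p. f x = g x" shows "order_ge g p m"
proof -
  from assms(1) obtain C where "\<forall>\<^sub>F x in nhds p. norm (f x) \<le> C * dist x p ^ m"
    unfolding order_ge_def by blast
  with assms(2) have "\<forall>\<^sub>F x in nhds p. norm (g x) \<le> C * dist x p ^ m"
    by eventually_elim simp
  then show ?thesis unfolding order_ge_def by blast
qed

lemma order_ge_add:
  assumes "order_ge f p m" "order_ge g p m" shows "order_ge (\<lambda>z. f z + g z) p m"
proof -
  from assms(1) obtain C where C: "C > 0" "\<forall>\<^sub>F x in nhds p. norm (f x) \<le> C * dist x p ^ m"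
    by (rule order_ge_pos)
  from assms(2) obtain D where D: "D > 0" "\<forall>\<^sub>F x in nhds p. norm (g x) \<le> D * dist x p ^ m"
    by (rule order_ge_pos)
  have "\<forall>\<^sub>F x in nhds p. norm (f x + g x) \<le> (C + D) * dist x p ^ m"
    using C(2) D(2)
  proof eventually_elim
    case (elim x)
    then show ?case using norm_triangle_ineq[of "f x" "g x"] by (simp add: distrib_right)
  qed
  then show ?thesis unfolding order_ge_def by blast
qed

lemma order_ge_zero: "order_ge (\<lambda>z. 0) p m"
  unfolding order_ge_def by (rule exI[of _ 0]) simp

lemma order_ge_sum: "(\<And>x. x \<in> A \<Longrightarrow> order_ge (f x) p m) \<Longrightarrow> order_ge (\<lambda>z. \<Sum>x\<in>A. f x z) p m"
  by (induction A rule: infinite_finite_induct) (auto intro: order_ge_zero order_ge_add)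

lemma order_ge_compose:
  assumes f: "order_ge f (g q) m" and g: "(g has_derivative g') (at q)"
  shows "order_ge (\<lambda>x. f (g x)) q m"
proof -
  from f obtain C where C: "C > 0" "\<forall>\<^sub>F x in nhds (g q). norm (f x) \<le> C * dist x (g q) ^ m"
    by (rule order_ge_pos)
  have "isCont g q" using g by (rule has_derivative_continuous)
  then have "filterlim g (nhds (g q)) (nhds q)" by (simp add: isCont_def tendsto_nhds_iff)
  with C(2) have 1: "\<forall>\<^sub>F x in nhds q. norm (f (g x)) \<le> C * dist (g x) (g q) ^ m"
    unfolding filterlim_iff by blast
  from g have bl: "bounded_linear g'" by (rule has_derivative_bounded_linear)
  then obtain K where K: "\<And>x. norm (g' x) \<le> norm x * K" using bounded_linear.bounded by blast
  from g obtain d where d: "d > 0" "\<And>y. norm (y - q) < d \<Longrightarrow> norm (g y - g q - g' (y - q)) \<le> 1 * norm (y - q)"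
    unfolding has_derivative_at_alt using zero_less_one by blast
  have 2: "\<forall>\<^sub>F x in nhds q. dist (g x) (g q) \<le> (\<bar>K\<bar> + 1) * dist x q"
    using eventually_dist_less[OF d(1), of q]
  proof eventually_elim
    case (elim x)
    have "norm (g x - g q) \<le> norm (g x - g q - g' (x - q)) + norm (g' (x - q))"
      by (rule order_trans[OF _ norm_triangle_ineq]) simp
    also have "\<dots> \<le> norm (x - q) + norm (x - q) * \<bar>K\<bar>"
    proof (rule add_mono)
      show "norm (g x - g q - g' (x - q)) \<le> norm (x - q)"
        using d(2)[of x] elim by (simp add: dist_norm)
      have "norm (x - q) * K \<le> norm (x - q) * \<bar>K\<bar>" by (intro mult_left_mono) auto
      with K[of "x - q"] show "norm (g' (x - q)) \<le> norm (x - q) * \<bar>K\<bar>" by linarith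
    qed
    finally show ?case by (simp add: dist_norm algebra_simps)
  qed
  from 1 2 have "\<forall>\<^sub>F x in nhds q. norm (f (g x)) \<le> (C * (\<bar>K\<bar> + 1) ^ m) * dist x q ^ m"
  proof eventually_elim
    case (elim x)
    have "dist (g x) (g q) ^ m \<le> ((\<bar>K\<bar> + 1) * dist x q) ^ m"
      using elim by (intro power_mono) auto
    then have "C * dist (g x) (g q) ^ m \<le> C * ((\<bar>K\<bar> + 1) * dist x q) ^ m"
      using C by simp
    with elim show ?case by (simp add: power_mult_distrib mult.assoc)
  qed
  then show ?thesis unfolding order_ge_def by blast
qed

lemma order_ge_fst: "order_ge (\<lambda>z. fst (z - p)) p 1"
proof -
  have "norm (fst w) \<le> norm w" for w :: "complex \<times> complex"
    using norm_fst_le[of "fst w" "snd w"] by simp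
  then show ?thesis
    unfolding order_ge_def by (intro exI[of _ 1] always_eventually) (simp add: dist_norm del: fst_diff)
qed

lemma order_ge_snd: "order_ge (\<lambda>z. snd (z - p)) p 1"
proof -
  have "norm (snd w) \<le> norm w" for w :: "complex \<times> complex"
    using norm_snd_le[of "snd w" "fst w"] by simp
  then show ?thesis
    unfolding order_ge_def by (intro exI[of _ 1] always_eventually) (simp add: dist_norm del: snd_diff)
qed

text \<open>The constant coefficient is the limit at 0, hence zero. Dividing by \<open>t\<close>
  leaves the same kind of bound with exponent one less.\<close>

lemma poly_small_imp_coeff_0:
  fixes q :: "complex poly"
  assumes "\<forall>\<^sub>F t in at 0. norm (poly q t) \<le> C * norm t ^ m" "n < m"
  shows "coeff q n = 0"
  using assms
proof (induction m arbitrary: q n)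
  case 0
  then show ?case by simp
next
  case (Suc m)
  have lim: "((\<lambda>t. poly q t) \<longlongrightarrow> poly q 0) (at 0)"
    by (intro tendsto_intros)
  have "((\<lambda>t::complex. C * norm t ^ Suc m) \<longlongrightarrow> C * norm (0::complex) ^ Suc m) (at 0)"
    by (intro tendsto_intros)
  then have "((\<lambda>t::complex. C * norm t ^ Suc m) \<longlongrightarrow> 0) (at 0)" by simp
  then have "((\<lambda>t. poly q t) \<longlongrightarrow> 0) (at 0)"
    by (rule Lim_null_comparison[rotated]) (use Suc.prems in simp)
  with lim have q0: "poly q 0 = 0" by (rule LIM_unique)
  obtain a r where q: "q = pCons a r" by (cases q)
  have a: "a = 0" using q0 q by simp
  have "\<forall>\<^sub>F t in at 0. norm (poly r t) \<le> C * norm t ^ m"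
    using Suc.prems(1) eventually_neq_at_within[of 0 0 UNIV]
  proof eventually_elim
    case (elim t)
    then have "norm t * norm (poly r t) \<le> norm t * (C * norm t ^ m)"
      by (simp add: q a norm_mult mult_ac)
    with elim show ?case by simp
  qed
  from Suc.IH[OF this] have IH: "n < m \<Longrightarrow> coeff r n = 0" for n .
  show ?case
    using IH Suc.prems(2) by (cases n) (auto simp: q a)
qed

lemma form_eval_as_univariate: "form_eval d c (t * u, t * v) = poly (\<Sum>n\<le>d. monom (\<Sum>i\<le>n. c i (n - i) * u ^ i * v ^ (n - i)) n) t"
proof -
  have "poly (\<Sum>n\<le>d. monom (\<Sum>i\<le>n. c i (n - i) * u ^ i * v ^ (n - i)) n) t
    = (\<Sum>n\<le>d. \<Sum>i\<le>n. c i (n - i) * u ^ i * v ^ (n - i) * t ^ n)"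
    by (simp add: poly_sum poly_monom sum_distrib_right)
  also have "\<dots> = (\<Sum>(n,i)\<in>Sigma {..d} (\<lambda>n. {..n}). c i (n - i) * u ^ i * v ^ (n - i) * t ^ n)"
    by (subst sum.Sigma) auto
  also have "\<dots> = (\<Sum>(i,j)\<in>{(i,j). i + j \<le> d}. c i j * (t * u) ^ i * (t * v) ^ j)"
    by (rule sum.reindex_bij_witness[of _ "\<lambda>(i,j). (i + j, i)" "\<lambda>(n,i). (i, n - i)"])
       (auto simp: power_mult_distrib power_add[symmetric] mult_ac)
  also have "\<dots> = form_eval d c (t * u, t * v)" by (simp add: form_eval_alt2)
  finally show ?thesis by simp
qed

text \<open>On every line through the origin the form becomes a polynomial in \<open>t\<close>
  bounded by a multiple of |t|^m, so its homogeneous part of degree \<open>k + l\<close> vanishes at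
  every \<open>(u, v)\<close>. At \<open>v = 1\<close> this part is a univariate polynomial without
  nonzero values, so all its coefficients vanish.\<close>

lemma order_ge_0_imp_coeff:
  assumes "order_ge (form_eval d c) (0, 0) m" "k + l < m" "k + l \<le> d"
  shows "c k l = 0"
proof -
  from assms(1) obtain C where C: "C > 0" "\<forall>\<^sub>F x in nhds (0,0). norm (form_eval d c x) \<le> C * dist x (0,0) ^ m"
    by (rule order_ge_pos)
  define n where "n = k + l"
  have 1: "(\<Sum>i\<le>n. c i (n - i) * u ^ i * v ^ (n - i)) = 0" for u v
  proof -
    have "((\<lambda>t. (t * u, t * v)) \<longlongrightarrow> (0 * u, 0 * v)) (at 0)"
      by (intro tendsto_intros)
    then have "filterlim (\<lambda>t. (t * u, t * v)) (nhds (0,0)) (at 0)" by simp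
    with C(2) have "\<forall>\<^sub>F t in at 0. norm (form_eval d c (t * u, t * v)) \<le> C * dist (t * u, t * v) (0,0) ^ m"
      unfolding filterlim_iff by blast
    moreover have "dist (t * u, t * v) (0,0) = norm t * norm (u, v)" for t
      by (simp add: dist_norm norm_Pair norm_mult power_mult_distrib distrib_left[symmetric] real_sqrt_mult)
    ultimately have "\<forall>\<^sub>F t in at 0. norm (poly (\<Sum>n\<le>d. monom (\<Sum>i\<le>n. c i (n - i) * u ^ i * v ^ (n - i)) n) t)
       \<le> (C * norm (u, v) ^ m) * norm t ^ m"
      by (simp add: form_eval_as_univariate power_mult_distrib mult_ac)
    from poly_small_imp_coeff_0[OF this, of n] show ?thesis
      using assms by (simp add: n_def coeff_sum)
  qed
  have "poly (\<Sum>i\<le>n. monom (c i (n - i)) i) u = poly 0 u" for u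
    using 1[of u 1] by (simp add: poly_sum poly_monom)
  then have "(\<Sum>i\<le>n. monom (c i (n - i)) i) = 0"
    by (intro poly_eq_poly_eq_iff[THEN iffD1] ext)
  then have "coeff (\<Sum>i\<le>n. monom (c i (n - i)) i) k = 0" by simp
  then show ?thesis by (simp add: coeff_sum n_def)
qed

lemma coeff_imp_order_ge:
  assumes "\<And>k l. k + l < m \<Longrightarrow> k + l \<le> d \<Longrightarrow> c k l = 0"
  shows "order_ge (\<lambda>z. form_eval d c (z - p)) p m"
  unfolding form_eval_alt2
proof (rule order_ge_sum, clarify)
  fix i j assume ij: "i + j \<le> d"
  show "order_ge (\<lambda>z. c i j * fst (z - p) ^ i * snd (z - p) ^ j) p m"
  proof (cases "i + j < m")
    case True
    then show ?thesis using assms[OF True ij] by (simp add: order_ge_zero)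
  next
    case False
    have "order_ge (\<lambda>z. c i j * (fst (z - p) ^ i * snd (z - p) ^ j)) p (i + j)"
      by (intro order_ge_mult_cont order_ge_mult order_ge_power order_ge_fst order_ge_snd) simp
    with False show ?thesis by (auto simp: mult.assoc intro: order_ge_antimono)
  qed
qed

text \<open>Both directions move \<open>p\<close> to the origin by the Taylor expansion.
  Multiplicities can then be treated through \<open>order_ge\<close>, which does not depend on
  coordinates.\<close>

lemma vanishes_iff_order_ge: "vanishes_to_order d c p m \<longleftrightarrow> order_ge (form_eval d c) p m"
proof
  assume "vanishes_to_order d c p m"
  then have "order_ge (\<lambda>z. form_eval d (taylor d c p) (z - p)) p m"
    by (intro coeff_imp_order_ge) (auto simp: vanishes_iff_taylor)
  then show "order_ge (form_eval d c) p m" by (simp add: form_eval_taylor[symmetric])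
next
  assume v: "order_ge (form_eval d c) p m"
  have "order_ge (\<lambda>u. form_eval d c (p + u)) (0,0) m"
  proof (rule order_ge_compose)
    show "order_ge (form_eval d c) (p + (0,0)) m" using v by (simp add: zero_prod_def[symmetric])
    show "((\<lambda>u. p + u) has_derivative (\<lambda>u. u)) (at (0, 0))"
      by (auto intro!: derivative_eq_intros)
  qed
  then have "order_ge (form_eval d (taylor d c p)) (0,0) m" by (simp add: form_eval_taylor)
  then show "vanishes_to_order d c p m"
    unfolding vanishes_iff_taylor using order_ge_0_imp_coeff taylor_eq_0
    by (metis not_le)
qed

section \<open>Specialization to arbitrary configurations of points\<close>

definition polyfun :: "(complex \<Rightarrow> complex) \<Rightarrow> bool" where
  "polyfun g \<longleftrightarrow> (\<exists>q. g = poly q)"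

lemma polyfun_const: "polyfun (\<lambda>t. a)"
  unfolding polyfun_def by (rule exI[of _ "[:a:]"]) auto

lemma polyfun_id: "polyfun (\<lambda>t. t)"
  unfolding polyfun_def by (rule exI[of _ "[:0,1:]"]) auto

lemma polyfun_add: "polyfun f \<Longrightarrow> polyfun g \<Longrightarrow> polyfun (\<lambda>t. f t + g t)"
  unfolding polyfun_def
  apply (elim exE)
  subgoal for p q by (rule exI[of _ "p + q"]) (simp add: fun_eq_iff)
  done

lemma polyfun_mult: "polyfun f \<Longrightarrow> polyfun g \<Longrightarrow> polyfun (\<lambda>t. f t * g t)"
  unfolding polyfun_def
  apply (elim exE)
  subgoal for p q by (rule exI[of _ "p * q"]) (simp add: fun_eq_iff)
  done

lemma polyfun_diff: "polyfun f \<Longrightarrow> polyfun g \<Longrightarrow> polyfun (\<lambda>t. f t - g t)"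
  unfolding polyfun_def
  apply (elim exE)
  subgoal for p q by (rule exI[of _ "p - q"]) (simp add: fun_eq_iff)
  done

lemma polyfun_power: "polyfun f \<Longrightarrow> polyfun (\<lambda>t. f t ^ n)"
  by (induction n) (auto intro: polyfun_const polyfun_mult)

lemma polyfun_sum: "(\<And>x. x \<in> A \<Longrightarrow> polyfun (f x)) \<Longrightarrow> polyfun (\<lambda>t. \<Sum>x\<in>A. f x t)"
  by (induction A rule: infinite_finite_induct) (auto intro: polyfun_const polyfun_add)

lemma polyfun_prod: "(\<And>x. x \<in> A \<Longrightarrow> polyfun (f x)) \<Longrightarrow> polyfun (\<lambda>t. \<Prod>x\<in>A. f x t)"
  by (induction A rule: infinite_finite_induct) (auto intro: polyfun_const polyfun_mult)

lemmas polyfun_intros = polyfun_const polyfun_id polyfun_add polyfun_mult polyfun_diff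
  polyfun_power polyfun_sum polyfun_prod

lemma polyfun_finite_zeros:
  assumes "polyfun g" "g t0 \<noteq> 0" shows "finite {t. g t = 0}"
proof -
  from assms(1) obtain q where q: "g = poly q" unfolding polyfun_def by blast
  with assms(2) have "q \<noteq> 0" by auto
  then show ?thesis unfolding q by (rule poly_roots_finite)
qed

lemma polyfun_bipoly:
  assumes "bipoly d f" "polyfun u" "polyfun v"
  shows "polyfun (\<lambda>t. f (u t, v t))"
proof -
  from assms(1) obtain c where c: "f = form_eval d c" unfolding bipoly_def by blast
  show ?thesis unfolding c form_eval_def fst_conv snd_conv
    by (intro polyfun_intros assms)
qed

definition line_at :: "complex \<times> complex \<Rightarrow> complex \<times> complex \<Rightarrow> complex \<Rightarrow> complex \<times> complex" where
  "line_at p q t = (fst p + t * (fst q - fst p), snd p + t * (snd q - snd p))"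

lemma line_at_0 [simp]: "line_at p q 0 = p" and line_at_1 [simp]: "line_at p q 1 = q"
  by (auto simp: line_at_def)

lemma polyfun_fst_line_at: "polyfun (\<lambda>t. fst (line_at p q t))"
  and polyfun_snd_line_at: "polyfun (\<lambda>t. snd (line_at p q t))"
  unfolding line_at_def fst_conv snd_conv by (intro polyfun_intros)+

lemma polyfun_bipoly_line: "bipoly d f \<Longrightarrow> polyfun (\<lambda>t. f (line_at p q t))"
  unfolding line_at_def by (erule polyfun_bipoly; intro polyfun_intros)

text \<open>On the line joining the two points both functions are nonzero polynomials in the
  parameter, with finitely many zeros each.\<close>

lemma bipoly_mult_nonzero:
  assumes "bipoly a f" "bipoly b g" "f p \<noteq> 0" "g q \<noteq> 0"
  shows "\<exists>z. f z \<noteq> 0 \<and> g z \<noteq> 0"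
proof -
  let ?F = "{t. f (line_at p q t) = 0}" and ?G = "{t. g (line_at p q t) = 0}"
  have "finite ?F" by (rule polyfun_finite_zeros[of _ 0]) (use assms in \<open>auto intro: polyfun_bipoly_line\<close>)
  moreover have "finite ?G" by (rule polyfun_finite_zeros[of _ 1]) (use assms in \<open>auto intro: polyfun_bipoly_line\<close>)
  ultimately have "finite (?F \<union> ?G)" by simp
  then obtain t where "t \<notin> ?F \<union> ?G" using ex_new_if_finite infinite_UNIV_char_0 by blast
  then show ?thesis by blast
qed

section \<open>Avoiding countably many hypersurfaces\<close>

lemma avoid_countable:
  fixes r :: real
  assumes "countable B" "r > 0"
  obtains t :: complex where "t \<notin> B" "norm t < r"
proof -
  have "uncountable (ball (0::complex) r - B)"
    by (intro uncountable_minus_countable uncountable_ball assms)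
  then have "ball (0::complex) r - B \<noteq> {}" by force
  then obtain t where "t \<in> ball 0 r - B" by blast
  then show ?thesis by (intro that[of t]) auto
qed

text \<open>The coefficient of the \<open>k\<close>-th power of the last variable, as a polynomial
  in the first \<open>n\<close> variables. The exponent at \<open>n\<close> is reset to 0 so that
  the result satisfies \<open>is_mpoly n\<close>.\<close>

definition mslice :: "nat \<Rightarrow> nat \<Rightarrow> ((nat \<Rightarrow> nat) \<Rightarrow> complex) \<Rightarrow> (nat \<Rightarrow> nat) \<Rightarrow> complex" where
  "mslice n k f \<alpha> = (if \<alpha> n = 0 then f (\<alpha>(n := k)) else 0)"

lemma mslice_bij:
  "bij_betw (\<lambda>\<alpha>. \<alpha>(n := k)) {\<alpha>. mslice n k f \<alpha> \<noteq> 0} {\<alpha>. f \<alpha> \<noteq> 0 \<and> \<alpha> n = k}"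
  by (rule bij_betwI[of _ _ _ "\<lambda>\<alpha>. \<alpha>(n := 0)"]) (auto simp: mslice_def split: if_splits)

lemma nonzero_mpoly_mslice:
  assumes "nonzero_mpoly (Suc n) f" "f \<alpha> \<noteq> 0"
  shows "nonzero_mpoly n (mslice n (\<alpha> n) f)"
  unfolding nonzero_mpoly_def is_mpoly_def
proof (intro conjI allI impI exI)
  have "finite {\<beta>. f \<beta> \<noteq> 0}" using assms by (simp add: nonzero_mpoly_def is_mpoly_def)
  then have "finite {\<beta>. f \<beta> \<noteq> 0 \<and> \<beta> n = \<alpha> n}" by (rule rev_finite_subset) auto
  then show "finite {\<beta>. mslice n (\<alpha> n) f \<beta> \<noteq> 0}" using bij_betw_finite[OF mslice_bij] by blast
  show "mslice n (\<alpha> n) f (\<alpha>(n := 0)) \<noteq> 0" using assms(2) by (simp add: mslice_def)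
  fix \<beta> j assume b: "mslice n (\<alpha> n) f \<beta> \<noteq> 0" "n \<le> j"
  then have "\<beta> n = 0" "f (\<beta>(n := \<alpha> n)) \<noteq> 0" by (auto simp: mslice_def split: if_splits)
  moreover from this assms(1) have "(\<beta>(n := \<alpha> n)) j' = 0" if "j' \<ge> Suc n" for j'
    using that unfolding nonzero_mpoly_def is_mpoly_def by blast
  ultimately show "\<beta> j = 0" using b(2) by (metis Suc_leI fun_upd_other le_neq_implies_less)
qed

lemma mpoly_eval_Suc:
  assumes "is_mpoly (Suc n) f"
  shows "mpoly_eval (Suc n) f x = (\<Sum>k\<in>(\<lambda>\<alpha>. \<alpha> n) ` {\<alpha>. f \<alpha> \<noteq> 0}. mpoly_eval n (mslice n k f) x * x n ^ k)"
proof -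
  let ?S = "{\<alpha>. f \<alpha> \<noteq> 0}"
  have "mpoly_eval (Suc n) f x = (\<Sum>k\<in>(\<lambda>\<alpha>. \<alpha> n) ` ?S. \<Sum>\<alpha>\<in>{\<alpha>\<in>?S. \<alpha> n = k}. f \<alpha> * (\<Prod>j<Suc n. x j ^ \<alpha> j))"
    unfolding mpoly_eval_def using assms by (intro sum.image_gen) (simp add: is_mpoly_def)
  also have "\<dots> = (\<Sum>k\<in>(\<lambda>\<alpha>. \<alpha> n) ` ?S. mpoly_eval n (mslice n k f) x * x n ^ k)"
  proof (rule sum.cong[OF refl])
    fix k
    have "(\<Sum>\<alpha>\<in>{\<alpha>\<in>?S. \<alpha> n = k}. f \<alpha> * (\<Prod>j<Suc n. x j ^ \<alpha> j)) =
      (\<Sum>\<alpha>\<in>{\<alpha>. mslice n k f \<alpha> \<noteq> 0}. f (\<alpha>(n := k)) * (\<Prod>j<Suc n. x j ^ (\<alpha>(n := k)) j))"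
      by (rule sum.reindex_bij_betw[symmetric]) (use mslice_bij[of n k f] in simp)
    also have "\<dots> = (\<Sum>\<alpha>\<in>{\<alpha>. mslice n k f \<alpha> \<noteq> 0}. mslice n k f \<alpha> * (\<Prod>j<n. x j ^ \<alpha> j) * x n ^ k)"
      by (intro sum.cong refl) (auto simp: mslice_def split: if_splits)
    also have "\<dots> = mpoly_eval n (mslice n k f) x * x n ^ k"
      by (simp add: mpoly_eval_def sum_distrib_right)
    finally show "(\<Sum>\<alpha>\<in>{\<alpha>\<in>?S. \<alpha> n = k}. f \<alpha> * (\<Prod>j<Suc n. x j ^ \<alpha> j)) = mpoly_eval n (mslice n k f) x * x n ^ k" .
  qed
  finally show ?thesis .
qed

lemma mpoly_eval_cong: "(\<And>j. j < n \<Longrightarrow> x j = y j) \<Longrightarrow> mpoly_eval n f x = mpoly_eval n f y"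
  unfolding mpoly_eval_def by (intro sum.cong arg_cong2[where f="(*)"] prod.cong) auto

text \<open>For each polynomial one nonzero slice is kept, and the induction hypothesis gives a
  point where all these slices are nonzero. Over this point each polynomial is a nonzero polynomial
  in the last coordinate, so only countably many values of that coordinate are forbidden.\<close>

lemma avoid_hypersurfaces:
  assumes "countable F" "\<And>f. f \<in> F \<Longrightarrow> nonzero_mpoly n f"
  shows "\<exists>x. \<forall>f\<in>F. mpoly_eval n f x \<noteq> 0"
  using assms
proof (induction n arbitrary: F)
  case 0
  have "mpoly_eval 0 f x \<noteq> 0" if "f \<in> F" for f x
  proof -
    have f: "nonzero_mpoly 0 f" using 0 that by blast
    then obtain \<alpha> where a: "f \<alpha> \<noteq> 0" by (auto simp: nonzero_mpoly_def)
    have "\<beta> = (\<lambda>_. 0)" if "f \<beta> \<noteq> 0" for \<beta> using f that by (auto simp: nonzero_mpoly_def is_mpoly_def)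
    with a have "{\<alpha>. f \<alpha> \<noteq> 0} = {\<lambda>_. 0}" by auto
    then show ?thesis using a by (auto simp: mpoly_eval_def)
  qed
  then show ?case by blast
next
  case (Suc n)
  have "\<forall>f\<in>F. \<exists>\<alpha>. f \<alpha> \<noteq> 0" using Suc.prems by (auto simp: nonzero_mpoly_def)
  then obtain A where A: "\<And>f. f \<in> F \<Longrightarrow> f (A f) \<noteq> 0" by metis
  have "\<exists>x. \<forall>g\<in>(\<lambda>f. mslice n (A f n) f) ` F. mpoly_eval n g x \<noteq> 0"
    by (rule Suc.IH) (use Suc.prems A nonzero_mpoly_mslice in auto)
  then obtain x where x: "\<And>f. f \<in> F \<Longrightarrow> mpoly_eval n (mslice n (A f n) f) x \<noteq> 0" by blast
  let ?B = "\<lambda>f. {t. mpoly_eval (Suc n) f (x(n := t)) = 0}"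
  have "finite (?B f)" if f: "f \<in> F" for f
  proof -
    let ?K = "(\<lambda>\<alpha>. \<alpha> n) ` {\<alpha>. f \<alpha> \<noteq> 0}"
    let ?q = "\<Sum>k\<in>?K. monom (mpoly_eval n (mslice n k f) x) k"
    have m: "is_mpoly (Suc n) f" using Suc.prems(2)[OF f] by (simp add: nonzero_mpoly_def)
    then have fin: "finite ?K" by (auto simp: is_mpoly_def)
    have "coeff ?q (A f n) = mpoly_eval n (mslice n (A f n) f) x"
      using fin A[OF f] by (auto simp: coeff_sum)
    with x[OF f] have "?q \<noteq> 0" by (metis coeff_0)
    then have "finite {t. poly ?q t = 0}" by (rule poly_roots_finite)
    moreover have "mpoly_eval n g (x(n := t)) = mpoly_eval n g x" for g t
      by (rule mpoly_eval_cong) auto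
    then have "mpoly_eval (Suc n) f (x(n := t)) = poly ?q t" for t
      by (simp add: mpoly_eval_Suc[OF m] poly_sum poly_monom)
    ultimately show ?thesis by simp
  qed
  then have "countable (\<Union>f\<in>F. ?B f)" using Suc.prems(1) by (auto intro: countable_finite)
  then obtain t where "t \<notin> (\<Union>f\<in>F. ?B f)" by (rule avoid_countable[OF _ zero_less_one])
  then show ?case by blast
qed

lemma tendsto_line_at:
  assumes "t \<longlonglongrightarrow> 0" shows "(\<lambda>n. line_at p q (t n)) \<longlonglongrightarrow> p"
proof -
  have "(\<lambda>n. line_at p q (t n)) \<longlonglongrightarrow> (fst p + 0 * (fst q - fst p), snd p + 0 * (snd q - snd p))"
    unfolding line_at_def by (intro tendsto_intros assms)
  then show ?thesis by simp
qed

lemma tendsto_0_norm_less_inverse: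
  assumes "\<And>n. norm (t n :: complex) < inverse (of_nat (Suc n))"
  shows "t \<longlonglongrightarrow> 0"
  by (rule Lim_null_comparison[OF _ LIMSEQ_inverse_real_of_nat])
     (use assms in \<open>auto intro!: always_eventually less_imp_le\<close>)

text \<open>Each point of \<open>p\<close> is joined by a line to the corresponding point of a
  configuration \<open>q\<close> that avoids all the hypersurfaces. Each hypersurface excludes
  finitely many parameters, since the parameter 1 is not excluded; so there are allowed parameters
  arbitrarily close to 0.\<close>

lemma very_general_dense:
  assumes "very_general s P"
  obtains pn where "\<And>n. P (pn n)" "\<And>i. (\<lambda>n. pn n i) \<longlonglongrightarrow> p i"
proof -
  from assms obtain F where F: "countable F" "\<And>f. f \<in> F \<Longrightarrow> nonzero_mpoly (2 * s) f"
    "\<And>p. (\<And>f. f \<in> F \<Longrightarrow> mpoly_eval (2 * s) f (point_coords p) \<noteq> 0) \<Longrightarrow> P p"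
    unfolding very_general_def by metis
  from avoid_hypersurfaces[OF F(1,2)] obtain x where x: "\<And>f. f \<in> F \<Longrightarrow> mpoly_eval (2 * s) f x \<noteq> 0"
    by blast
  \<comment> \<open>Inverse of \<open>point_coords\<close>: points are numbered from 1, coordinates
    from 0.\<close>
  define q where "q i = (x (2 * (i - 1)), x (2 * (i - 1) + 1))" for i
  have pq: "point_coords q = x"
  proof
    fix j show "point_coords q j = x j"
      by (cases "even j") (auto simp: point_coords_def q_def elim!: oddE)
  qed
  define B where "B = (\<Union>f\<in>F. {t. mpoly_eval (2 * s) f (point_coords (\<lambda>i. line_at (p i) (q i) t)) = 0})"
  have "finite {t. mpoly_eval (2 * s) f (point_coords (\<lambda>i. line_at (p i) (q i) t)) = 0}" if "f \<in> F" for f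
  proof (rule polyfun_finite_zeros[of _ 1])
    have "polyfun (\<lambda>t. point_coords (\<lambda>i. line_at (p i) (q i) t) j)" for j
      by (cases "even j") (auto simp: point_coords_def intro: polyfun_fst_line_at polyfun_snd_line_at)
    then show "polyfun (\<lambda>t. mpoly_eval (2 * s) f (point_coords (\<lambda>i. line_at (p i) (q i) t)))"
      unfolding mpoly_eval_def by (intro polyfun_intros)
  qed (use x[OF that] in \<open>simp add: pq\<close>)
  then have B: "countable B" unfolding B_def using F(1) by (auto intro: countable_finite)
  have "\<exists>t. t \<notin> B \<and> norm t < inverse (of_nat (Suc n))" for n
    by (rule avoid_countable[OF B, of "inverse (of_nat (Suc n))"]) auto
  then obtain t where t: "\<And>n. t n \<notin> B" "\<And>n. norm (t n) < inverse (of_nat (Suc n))" by metis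
  show ?thesis
  proof (rule that[of "\<lambda>n i. line_at (p i) (q i) (t n)"])
    show "P (\<lambda>i. line_at (p i) (q i) (t n))" for n
      using t(1)[of n] by (intro F(3)) (auto simp: B_def)
    show "(\<lambda>n. line_at (p i) (q i) (t n)) \<longlonglongrightarrow> p i" for i
      by (rule tendsto_line_at, rule tendsto_0_norm_less_inverse, rule t(2))
  qed
qed

section \<open>Compactness of forms of bounded degree\<close>

lemma subseq_finite:
  fixes f :: "nat \<Rightarrow> 'a \<Rightarrow> complex"
  assumes "finite A" "\<And>a n. a \<in> A \<Longrightarrow> norm (f n a) \<le> K"
  shows "\<exists>r l. strict_mono (r :: nat \<Rightarrow> nat) \<and> (\<forall>a\<in>A. (\<lambda>n. f (r n) a) \<longlonglongrightarrow> l a)"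
  using assms
proof (induction A rule: finite_induct)
  case empty
  show ?case by (rule exI[of _ id]) (auto simp: strict_mono_def)
next
  case (insert x A)
  then obtain r l where r: "strict_mono (r :: nat \<Rightarrow> nat)" "\<And>a. a \<in> A \<Longrightarrow> (\<lambda>n. f (r n) a) \<longlonglongrightarrow> l a"
    by (metis insertCI)
  have "bounded (range (\<lambda>n. f (r n) x))" using insert.prems[of x] by (auto simp: bounded_iff)
  from bounded_imp_convergent_subsequence[OF this] obtain y r'
    where r': "strict_mono r'" "((\<lambda>n. f (r n) x) \<circ> r') \<longlonglongrightarrow> y" by auto
  have "(\<lambda>n. f ((r \<circ> r') n) a) \<longlonglongrightarrow> (l(x := y)) a" if "a \<in> insert x A" for a
  proof (cases "a = x")
    case True
    then show ?thesis using r'(2) by (simp add: comp_def)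
  next
    case False
    with that have "(\<lambda>n. f (r n) a) \<longlonglongrightarrow> l a" using r by auto
    then show ?thesis using LIMSEQ_subseq_LIMSEQ[OF _ r'(1)] False by (fastforce simp: comp_def)
  qed
  moreover have "strict_mono (r \<circ> r')" using r(1) r'(1) by (rule strict_mono_o)
  ultimately show ?case by blast
qed

text \<open>The factor \<open>a n\<close> normalizes the sum of the absolute values of the
  coefficients to 1. The limit inherits this sum and is therefore not the zero form.\<close>

lemma form_compact:
  assumes "\<And>n. nonzero_form d (c n)"
  obtains r c' a where "strict_mono (r :: nat \<Rightarrow> nat)" "nonzero_form d c'"
    "\<And>i j. i + j \<le> d \<Longrightarrow> (\<lambda>n. a n * c (r n) i j) \<longlonglongrightarrow> c' i j"
proof -
  let ?D = "{(i,j). i + j \<le> d}"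
  define M where "M n = (\<Sum>(i,j)\<in>?D. norm (c n i j))" for n
  have le: "norm (c n i j) \<le> M n" if "i + j \<le> d" for n i j
    unfolding M_def using member_le_sum[of "(i,j)" ?D "\<lambda>(i,j). norm (c n i j)"] that by auto
  have M: "M n > 0" for n
  proof -
    from assms[of n] obtain i j where "i + j \<le> d" "c n i j \<noteq> 0" unfolding nonzero_form_def by blast
    with le[of i j n] show ?thesis by (smt (verit) zero_less_norm_iff)
  qed
  define f where "f n = (\<lambda>(i,j). c n i j / of_real (M n))" for n
  have "norm (f n x) \<le> 1" if "x \<in> ?D" for n x
    using that le M[of n] by (auto simp: f_def norm_divide)
  from subseq_finite[of ?D f 1, OF finite_deg_le this] obtain r l
    where r: "strict_mono (r :: nat \<Rightarrow> nat)" "\<And>x. x \<in> ?D \<Longrightarrow> (\<lambda>n. f (r n) x) \<longlonglongrightarrow> l x" by blast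
  have "(\<lambda>n. \<Sum>x\<in>?D. norm (f (r n) x)) \<longlonglongrightarrow> (\<Sum>x\<in>?D. norm (l x))"
    by (intro tendsto_intros r)
  moreover have "(\<Sum>x\<in>?D. norm (f (r n) x)) = 1" for n
  proof -
    have "(\<Sum>x\<in>?D. norm (f (r n) x)) = (\<Sum>x\<in>?D. (case x of (i,j) \<Rightarrow> norm (c (r n) i j)) / M (r n))"
      using M[of "r n"] by (intro sum.cong) (auto simp: f_def norm_divide)
    also have "\<dots> = 1" using M[of "r n"] by (simp add: sum_divide_distrib[symmetric] M_def[symmetric])
    finally show ?thesis .
  qed
  ultimately have "(\<Sum>x\<in>?D. norm (l x)) = 1" by (simp add: LIMSEQ_const_iff)
  then have "\<exists>x\<in>?D. l x \<noteq> 0" by (metis (mono_tags, lifting) norm_zero sum.neutral zero_neq_one)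
  then have nz: "nonzero_form d (\<lambda>i j. l (i,j))" by (auto simp: nonzero_form_def)
  show ?thesis
    by (rule that[OF r(1) nz, of "\<lambda>n. 1 / of_real (M (r n))"])
       (use r(2) in \<open>force simp: f_def\<close>)
qed

lemma taylor_scale: "taylor d (\<lambda>i j. a * c i j) p k l = a * taylor d c p k l"
  unfolding taylor_def sum_distrib_left by (intro sum.cong refl) auto

lemma vanishes_scale: "vanishes_to_order d c p m \<Longrightarrow> vanishes_to_order d (\<lambda>i j. a * c i j) p m"
  by (simp add: vanishes_iff_taylor taylor_scale)

lemma taylor_tendsto:
  assumes "\<And>i j. i + j \<le> d \<Longrightarrow> (\<lambda>n. c n i j) \<longlonglongrightarrow> c' i j" "p \<longlonglongrightarrow> p'"
  shows "(\<lambda>n. taylor d (c n) (p n) k l) \<longlonglongrightarrow> taylor d c' p' k l"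
  unfolding taylor_def
proof (intro tendsto_sum)
  fix i j assume "i \<in> {..d}" "j \<in> {..d - i}"
  then have "(\<lambda>n. c n i j) \<longlonglongrightarrow> c' i j" using assms(1) by auto
  then show "(\<lambda>n. if k \<le> i \<and> l \<le> j
             then c n i j * of_nat (i choose k) * of_nat (j choose l) * fst (p n) ^ (i - k) * snd (p n) ^ (j - l)
             else 0) \<longlonglongrightarrow> (if k \<le> i \<and> l \<le> j
             then c' i j * of_nat (i choose k) * of_nat (j choose l) * fst p' ^ (i - k) * snd p' ^ (j - l)
             else 0)"
    by (cases "k \<le> i \<and> l \<le> j") (auto intro!: tendsto_intros assms(2))
qed

lemma vanishes_limit:
  assumes "\<And>i j. i + j \<le> d \<Longrightarrow> (\<lambda>n. c n i j) \<longlonglongrightarrow> c' i j" "p \<longlonglongrightarrow> p'"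
    and "\<And>n. vanishes_to_order d (c n) (p n) m"
  shows "vanishes_to_order d c' p' m"
  unfolding vanishes_iff_taylor
proof (intro allI impI)
  fix k l assume "k + l < m"
  then have "taylor d (c n) (p n) k l = 0" for n using assms(3) by (simp add: vanishes_iff_taylor)
  moreover have "(\<lambda>n. taylor d (c n) (p n) k l) \<longlonglongrightarrow> taylor d c' p' k l"
    by (rule taylor_tendsto) (use assms in auto)
  ultimately show "taylor d c' p' k l = 0" by (simp add: LIMSEQ_const_iff)
qed

definition has_form :: "nat set \<Rightarrow> nat \<Rightarrow> (nat \<Rightarrow> nat) \<Rightarrow> (nat \<Rightarrow> complex \<times> complex) \<Rightarrow> bool" where
  "has_form I d b p \<longleftrightarrow> (\<exists>c. nonzero_form d c \<and> (\<forall>i\<in>I. vanishes_to_order d c (p i) (b i)))"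

text \<open>This is the step that reaches special positions: the limit points may coincide or be
  collinear, and the limiting form keeps all prescribed multiplicities.\<close>

lemma has_form_closed:
  assumes "\<And>n. has_form I d b (p n)" "\<And>i. i \<in> I \<Longrightarrow> (\<lambda>n. p n i) \<longlonglongrightarrow> p' i"
  shows "has_form I d b p'"
proof -
  from assms(1) obtain c where c: "\<And>n. nonzero_form d (c n)"
    "\<And>n i. i \<in> I \<Longrightarrow> vanishes_to_order d (c n) (p n i) (b i)"
    unfolding has_form_def by metis
  from form_compact[of d c, OF c(1)] obtain r c' a where r: "strict_mono (r :: nat \<Rightarrow> nat)" "nonzero_form d c'"
    "\<And>i j. i + j \<le> d \<Longrightarrow> (\<lambda>n. a n * c (r n) i j) \<longlonglongrightarrow> c' i j" by metis
  have "vanishes_to_order d c' (p' i) (b i)" if "i \<in> I" for i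
  proof (rule vanishes_limit[OF r(3)])
    show "(\<lambda>n. p (r n) i) \<longlonglongrightarrow> p' i"
      using LIMSEQ_subseq_LIMSEQ[OF assms(2)[OF that] r(1)] by (simp add: comp_def)
    show "vanishes_to_order d (\<lambda>i j. a n * c (r n) i j) (p (r n) i) (b i)" for n
      by (rule vanishes_scale, rule c(2), rule that)
  qed
  with r(2) show ?thesis unfolding has_form_def by blast
qed

definition everywhere_effective :: "nat set \<Rightarrow> nat \<Rightarrow> (nat \<Rightarrow> nat) \<Rightarrow> bool" where
  "everywhere_effective I d b \<longleftrightarrow> (\<forall>p. has_form I d b p)"

lemma effective_class_imp_everywhere:
  assumes "effective_class s D"
  shows "everywhere_effective {1..s} (nat \<lfloor>D 0\<rfloor>) (\<lambda>i. nat \<lfloor>- D i\<rfloor>)"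
  unfolding everywhere_effective_def
proof
  fix p
  have "very_general s (has_form {1..s} (nat \<lfloor>D 0\<rfloor>) (\<lambda>i. nat \<lfloor>- D i\<rfloor>))"
    using assms unfolding effective_class_def has_form_def by blast
  from very_general_dense[OF this, of p]
  show "has_form {1..s} (nat \<lfloor>D 0\<rfloor>) (\<lambda>i. nat \<lfloor>- D i\<rfloor>) p"
    by (metis has_form_closed)
qed

section \<open>Collisions of points\<close>

text \<open>The zero function vanishes at the origin to order \<open>Suc d\<close>, which kills all
  coefficients of a form of degree \<open>d\<close>.\<close>

lemma nonzero_form_value:
  assumes "nonzero_form d c" shows "\<exists>z. form_eval d c z \<noteq> 0"
proof (rule ccontr)
  assume "\<not> ?thesis"
  then have "form_eval d c = (\<lambda>z. 0)" by auto
  then have "order_ge (form_eval d c) (0,0) (Suc d)" by (simp add: order_ge_zero)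
  with assms show False unfolding nonzero_form_def using order_ge_0_imp_coeff by (metis le_imp_less_Suc)
qed

lemma form_eval_Suc: "form_eval (Suc e) C u = (\<Sum>l\<le>Suc e. C 0 l * snd u ^ l) + fst u * form_eval e (\<lambda>k l. C (Suc k) l) u"
  unfolding form_eval_def
  by (subst sum.atMost_Suc_shift) (simp add: sum_distrib_left mult_ac del: sum.atMost_Suc)

lemma bipoly_shift: "bipoly d f \<Longrightarrow> bipoly d (\<lambda>u. f (a + fst u, b + snd u))"
  by (rule bipoly_compose_affine)
     (auto intro!: bipoly_add bipoly_const bipoly_fst bipoly_snd)

lemma bipoly_unshift: "bipoly d (form_eval d C) \<Longrightarrow> bipoly d (\<lambda>z. form_eval d C (z - p))"
  using bipoly_shift[of d "form_eval d C" "- fst p" "- snd p"]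
  by (simp add: minus_prod_def)

lemma bipoly_at_point:
  assumes "bipoly d f" obtains C where "\<And>u. f (p + u) = form_eval d C u"
proof -
  from assms obtain c where c: "f = form_eval d c" unfolding bipoly_def by blast
  show ?thesis by (rule that[of "taylor d c p"]) (simp add: c form_eval_taylor)
qed

text \<open>In the expansion at \<open>(c,0)\<close> the terms free of the first coordinate make up
  the restriction to the line, which is zero; all other terms contain the factor
  \<open>fst z - c\<close>.\<close>

lemma bipoly_divide_line:
  assumes "bipoly (Suc e) f" "\<And>y. f (c, y) = 0"
  obtains g where "bipoly e g" "\<And>z. f z = (fst z - c) * g z"
proof -
  from assms(1) obtain C where C: "\<And>u. f ((c,0) + u) = form_eval (Suc e) C u"
    using bipoly_at_point[OF assms(1)] by blast
  have 0: "(\<Sum>l\<le>Suc e. C 0 l * y ^ l) = 0" for y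
    using C[of "(0,y)"] assms(2)[of y] by (simp add: form_eval_Suc del: sum.atMost_Suc)
  show ?thesis
  proof (rule that[of "\<lambda>z. form_eval e (\<lambda>k l. C (Suc k) l) (z - (c,0))"])
    show "bipoly e (\<lambda>z. form_eval e (\<lambda>k l. C (Suc k) l) (z - (c,0)))"
      by (rule bipoly_unshift) (auto simp: bipoly_def)
    show "f z = (fst z - c) * form_eval e (\<lambda>k l. C (Suc k) l) (z - (c,0))" for z
      using C[of "z - (c,0)"] by (simp add: form_eval_Suc 0 del: sum.atMost_Suc)
  qed
qed

lemma order_ge_translate: "order_ge f p m \<Longrightarrow> order_ge (\<lambda>u. f (p + u)) 0 m"
  by (rule order_ge_compose[of f "\<lambda>u. p + u" 0 m "\<lambda>u. u"]) (auto intro!: derivative_eq_intros)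

lemma order_ge_untranslate: "order_ge (\<lambda>u. f (p + u)) 0 m \<Longrightarrow> order_ge f p m"
  using order_ge_compose[of "\<lambda>u. f (p + u)" "\<lambda>z. z - p" p m "\<lambda>u. u"]
  by (simp add: has_derivative_diff[OF has_derivative_ident has_derivative_const, simplified])

text \<open>Multiplication by the equation of the line shifts the first Taylor index by one, so
  division costs at most one order at a point of the line.\<close>

lemma order_ge_divide_on_line:
  assumes "bipoly e g" "order_ge (\<lambda>z. (fst z - fst q) * g z) q m"
  shows "order_ge g q (m - 1)"
proof -
  from assms(1) obtain C where C: "\<And>u. g (q + u) = form_eval e C u"
    using bipoly_at_point[OF assms(1)] by blast
  let ?C = "\<lambda>k l. if k = 0 then 0 else C (k - 1) l"
  have "order_ge (\<lambda>u. fst u * form_eval e C u) 0 m"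
    using order_ge_translate[OF assms(2)] by (simp add: C)
  moreover have "form_eval (Suc e) ?C = (\<lambda>u. fst u * form_eval e C u)"
    by (rule ext) (subst form_eval_Suc, simp del: sum.atMost_Suc)
  ultimately have v: "order_ge (form_eval (Suc e) ?C) (0,0) m" by (simp add: zero_prod_def)
  have "C k l = 0" if "k + l < m - 1" "k + l \<le> e" for k l
    using order_ge_0_imp_coeff[OF v, of "Suc k" l] that by simp
  then have "order_ge (\<lambda>z. form_eval e C (z - 0)) 0 (m - 1)" by (rule coeff_imp_order_ge)
  then have "order_ge (\<lambda>u. g (q + u)) 0 (m - 1)" by (simp add: C)
  then show ?thesis by (rule order_ge_untranslate)
qed

text \<open>Away from the line its equation is invertible, so division costs nothing.\<close>

lemma order_ge_divide_off_line:
  assumes "order_ge (\<lambda>z. (fst z - c) * g z) q m" "fst q \<noteq> c"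
  shows "order_ge g q m"
proof (rule order_ge_cong[OF order_ge_mult_cont[OF assms(1)]])
  show "isCont (\<lambda>z. inverse (fst z - c)) q" using assms(2) by (intro continuous_intros) auto
  have "(fst \<longlongrightarrow> fst q) (nhds q)" by (intro tendsto_intros filterlim_ident)
  then have "\<forall>\<^sub>F z in nhds q. fst z \<noteq> c" using assms(2) by (rule tendsto_imp_eventually_ne)
  then show "\<forall>\<^sub>F z in nhds q. inverse (fst z - c) * ((fst z - c) * g z) = g z"
    by eventually_elim simp
qed

section \<open>Counting multiplicities along lines\<close>

lemma pcompose_pow: "pcompose (p ^ n) q = pcompose p (q :: 'a :: comm_semiring_1 poly) ^ n"
  by (induction n) (simp_all add: pcompose_mult pcompose_1)

lemma order_ge_of_small:
  fixes r :: "complex poly"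
  assumes "r \<noteq> 0" "\<forall>\<^sub>F y in nhds a. norm (poly r y) \<le> C * dist y a ^ m"
  shows "order a r \<ge> m"
proof -
  let ?s = "pcompose r [:a,1:]"
  have "((\<lambda>t. a + t) \<longlongrightarrow> a + 0) (at 0)" by (intro tendsto_intros)
  then have "filterlim (\<lambda>t. a + t) (nhds a) (at 0)" by simp
  with assms(2) have "\<forall>\<^sub>F t in at 0. norm (poly r (a + t)) \<le> C * dist (a + t) a ^ m"
    unfolding filterlim_iff by blast
  then have "\<forall>\<^sub>F t in at 0. norm (poly ?s t) \<le> C * norm t ^ m"
    by (simp add: poly_pcompose dist_norm)
  then have "\<forall>n<m. coeff ?s n = 0" using poly_small_imp_coeff_0 by blast
  then have "monom 1 m dvd ?s" by (simp add: monom_1_dvd_iff')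
  then obtain w where "?s = monom 1 m * w" by (elim dvdE)
  then have "pcompose ?s [:-a,1:] = pcompose (monom 1 m) [:-a,1:] * pcompose w [:-a,1:]"
    by (simp add: pcompose_mult)
  moreover have "pcompose ?s [:-a,1:] = r" by (simp add: pcompose_assoc[symmetric] pcompose_pCons)
  moreover have "pcompose (monom 1 m) [:-a,1:] = [:-a,1:] ^ m"
    by (simp add: monom_altdef pcompose_smult pcompose_pow pcompose_pCons)
  ultimately have "[:-a,1:] ^ m dvd r" by (metis dvd_triv_left)
  with assms(1) show ?thesis by (simp add: order_divides)
qed

lemma degree_line_restriction:
  assumes "bipoly e f" obtains r where "degree r \<le> e" "\<And>y. f (c, y) = poly r y"
proof -
  from assms obtain k where k: "f = form_eval e k" unfolding bipoly_def by blast
  show ?thesis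
  proof (rule that[of "\<Sum>i\<le>e. \<Sum>j\<le>e - i. monom (k i j * c ^ i) j"])
    show "degree (\<Sum>i\<le>e. \<Sum>j\<le>e - i. monom (k i j * c ^ i) j) \<le> e"
      by (intro degree_sum_le order_trans[OF degree_monom_le]) auto
    show "f (c, y) = poly (\<Sum>i\<le>e. \<Sum>j\<le>e - i. monom (k i j * c ^ i) j) y" for y
      by (simp add: k form_eval_def poly_sum poly_monom)
  qed
qed

text \<open>The restriction of \<open>f\<close> to the vertical line is a nonzero polynomial of
  degree at most \<open>e\<close>. Its zeros at the distinct points \<open>q j\<close> have order at
  least \<open>b j\<close>, and orders of zeros add up to at most the degree.\<close>

lemma line_multiplicity_bound:
  assumes "bipoly e f" "f (c, y0) \<noteq> 0" "finite J" "inj_on q J"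
    "\<And>j. j \<in> J \<Longrightarrow> fst (q j) = c" "\<And>j. j \<in> J \<Longrightarrow> order_ge f (q j) (b j)"
  shows "(\<Sum>j\<in>J. b j) \<le> e"
proof -
  from assms(1) obtain r where r: "degree r \<le> e" "\<And>y. f (c, y) = poly r y" using degree_line_restriction[OF assms(1)] by blast
  have r0: "r \<noteq> 0" using r(2)[of y0] assms(2) by auto
  have inj: "inj_on (\<lambda>j. snd (q j)) J"
    using assms(4,5) unfolding inj_on_def by (metis prod_eqI)
  have ord: "b j \<le> order (snd (q j)) r" if j: "j \<in> J" for j
  proof -
    from assms(6)[OF j] obtain C where C: "C > 0" "\<forall>\<^sub>F x in nhds (q j). norm (f x) \<le> C * dist x (q j) ^ b j"
      by (rule order_ge_pos)
    have q: "q j = (c, snd (q j))" using assms(5)[OF j] by (metis prod.collapse)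
    have "((\<lambda>y. (c, y)) \<longlongrightarrow> (c, snd (q j))) (nhds (snd (q j)))"
      by (intro tendsto_intros filterlim_ident)
    then have "filterlim (\<lambda>y. (c, y)) (nhds (q j)) (nhds (snd (q j)))" using q by simp
    with C(2) have "\<forall>\<^sub>F y in nhds (snd (q j)). norm (f (c,y)) \<le> C * dist (c,y) (q j) ^ b j"
      unfolding filterlim_iff by blast
    moreover have "dist (c,y) (q j) = dist y (snd (q j))" for y
      by (subst q) (simp add: dist_Pair_Pair)
    ultimately show ?thesis by (intro order_ge_of_small[OF r0]) (simp add: r(2))
  qed
  have "(\<Sum>j\<in>J. b j) \<le> (\<Sum>j\<in>J. order (snd (q j)) r)" by (rule sum_mono) (rule ord)
  also have "\<dots> = (\<Sum>y\<in>(\<lambda>j. snd (q j)) ` J. order y r)" using inj by (simp add: sum.reindex)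
  also have "\<dots> = (\<Sum>y\<in>(\<lambda>j. snd (q j)) ` J \<inter> {y. poly r y = 0}. order y r)"
    using assms(3) by (intro sum.mono_neutral_right) (auto simp: order_root)
  also have "\<dots> \<le> (\<Sum>y | poly r y = 0. order y r)"
    by (intro sum_mono2 poly_roots_finite[OF r0]) auto
  also have "\<dots> \<le> e" using sum_order_le_degree[OF r0] r(1) by simp
  finally show ?thesis .
qed

text \<open>If \<open>f\<close> vanishes identically on none of the lines, the bound
  \<open>e\<close> on each of them adds up to \<open>card X * e\<close>. Otherwise one line splits
  off: the degree drops by one, and each multiplicity on that line by at most one. Since the line
  carries at most \<open>card X\<close> points, both sides of the inequality remain in
  balance.\<close>

lemma lines_multiplicity_bound:
  assumes "bipoly e f" "f z0 \<noteq> 0" "finite J" "inj_on q J" "finite X"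
    "\<And>j. j \<in> J \<Longrightarrow> fst (q j) \<in> X" "\<And>j. j \<in> J \<Longrightarrow> order_ge f (q j) (b j)"
    "\<And>c. c \<in> X \<Longrightarrow> card {j \<in> J. fst (q j) = c} \<le> card X"
  shows "(\<Sum>j\<in>J. b j) \<le> card X * e"
  using assms(1,2,7)
proof (induction e arbitrary: f z0 b)
  case (0 f z0 b)
  have "(\<Sum>j\<in>J. b j) = (\<Sum>c\<in>X. \<Sum>j\<in>{j \<in> J. fst (q j) = c}. b j)"
    using assms(3,5,6) by (intro sum.group[symmetric]) auto
  also have "\<dots> \<le> (\<Sum>c\<in>X. 0)"
  proof (rule sum_mono)
    fix c assume "c \<in> X"
    obtain k where "f = form_eval 0 k" using 0 unfolding bipoly_def by blast
    then have "f (c, 0) \<noteq> 0" using 0(2) by (simp add: form_eval_def)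
    then show "(\<Sum>j\<in>{j \<in> J. fst (q j) = c}. b j) \<le> 0"
      by (rule line_multiplicity_bound[OF 0(1), of c 0])
         (use assms(3) inj_on_subset[OF assms(4)] 0(3) in auto)
  qed
  finally show ?case by simp
next
  case (Suc e f z0 b)
  show ?case
  proof (cases "\<exists>c\<in>X. \<forall>y. f (c, y) = 0")
    case False
    have "(\<Sum>j\<in>J. b j) = (\<Sum>c\<in>X. \<Sum>j\<in>{j \<in> J. fst (q j) = c}. b j)"
      using assms(3,5,6) by (intro sum.group[symmetric]) auto
    also have "\<dots> \<le> (\<Sum>c\<in>X. Suc e)"
    proof (rule sum_mono)
      fix c assume "c \<in> X"
      with False obtain y where "f (c, y) \<noteq> 0" by blast
      then show "(\<Sum>j\<in>{j \<in> J. fst (q j) = c}. b j) \<le> Suc e"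
        by (rule line_multiplicity_bound[OF Suc.prems(1)])
           (use assms(3) inj_on_subset[OF assms(4)] Suc.prems(3) in auto)
    qed
    finally show ?thesis by simp
  next
    case True
    then obtain c where c: "c \<in> X" "\<And>y. f (c, y) = 0" by blast
    obtain g where g: "bipoly e g" "\<And>z. f z = (fst z - c) * g z"
      using bipoly_divide_line[OF Suc.prems(1) c(2)] by blast
    let ?b = "\<lambda>j. if fst (q j) = c then b j - 1 else b j"
    have "(\<Sum>j\<in>J. ?b j) \<le> card X * e"
    proof (rule Suc.IH[OF g(1)])
      show "g z0 \<noteq> 0" using Suc.prems(2) g(2)[of z0] by (metis mult_zero_right)
      fix j assume j: "j \<in> J"
      have f: "f = (\<lambda>z. (fst z - c) * g z)" using g(2) by (rule ext)
      have v: "order_ge (\<lambda>z. (fst z - c) * g z) (q j) (b j)"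
        using Suc.prems(3)[OF j] unfolding f .
      show "order_ge g (q j) (?b j)"
      proof (cases "fst (q j) = c")
        case True
        then show ?thesis using order_ge_divide_on_line[OF g(1), of "q j" "b j"] v by simp
      next
        case False
        then show ?thesis using order_ge_divide_off_line[OF v] by simp
      qed
    qed
    moreover have "(\<Sum>j\<in>J. b j) \<le> (\<Sum>j\<in>J. ?b j + (if fst (q j) = c then 1 else 0))"
      by (rule sum_mono) auto
    moreover have "(\<Sum>j\<in>J. (if fst (q j) = c then 1 else 0)) = card {j \<in> J. fst (q j) = c}"
      using assms(3) by (simp add: sum.If_cases Int_def)
    ultimately show ?thesis using assms(8)[OF c(1)] by (simp add: sum.distrib)
  qed
qed

text \<open>\<open>X\<close> is the set of columns: \<open>h\<close> vertical lines with
  \<open>h\<close> points each, as required by \<open>lines_multiplicity_bound\<close>.\<close>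

lemma square_grid:
  assumes "finite F" "card F = h ^ 2"
  obtains q :: "'a \<Rightarrow> complex \<times> complex" and X where "inj_on q F" "finite X" "card X = h"
    "\<And>j. j \<in> F \<Longrightarrow> fst (q j) \<in> X" "\<And>c. c \<in> X \<Longrightarrow> card {j \<in> F. fst (q j) = c} \<le> card X"
proof -
  have "card F = card ({..<h} \<times> {..<h})" using assms by (simp add: power2_eq_square)
  then obtain f where f: "bij_betw f F ({..<h} \<times> {..<h})"
    using finite_same_card_bij[OF assms(1), of "{..<h} \<times> {..<h}"] by auto
  define X where "X = (of_nat :: nat \<Rightarrow> complex) ` {..<h}"
  define q where "q j = (of_nat (fst (f j)) :: complex, of_nat (snd (f j)) :: complex)" for j
  have X: "card X = h" "finite X" unfolding X_def by (auto simp: card_image inj_on_def)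
  have inj: "inj_on q F"
    using bij_betw_imp_inj_on[OF f] unfolding inj_on_def q_def by (metis of_nat_eq_iff prod.inject prod.collapse)
  have fF: "f j \<in> {..<h} \<times> {..<h}" if "j \<in> F" for j using f that by (rule bij_betw_apply)
  show ?thesis
  proof (rule that[OF inj X(2,1)])
    show "fst (q j) \<in> X" if "j \<in> F" for j using fF[OF that] by (auto simp: X_def q_def)
    fix c assume "c \<in> X"
    have "q ` {j \<in> F. fst (q j) = c} \<subseteq> {c} \<times> X"
      using fF by (fastforce simp: X_def q_def)
    then have "card (q ` {j \<in> F. fst (q j) = c}) \<le> card ({c} \<times> X)"
      by (rule card_mono[rotated]) (use X in auto)
    moreover have "card (q ` {j \<in> F. fst (q j) = c}) = card {j \<in> F. fst (q j) = c}"
      by (rule card_image) (rule inj_on_subset[OF inj], auto)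
    ultimately show "card {j \<in> F. fst (q j) = c} \<le> card X" by (simp add: card_cartesian_product)
  qed
qed

text \<open>The points of \<open>F\<close> are placed on a square grid. For \<open>h = 3\<close>
  this is the nefness of 3H minus nine exceptional curves, the end of the Cremona reduction.\<close>

lemma everywhere_effective_square_bound:
  assumes "everywhere_effective I e b" "F \<subseteq> I" "finite F" "card F = h ^ 2"
  shows "(\<Sum>j\<in>F. b j) \<le> h * e"
proof -
  obtain q :: "nat \<Rightarrow> complex \<times> complex" and X where q: "inj_on q F" "finite X" "card X = h"
    "\<And>j. j \<in> F \<Longrightarrow> fst (q j) \<in> X" "\<And>c. c \<in> X \<Longrightarrow> card {j \<in> F. fst (q j) = c} \<le> card X"
    by (rule square_grid[OF assms(3,4)]) blast
  from assms(1) obtain c where c: "nonzero_form e c" "\<And>i. i \<in> I \<Longrightarrow> vanishes_to_order e c (q i) (b i)"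
    unfolding everywhere_effective_def has_form_def by blast
  from nonzero_form_value[OF c(1)] obtain z0 where "form_eval e c z0 \<noteq> 0" by blast
  then have "(\<Sum>j\<in>F. b j) \<le> card X * e"
    by (rule lines_multiplicity_bound[rotated, OF _ assms(3) q(1,2,4)])
       (use c(2) assms(2) q(5) in \<open>auto simp: bipoly_def vanishes_iff_order_ge[symmetric]\<close>)
  with q(3) show ?thesis by simp
qed

lemma form_eval_low_degree:
  assumes "\<And>i j. m < i + j \<Longrightarrow> i + j \<le> d \<Longrightarrow> g i j = 0" "m \<le> d"
  shows "form_eval d g = form_eval m g"
proof
  fix z
  have "(case x of (i,j) \<Rightarrow> g i j * fst z ^ i * snd z ^ j) = 0"
    if "x \<in> {(i,j). i + j \<le> d} - {(i,j). i + j \<le> m}" for x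
    using that assms(1)[of "fst x" "snd x"] by (auto simp: case_prod_unfold not_le)
  then show "form_eval d g z = form_eval m g z"
    unfolding form_eval_alt2 using assms(2) by (intro sum.mono_neutral_right ballI) auto
qed

lemma form_eval_taylor_scaled: "form_eval d (\<lambda>k l. taylor d c p k l * t ^ (k + l)) z = form_eval d c (p + (t * fst z, t * snd z))"
  unfolding form_eval_taylor unfolding form_eval_def
  by (intro sum.cong refl) (simp add: power_add power_mult_distrib mult_ac)

text \<open>Let the points of each cluster \<open>g j = i\<close> collapse homothetically onto \<open>P i\<close>. The rescaled
  leading part at \<open>P i\<close> of the limiting form has degree at most the multiplicity of the limit at
  \<open>P i\<close>, and it still has multiplicities \<open>b j\<close> at the points \<open>q j\<close> of a square grid.\<close>

lemma everywhere_effective_collide: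
  assumes eff: "everywhere_effective J e b"
    and J: "finite J" and h: "\<And>i. i \<in> I \<Longrightarrow> card {j \<in> J. g j = i} = h i ^ 2"
    and m: "\<And>i \<mu>. i \<in> I \<Longrightarrow> \<mu> < m i \<Longrightarrow> h i * \<mu> < (\<Sum>j | j \<in> J \<and> g j = i. b j)"
  shows "everywhere_effective I e m"
  unfolding everywhere_effective_def
proof
  fix P :: "nat \<Rightarrow> complex \<times> complex"
  let ?F = "\<lambda>i. {j \<in> J. g j = i}"
  define grid where "grid i q X \<longleftrightarrow> inj_on q (?F i) \<and> finite X \<and> card X = h i
      \<and> (\<forall>j\<in>?F i. fst (q j :: complex \<times> complex) \<in> X)
      \<and> (\<forall>c\<in>X. card {j \<in> ?F i. fst (q j) = c} \<le> card X)" for i q X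
  have "\<exists>q X. grid i q X" if i: "i \<in> I" for i
  proof -
    have fin: "finite (?F i)" using J by simp
    show ?thesis by (rule square_grid[OF fin h[OF i]]) (use grid_def in blast)
  qed
  then obtain Q X where QX: "\<And>i. i \<in> I \<Longrightarrow> grid i (Q i) (X i)" by metis
  have Q: "inj_on (Q i) (?F i)" "finite (X i)" "card (X i) = h i"
    "\<And>j. j \<in> ?F i \<Longrightarrow> fst (Q i j) \<in> X i"
    "\<And>c. c \<in> X i \<Longrightarrow> card {j \<in> ?F i. fst (Q i j) = c} \<le> card (X i)" if "i \<in> I" for i
    using QX[OF that] unfolding grid_def by blast+
  define t where "t n = inverse (of_nat (Suc n) :: complex)" for n
  have t0: "t \<longlonglongrightarrow> 0"
    by (rule Lim_null_comparison[OF _ LIMSEQ_inverse_real_of_nat])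
       (simp add: t_def norm_inverse del: of_nat_Suc)
  have tnz: "t n \<noteq> 0" for n by (simp add: t_def del: of_nat_Suc)
  define p where "p n j = P (g j) + (t n * fst (Q (g j) j), t n * snd (Q (g j) j))" for n j
  have "has_form J e b (p n)" for n using eff unfolding everywhere_effective_def by blast
  then obtain c where c: "\<And>n. nonzero_form e (c n)" "\<And>n j. j \<in> J \<Longrightarrow> vanishes_to_order e (c n) (p n j) (b j)"
    unfolding has_form_def by metis
  from form_compact[of e c, OF c(1)] obtain r c' a where r: "strict_mono (r :: nat \<Rightarrow> nat)" "nonzero_form e c'"
    "\<And>i j. i + j \<le> e \<Longrightarrow> (\<lambda>n. a n * c (r n) i j) \<longlonglongrightarrow> c' i j" by metis
  define C where "C n i j = a n * c (r n) i j" for n i j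
  define \<tau> where "\<tau> n = t (r n)" for n
  have \<tau>: "\<tau> \<longlonglongrightarrow> 0" using LIMSEQ_subseq_LIMSEQ[OF t0 r(1)] by (simp add: \<tau>_def[abs_def] comp_def)
  have C: "vanishes_to_order e (C n) (p (r n) j) (b j)" if "j \<in> J" for n j
    unfolding C_def by (rule vanishes_scale, rule c(2), rule that)
  have "vanishes_to_order e c' (P i) (m i)" if i: "i \<in> I" for i
  proof (rule ccontr)
    assume "\<not> ?thesis"
    then obtain k l where kl: "k + l < m i" "taylor e c' (P i) k l \<noteq> 0"
      by (auto simp: vanishes_iff_taylor)
    define \<mu> where "\<mu> = k + l"
    have \<mu>: "\<mu> \<le> e" using kl(2) taylor_eq_0 unfolding \<mu>_def by (metis not_le)
    define T where "T n = taylor e (C n) (P i)" for n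
    have T: "(\<lambda>n. T n k' l') \<longlonglongrightarrow> taylor e c' (P i) k' l'" for k' l'
      unfolding T_def by (rule taylor_tendsto) (use r(3) in \<open>auto simp: C_def\<close>)
    then have "\<forall>\<^sub>F n in sequentially. T n k l \<noteq> 0" using kl(2) by (rule tendsto_imp_eventually_ne)
    then obtain N where N: "\<And>n. n \<ge> N \<Longrightarrow> T n k l \<noteq> 0" unfolding eventually_sequentially by blast
    \<comment> \<open>Taylor coefficients at \<open>P i\<close> after rescaling the coordinates so
      that the cluster stands at the fixed grid \<open>Q i\<close>. The shift by \<open>N\<close>
      keeps the coefficient at \<open>(k, l)\<close> nonzero, hence the forms to be normalized are
      nonzero.\<close>
    define G where "G n k' l' = T (n + N) k' l' * \<tau> (n + N) ^ (k' + l')" for n k' l'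
    have Gkl: "G n k l \<noteq> 0" for n using N[of "n + N"] tnz by (simp add: G_def \<tau>_def)
    then have "nonzero_form e (G n)" for n using \<mu> unfolding nonzero_form_def \<mu>_def by blast
    from form_compact[of e G, OF this] obtain s G' d where s: "strict_mono (s :: nat \<Rightarrow> nat)" "nonzero_form e G'"
      "\<And>i j. i + j \<le> e \<Longrightarrow> (\<lambda>n. d n * G (s n) i j) \<longlonglongrightarrow> G' i j" by metis
    \<comment> \<open>Compared with the coefficient at \<open>(k, l)\<close>, whose unscaled limit
      is nonzero, a coefficient of degree above \<mu> carries an additional positive power of
      \<tau>. The normalized coefficient at \<open>(k, l)\<close> converges, so the normalized
      higher ones tend to 0.\<close>
    have low: "G' k' l' = 0" if "\<mu> < k' + l'" "k' + l' \<le> e" for k' l'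
    proof -
      have s': "filterlim (\<lambda>n. s n + N) sequentially sequentially"
        by (intro filterlim_compose[OF filterlim_add_const_nat_at_top] filterlim_subseq s(1))
      have "(\<lambda>n. d n * G (s n) k l * (T (s n + N) k' l' / T (s n + N) k l * \<tau> (s n + N) ^ (k' + l' - \<mu>)))
         \<longlonglongrightarrow> G' k l * (taylor e c' (P i) k' l' / taylor e c' (P i) k l * 0 ^ (k' + l' - \<mu>))"
        using \<mu> kl(2) by (intro tendsto_mult s(3) tendsto_divide tendsto_power
           filterlim_compose[OF T s'] filterlim_compose[OF \<tau> s']) (auto simp: \<mu>_def)
      moreover have "d n * G (s n) k l * (T (s n + N) k' l' / T (s n + N) k l * \<tau> (s n + N) ^ (k' + l' - \<mu>))
         = d n * G (s n) k' l'" for n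
      proof -
        have "\<tau> (s n + N) ^ (k' + l') = \<tau> (s n + N) ^ (k + l) * \<tau> (s n + N) ^ (k' + l' - \<mu>)"
          using that by (simp add: power_add[symmetric] \<mu>_def)
        with N[of "s n + N"] show ?thesis by (simp add: G_def)
      qed
      moreover have "(0 :: complex) ^ (k' + l' - \<mu>) = 0" using that by (simp add: power_0_left)
      ultimately have "(\<lambda>n. d n * G (s n) k' l') \<longlonglongrightarrow> 0" by simp
      with s(3)[OF that(2)] show ?thesis by (rule LIMSEQ_unique)
    qed
    have van: "vanishes_to_order e G' (Q i j) (b j)" if j: "j \<in> ?F i" for j
    proof (rule vanishes_limit[OF s(3) tendsto_const])
      fix n
      let ?n = "s n + N"
      have "order_ge (form_eval e (C ?n)) (P i + (\<tau> ?n * fst (Q i j), \<tau> ?n * snd (Q i j))) (b j)"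
        using C[of j ?n] j by (simp add: p_def \<tau>_def vanishes_iff_order_ge)
      then have "order_ge (\<lambda>z. form_eval e (C ?n) (P i + (\<tau> ?n * fst z, \<tau> ?n * snd z))) (Q i j) (b j)"
        by (rule order_ge_compose[where g' = "\<lambda>z. (\<tau> ?n * fst z, \<tau> ?n * snd z)"])
           (auto intro!: derivative_eq_intros)
      moreover have "form_eval e (G (s n)) = (\<lambda>z. form_eval e (C ?n) (P i + (\<tau> ?n * fst z, \<tau> ?n * snd z)))"
        by (rule ext) (simp only: G_def[abs_def] T_def form_eval_taylor_scaled)
      ultimately have "order_ge (form_eval e (G (s n))) (Q i j) (b j)" by simp
      then show "vanishes_to_order e (\<lambda>i j. d n * G (s n) i j) (Q i j) (b j)"
        by (intro vanishes_scale) (simp add: vanishes_iff_order_ge)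
    qed auto
    from nonzero_form_value[OF s(2)] obtain z0 where z0: "form_eval e G' z0 \<noteq> 0" by blast
    have form_eval: "form_eval e G' = form_eval \<mu> G'" using low \<mu> by (intro form_eval_low_degree) auto
    have "bipoly \<mu> (form_eval e G')" unfolding form_eval bipoly_def by blast
    moreover have "order_ge (form_eval e G') (Q i j) (b j)" if "j \<in> ?F i" for j
      using van[OF that] by (simp add: vanishes_iff_order_ge)
    moreover have "finite (?F i)" using J by simp
    ultimately have "(\<Sum>j\<in>?F i. b j) \<le> card (X i) * \<mu>"
      using lines_multiplicity_bound[of \<mu> "form_eval e G'" z0 "?F i" "Q i" "X i" b] z0 Q[OF i] by blast
    moreover have "h i * \<mu> < (\<Sum>j\<in>?F i. b j)" using m[OF i] kl(1) by (simp add: \<mu>_def)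
    ultimately show False using Q(3)[OF i] by simp
  qed
  with r(2) show "has_form I e m P" unfolding has_form_def by blast
qed

section \<open>Quadratic transformations\<close>

lemma order_ge_compose_differentiable:
  "order_ge f (g q) m \<Longrightarrow> g differentiable (at q) \<Longrightarrow> order_ge (\<lambda>x. f (g x)) q m"
  unfolding differentiable_def using order_ge_compose by blast

lemma homogenized_value:
  assumes "w \<noteq> (0::complex)"
  shows "w ^ d * form_eval d c (x / w, y / w) = (\<Sum>(i,j)\<in>{(i,j). i + j \<le> d}. c i j * x ^ i * y ^ j * w ^ (d - i - j))"
  unfolding form_eval_alt2 sum_distrib_left
proof (intro sum.cong refl, clarify)
  fix i j :: nat assume "i + j \<le> d"
  then have "w ^ d = w ^ (d - i - j) * (w ^ i * w ^ j)" by (simp flip: power_add)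
  then show "w ^ d * (c i j * fst (x / w, y / w) ^ i * snd (x / w, y / w) ^ j) = c i j * x ^ i * y ^ j * w ^ (d - i - j)"
    using assms by (simp add: power_divide)
qed

text \<open>In the projective coordinates with third coordinate \<open>z = w - x - y\<close>, the points
  \<open>(1,0)\<close>, \<open>(0,1)\<close>, \<open>(0,0)\<close> are the vertices of the coordinate triangle.\<close>

lemma triangle_coordinates:
  assumes v1: "order_ge (form_eval d c) (1,0) a1" and v2: "order_ge (form_eval d c) (0,1) a2" and v3: "order_ge (form_eval d c) (0,0) a3"
  obtains \<phi> where
    "\<And>x y z. x + y + z \<noteq> 0 \<Longrightarrow> (\<Sum>(i,j)\<in>{(i,j). i + j \<le> d}. \<phi> i j * x ^ i * y ^ j * z ^ (d - i - j))
        = (x + y + z) ^ d * form_eval d c (x / (x + y + z), y / (x + y + z))"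
    "\<And>i j. i + j \<le> d \<Longrightarrow> \<phi> i j \<noteq> 0 \<Longrightarrow> i + a1 \<le> d \<and> j + a2 \<le> d \<and> a3 \<le> i + j"
proof -
  let ?D = "{(i,j). i + j \<le> d}"
  have "bipoly d (\<lambda>z. \<Sum>x\<in>?D. case x of (i,j) \<Rightarrow> c i j * fst z ^ i * snd z ^ j * (1 + fst z + snd z) ^ (d - i - j))"
  proof (rule bipoly_sum, clarify)
    fix i j assume "i + j \<le> d"
    have "bipoly 1 (\<lambda>z. 1 + fst z + snd z)"
      by (auto intro!: bipoly_add bipoly_const bipoly_fst bipoly_snd)
    then have "bipoly (i + j + (d - i - j) * 1) (\<lambda>z. (c i j * fst z ^ i * snd z ^ j) * (1 + fst z + snd z) ^ (d - i - j))"
      by (intro bipoly_mult bipoly_power bipoly_monom) auto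
    with \<open>i + j \<le> d\<close> show "bipoly d (\<lambda>z. c i j * fst z ^ i * snd z ^ j * (1 + fst z + snd z) ^ (d - i - j))" by simp
  qed
  then obtain \<phi> where "(\<lambda>z. \<Sum>x\<in>?D. case x of (i,j) \<Rightarrow> c i j * fst z ^ i * snd z ^ j * (1 + fst z + snd z) ^ (d - i - j))
      = form_eval d \<phi>" unfolding bipoly_def by blast
  note \<phi>0 = fun_cong[OF this]
  have \<phi>: "form_eval d \<phi> (x,y) = (\<Sum>(i,j)\<in>?D. c i j * x ^ i * y ^ j * (1 + x + y) ^ (d - i - j))" for x y
    using \<phi>0[of "(x,y)"] by simp
  define \<Psi> where "\<Psi> x y z = (\<Sum>(i,j)\<in>?D. \<phi> i j * x ^ i * y ^ j * z ^ (d - i - j))" for x y z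
  define \<Psi>' where "\<Psi>' x y z = (\<Sum>(i,j)\<in>?D. c i j * x ^ i * y ^ j * (x + y + z) ^ (d - i - j))" for x y z
  have eq1: "\<Psi> x y z = \<Psi>' x y z" if "z \<noteq> 0" for x y z
  proof -
    have "\<Psi> x y z = z ^ d * form_eval d \<phi> (x / z, y / z)" using that by (simp add: homogenized_value \<Psi>_def)
    also have "\<dots> = \<Psi>' x y z"
      unfolding \<phi> \<Psi>'_def sum_distrib_left
    proof (intro sum.cong refl, clarify)
      fix i j :: nat assume "i + j \<le> d"
      then have 1: "z ^ d = z ^ (d - i - j) * (z ^ i * z ^ j)" by (simp flip: power_add)
      have 2: "1 + x / z + y / z = (x + y + z) / z" using that by (simp add: field_simps)
      show "z ^ d * (c i j * (x / z) ^ i * (y / z) ^ j * (1 + x / z + y / z) ^ (d - i - j)) =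
         c i j * x ^ i * y ^ j * (x + y + z) ^ (d - i - j)"
        unfolding 2 power_divide unfolding 1 using that by simp
    qed
    finally show ?thesis .
  qed
  \<comment> \<open>Both sides are polynomials in \<open>z\<close> that agree for nonzero
    \<open>z\<close>, so they agree at \<open>z = 0\<close>, where the division by \<open>z\<close>
    made no sense.\<close>
  have eq: "\<Psi> x y z = \<Psi>' x y z" for x y z
  proof (cases "z = 0")
    case True
    have pf: "polyfun (\<lambda>z. \<Psi> x y z - \<Psi>' x y z)"
      unfolding \<Psi>_def \<Psi>'_def case_prod_unfold by (intro polyfun_intros)
    show ?thesis
    proof (rule ccontr)
      assume "\<Psi> x y z \<noteq> \<Psi>' x y z"
      then have "finite {z. \<Psi> x y z - \<Psi>' x y z = 0}"
        by (intro polyfun_finite_zeros[OF pf, of z]) auto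
      moreover have "- {0} \<subseteq> {z. \<Psi> x y z - \<Psi>' x y z = 0}" using eq1 by auto
      ultimately have "finite (- {0 :: complex})" by (rule rev_finite_subset)
      then have "finite (UNIV :: complex set)" by (simp add: finite_compl)
      then show False by (simp add: infinite_UNIV_char_0)
    qed
  qed (rule eq1)
  have val: "\<Psi> x y z = (x + y + z) ^ d * form_eval d c (x / (x + y + z), y / (x + y + z))" if "x + y + z \<noteq> 0" for x y z
    unfolding eq \<Psi>'_def using that by (simp add: homogenized_value)
  have w: "isCont (\<lambda>z :: complex \<times> complex. 1 + fst z + snd z) q" for q
    by (intro continuous_intros)
  have ev: "\<forall>\<^sub>F z in nhds (0, 0). 1 + fst z + snd z \<noteq> (0::complex)"
  proof (rule tendsto_imp_eventually_ne)
    show "((\<lambda>z. 1 + fst z + snd z) \<longlongrightarrow> (1 + fst (0,0) + snd (0,0))) (nhds (0,0::complex))"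
      using w[of "(0,0)"] by (simp add: isCont_def tendsto_nhds_iff)
  qed simp
  \<comment> \<open>Common to the three vertices: in the chart around a vertex, where the two other
    projective coordinates serve as local coordinates, the homogeneous form is a power of
    \<open>w\<close> times the pullback of the original form under a differentiable map. Setting the
    first, second or third coordinate to 1 then permutes the exponents of the monomials.\<close>
  have key: "order_ge (\<lambda>u. (1 + fst u + snd u) ^ d * form_eval d c (A u / (1 + fst u + snd u), B u / (1 + fst u + snd u))) (0,0) m"
    if "A differentiable (at (0,0))" "B differentiable (at (0,0))" "order_ge (form_eval d c) (A (0,0), B (0,0)) m" for A B m
  proof (rule order_ge_mult_cont)
    show "order_ge (\<lambda>u. form_eval d c (A u / (1 + fst u + snd u), B u / (1 + fst u + snd u))) (0,0) m"
    proof (rule order_ge_compose_differentiable[where f = "form_eval d c"])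
      show "order_ge (form_eval d c) (A (0, 0) / (1 + fst (0, 0) + snd (0, 0)), B (0, 0) / (1 + fst (0, 0) + snd (0, 0))) m"
        using that(3) by simp
      from that(1,2) obtain A' B' where AB: "(A has_derivative A') (at (0,0))" "(B has_derivative B') (at (0,0))"
        unfolding differentiable_def by blast
      show "(\<lambda>u. (A u / (1 + fst u + snd u), B u / (1 + fst u + snd u))) differentiable at (0, 0)"
        unfolding differentiable_def
        by (rule exI, (rule has_derivative_Pair has_derivative_divide has_derivative_add has_derivative_const
             has_derivative_fst has_derivative_snd has_derivative_ident AB | simp)+)
    qed
    show "isCont (\<lambda>u. (1 + fst u + snd u) ^ d) (0, 0::complex)" by (intro continuous_intros)
  qed
  have dfst: "fst differentiable (at (q :: complex \<times> complex))" and dsnd: "snd differentiable (at q)" for q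
    unfolding differentiable_def
    by (rule exI, rule has_derivative_fst[OF has_derivative_ident], rule exI, rule has_derivative_snd[OF has_derivative_ident])
  have n3: "\<phi> i j = 0" if "i + j < a3" "i + j \<le> d" for i j
  proof -
    have "order_ge (form_eval d \<phi>) (0,0) a3"
    proof (rule order_ge_cong[OF key[OF dfst dsnd, of a3]])
      show "\<forall>\<^sub>F u in nhds (0, 0). (1 + fst u + snd u) ^ d * form_eval d c (fst u / (1 + fst u + snd u), snd u / (1 + fst u + snd u)) = form_eval d \<phi> u"
        using ev
      proof eventually_elim
        case (elim u)
        have "form_eval d \<phi> u = \<Psi> (fst u) (snd u) 1" by (simp add: form_eval_alt2 \<Psi>_def)
        with elim show ?case by (simp add: val add_ac)
      qed
    qed (use v3 in simp)
    then show ?thesis using that by (rule order_ge_0_imp_coeff)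
  qed
  have n1: "\<phi> i j = 0" if "d < i + a1" "i + j \<le> d" for i j
  proof -
    let ?\<phi> = "\<lambda>q r. \<phi> (d - q - r) q"
    have "order_ge (form_eval d ?\<phi>) (0,0) a1"
    proof (rule order_ge_cong[OF key[of "\<lambda>_. 1" fst a1, OF differentiable_const dfst]])
      show "\<forall>\<^sub>F u in nhds (0, 0). (1 + fst u + snd u) ^ d * form_eval d c (1 / (1 + fst u + snd u), fst u / (1 + fst u + snd u)) = form_eval d ?\<phi> u"
        using ev
      proof eventually_elim
        case (elim u)
        have "form_eval d ?\<phi> u = \<Psi> 1 (fst u) (snd u)"
          unfolding form_eval_alt2 \<Psi>_def
          by (rule sum.reindex_bij_witness[of _ "\<lambda>(i,j). (j, d - i - j)" "\<lambda>(q,r). (d - q - r, q)"]) auto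
        with elim show ?case by (simp add: val)
      qed
    qed (use v1 in simp)
    from order_ge_0_imp_coeff[OF this, of j "d - i - j"] show ?thesis using that by simp
  qed
  have n2: "\<phi> i j = 0" if "d < j + a2" "i + j \<le> d" for i j
  proof -
    let ?\<phi> = "\<lambda>p r. \<phi> p (d - p - r)"
    have "order_ge (form_eval d ?\<phi>) (0,0) a2"
    proof (rule order_ge_cong[OF key[of fst "\<lambda>_. 1" a2, OF dfst differentiable_const]])
      show "\<forall>\<^sub>F u in nhds (0, 0). (1 + fst u + snd u) ^ d * form_eval d c (fst u / (1 + fst u + snd u), 1 / (1 + fst u + snd u)) = form_eval d ?\<phi> u"
        using ev
      proof eventually_elim
        case (elim u)
        have "form_eval d ?\<phi> u = \<Psi> (fst u) 1 (snd u)"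
          unfolding form_eval_alt2 \<Psi>_def
          by (rule sum.reindex_bij_witness[of _ "\<lambda>(i,j). (i, d - i - j)" "\<lambda>(p,r). (p, d - p - r)"]) auto
        with elim show ?case by (simp add: val add_ac)
      qed
    qed (use v2 in simp)
    from order_ge_0_imp_coeff[OF this, of i "d - i - j"] show ?thesis using that by simp
  qed
  show ?thesis
  proof (rule that[of \<phi>])
    show "(\<Sum>(i,j)\<in>?D. \<phi> i j * x ^ i * y ^ j * z ^ (d - i - j))
        = (x + y + z) ^ d * form_eval d c (x / (x + y + z), y / (x + y + z))" if "x + y + z \<noteq> 0" for x y z
      using val[OF that] by (simp add: \<Psi>_def)
    show "i + a1 \<le> d \<and> j + a2 \<le> d \<and> a3 \<le> i + j" if "i + j \<le> d" "\<phi> i j \<noteq> 0" for i j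
      using n1[of i j] n2[of j i] n3[of i j] that by (meson not_le)
  qed
qed

text \<open>Twice the signed area of the triangle. In one argument it is the equation of the line
  through the two others, that is, a barycentric coordinate up to a common factor.\<close>

definition tri :: "complex \<times> complex \<Rightarrow> complex \<times> complex \<Rightarrow> complex \<times> complex \<Rightarrow> complex" where
  "tri A B C = (fst B - fst A) * (snd C - snd A) - (fst C - fst A) * (snd B - snd A)"

lemma tri_same [simp]: "tri A A C = 0" "tri A B A = 0" "tri A B B = 0"
  by (auto simp: tri_def)

lemma tri_differentiable:
  "(\<lambda>X. tri X B C) differentiable (at q)" "(\<lambda>X. tri B X C) differentiable (at q)" "(\<lambda>X. tri B C X) differentiable (at q)"
  unfolding tri_def differentiable_def
  by (rule exI, (rule has_derivative_diff has_derivative_mult has_derivative_const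
             has_derivative_fst has_derivative_snd has_derivative_ident)+)+

lemma differentiable_imp_isCont: "f differentiable (at q) \<Longrightarrow> isCont f q"
  unfolding differentiable_def using has_derivative_continuous by blast

lemma order_ge_of_zero:
  assumes "f differentiable (at q)" "f q = 0" shows "order_ge f q 1"
proof -
  have "order_ge (\<lambda>z. fst (z - 0)) ((f q, 0) :: complex \<times> complex) 1"
    using order_ge_fst[of 0] assms(2) by (simp add: zero_prod_def)
  moreover have "(\<lambda>z. (f z, 0 :: complex)) differentiable (at q)"
    using assms(1) unfolding differentiable_def by (auto intro!: has_derivative_Pair has_derivative_const)
  ultimately show ?thesis
    using order_ge_compose_differentiable[of "\<lambda>z. fst (z - 0)" "\<lambda>z. (f z, 0)" q 1] by simp
qed

lemma bipoly_tri:
  "bipoly 1 (\<lambda>X. tri X B C)" "bipoly 1 (\<lambda>X. tri B X C)" "bipoly 1 (\<lambda>X. tri B C X)"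
proof -
  have eq: "tri X B C = (snd B - snd C) * fst X + (fst C - fst B) * snd X + (fst B * snd C - fst C * snd B)"
    "tri B X C = (snd C - snd B) * fst X + (fst B - fst C) * snd X + (snd B * fst C - fst B * snd C)"
    "tri B C X = (snd B - snd C) * fst X + (fst C - fst B) * snd X + (fst B * snd C - fst C * snd B)" for X
    by (simp_all add: tri_def algebra_simps)
  have lin: "bipoly 1 (\<lambda>X. u * fst X + v * snd X + k)" for u v k
    by (intro bipoly_add bipoly_const bipoly_cmult) (simp_all add: bipoly_fst bipoly_snd)
  show "bipoly 1 (\<lambda>X. tri X B C)" "bipoly 1 (\<lambda>X. tri B X C)" "bipoly 1 (\<lambda>X. tri B C X)"
    unfolding eq by (rule lin)+
qed

lemma order_ge_monomials:
  assumes "order_ge y q 1" "order_ge z q 1" "isCont x q" "a \<le> m + n"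
  shows "order_ge (\<lambda>X. c * x X ^ l * y X ^ m * z X ^ n) q a"
proof -
  have "order_ge (\<lambda>X. (c * x X ^ l) * (y X ^ m * z X ^ n)) q (m + n)"
    by (intro order_ge_mult_cont order_ge_mult order_ge_power assms continuous_intros)
  then show ?thesis using assms(4) by (auto simp: mult.assoc intro: order_ge_antimono)
qed

text \<open>In barycentric coordinates of the triangle \<open>P i\<close>, \<open>P j\<close>,
  \<open>P k\<close>, the map \<sigma> is the standard quadratic transformation [x : y : z] to
  [yz : xz : xy]. A curve with the given multiplicities at the vertices and at the images of the
  other points is pulled back by \<sigma>, and the sides of the triangle are removed from it. The
  conditions on \<open>P l\<close> say that it lies on no side and, by the last one, that its image
  is not at infinity.\<close>

lemma has_form_cremona_general_position:
  fixes P :: "nat \<Rightarrow> complex \<times> complex"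
  assumes eff: "everywhere_effective I d b"
    and ijk: "i \<in> I" "j \<in> I" "k \<in> I" "i \<noteq> j" "i \<noteq> k" "j \<noteq> k"
    and gen: "tri (P i) (P j) (P k) \<noteq> 0"
      "\<And>l. l \<in> I - {i,j,k} \<Longrightarrow> tri (P l) (P j) (P k) \<noteq> 0"
      "\<And>l. l \<in> I - {i,j,k} \<Longrightarrow> tri (P i) (P l) (P k) \<noteq> 0"
      "\<And>l. l \<in> I - {i,j,k} \<Longrightarrow> tri (P i) (P j) (P l) \<noteq> 0"
      "\<And>l. l \<in> I - {i,j,k} \<Longrightarrow> tri (P i) (P l) (P k) * tri (P i) (P j) (P l)
         + tri (P l) (P j) (P k) * tri (P i) (P j) (P l) + tri (P l) (P j) (P k) * tri (P i) (P l) (P k) \<noteq> 0"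
  shows "b i + b j + b k \<le> 2 * d \<and> has_form I (2 * d - b i - b j - b k)
     (b(i := d - b j - b k, j := d - b i - b k, k := d - b i - b j)) P"
proof -
  define x where "x = (\<lambda>X. tri X (P j) (P k))"
  define y where "y = (\<lambda>X. tri (P i) X (P k))"
  define z where "z = (\<lambda>X. tri (P i) (P j) X)"
  define w where "w X = y X * z X + x X * z X + x X * y X" for X
  define \<sigma> where "\<sigma> X = (y X * z X / w X, x X * z X / w X)" for X
  let ?D = "{(p,q). p + q \<le> d}"
  have diff: "x differentiable (at q)" "y differentiable (at q)" "z differentiable (at q)" for q
    unfolding x_def y_def z_def by (rule tri_differentiable)+
  have cont: "isCont x q" "isCont y q" "isCont z q" for q
    by (rule differentiable_imp_isCont, rule diff)+
  have bip: "bipoly 1 x" "bipoly 1 y" "bipoly 1 z" unfolding x_def y_def z_def by (rule bipoly_tri)+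
  obtain c where c: "nonzero_form d c" "\<And>l. l \<in> I \<Longrightarrow> order_ge (form_eval d c) (((\<lambda>l. \<sigma> (P l))(i := (1,0), j := (0,1), k := (0,0))) l) (b l)"
    using eff unfolding everywhere_effective_def has_form_def vanishes_iff_order_ge by blast
  have v: "order_ge (form_eval d c) (1,0) (b i)" "order_ge (form_eval d c) (0,1) (b j)" "order_ge (form_eval d c) (0,0) (b k)"
    using c(2)[OF ijk(1)] c(2)[OF ijk(2)] c(2)[OF ijk(3)] ijk by auto
  obtain \<phi> where \<phi>: "\<And>x y z. x + y + z \<noteq> 0 \<Longrightarrow> (\<Sum>(p,q)\<in>?D. \<phi> p q * x ^ p * y ^ q * z ^ (d - p - q))
        = (x + y + z) ^ d * form_eval d c (x / (x + y + z), y / (x + y + z))"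
    and \<phi>0: "\<And>p q. p + q \<le> d \<Longrightarrow> \<phi> p q \<noteq> 0 \<Longrightarrow> p + b i \<le> d \<and> q + b j \<le> d \<and> b k \<le> p + q"
    using triangle_coordinates[OF v] by blast
  \<comment> \<open>The form with yz, xz, xy substituted for the coordinates, divided by the powers
    \<open>b i\<close>, \<open>b j\<close>, \<open>b k\<close> of the three sides. For nonzero
    \<open>\<phi> p q\<close> the exponents are true differences, by the bounds in
    \<open>\<phi>0\<close>.\<close>
  define G where "G X = (\<Sum>(p,q)\<in>?D. \<phi> p q * x X ^ (d - b i - p) * y X ^ (d - b j - q) * z X ^ (p + q - b k))" for X
  have G: "G X * (x X ^ b i * y X ^ b j * z X ^ b k) = w X ^ d * form_eval d c (\<sigma> X)" if "w X \<noteq> 0" for X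
  proof -
    have "G X * (x X ^ b i * y X ^ b j * z X ^ b k) =
      (\<Sum>(p,q)\<in>?D. \<phi> p q * (y X * z X) ^ p * (x X * z X) ^ q * (x X * y X) ^ (d - p - q))"
      unfolding G_def sum_distrib_right
    proof (intro sum.cong refl, clarify)
      fix p q assume pq: "p + q \<le> d"
      show "\<phi> p q * x X ^ (d - b i - p) * y X ^ (d - b j - q) * z X ^ (p + q - b k) * (x X ^ b i * y X ^ b j * z X ^ b k)
        = \<phi> p q * (y X * z X) ^ p * (x X * z X) ^ q * (x X * y X) ^ (d - p - q)"
      proof (cases "\<phi> p q = 0")
        case False
        from \<phi>0[OF pq False] pq have e: "d - b i - p + b i = q + (d - p - q)" "d - b j - q + b j = p + (d - p - q)"
          "p + q - b k + b k = p + q" by auto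
        have "\<phi> p q * x X ^ (d - b i - p) * y X ^ (d - b j - q) * z X ^ (p + q - b k) * (x X ^ b i * y X ^ b j * z X ^ b k)
          = \<phi> p q * (x X ^ (d - b i - p) * x X ^ b i) * (y X ^ (d - b j - q) * y X ^ b j) * (z X ^ (p + q - b k) * z X ^ b k)"
          by (simp only: mult_ac)
        also have "\<dots> = \<phi> p q * (x X ^ q * x X ^ (d - p - q)) * (y X ^ p * y X ^ (d - p - q)) * (z X ^ p * z X ^ q)"
          unfolding power_add[symmetric] e by (rule refl)
        also have "\<dots> = \<phi> p q * (y X * z X) ^ p * (x X * z X) ^ q * (x X * y X) ^ (d - p - q)"
          by (simp only: power_mult_distrib mult_ac)
        finally show ?thesis .
      qed simp
    qed
    also have "\<dots> = w X ^ d * form_eval d c (\<sigma> X)"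
      using \<phi>[of "y X * z X" "x X * z X" "x X * y X"] that by (simp add: w_def \<sigma>_def)
    finally show ?thesis .
  qed
  \<comment> \<open>The standard quadratic transformation is its own inverse. A point
    \<open>T\<close> off the curve, off the coordinate triangle and off the conic \<open>S\<close>
    is therefore the image of the point with barycentric coordinates t2 t3 / S, t1 t3 / S, t1 t2 /
    S, and \<open>G\<close> does not vanish there.\<close>
  obtain X0 where X0: "G X0 \<noteq> 0"
  proof -
    obtain z0 where z0: "form_eval d c z0 \<noteq> 0" using nonzero_form_value[OF c(1)] by blast
    have lin: "bipoly 1 (\<lambda>T. 1 - fst T - snd T)"
      by (intro bipoly_diff bipoly_const) (simp_all add: bipoly_fst bipoly_snd)
    have t: "bipoly 1 fst" "bipoly 1 snd" by (simp_all add: bipoly_fst bipoly_snd)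
    let ?S = "\<lambda>T. snd T * (1 - fst T - snd T) + fst T * (1 - fst T - snd T) + fst T * snd T :: complex"
    let ?H = "\<lambda>T. fst T * snd T * (1 - fst T - snd T) * ?S T"
    have H: "bipoly (1 + 1 + 1 + (1 + 1)) ?H"
      by (intro bipoly_mult bipoly_add lin t)
    have f: "bipoly d (form_eval d c)" unfolding bipoly_def by blast
    have "?H (1/3,1/3) \<noteq> 0" by simp
    then have "\<exists>T. ?H T \<noteq> 0 \<and> form_eval d c T \<noteq> 0"
      using bipoly_mult_nonzero[of _ ?H d "form_eval d c" "(1/3,1/3)" z0, OF H f] z0 by blast
    then obtain T where T: "form_eval d c T \<noteq> 0" "?H T \<noteq> 0" by blast
    define t1 where "t1 = fst T"
    define t2 where "t2 = snd T"
    define t3 where "t3 = 1 - t1 - t2"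
    define S where "S = t2 * t3 + t1 * t3 + t1 * t2"
    have nz: "t1 \<noteq> 0" "t2 \<noteq> 0" "t3 \<noteq> 0" "S \<noteq> 0" using T(2) by (auto simp: t1_def t2_def t3_def S_def)
    define \<Delta> where "\<Delta> = tri (P i) (P j) (P k)"
    define \<alpha> where "\<alpha> = t2 * t3 / S"
    define \<beta> where "\<beta> = t1 * t3 / S"
    define \<gamma> where "\<gamma> = t1 * t2 / S"
    have "\<alpha> + \<beta> + \<gamma> = S / S"
      by (simp only: \<alpha>_def \<beta>_def \<gamma>_def add_divide_distrib[symmetric] S_def)
    then have one: "\<gamma> = 1 - \<alpha> - \<beta>" using nz by (simp add: algebra_simps)
    define X where "X = (\<alpha> * fst (P i) + \<beta> * fst (P j) + \<gamma> * fst (P k), \<alpha> * snd (P i) + \<beta> * snd (P j) + \<gamma> * snd (P k))"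
    have xyz: "x X = \<alpha> * \<Delta>" "y X = \<beta> * \<Delta>" "z X = \<gamma> * \<Delta>"
      unfolding x_def y_def z_def X_def one \<Delta>_def tri_def fst_conv snd_conv by algebra+
    have t: "t1 + t2 + t3 = 1" by (simp add: t3_def)
    have w: "w X = \<Delta>^2 * (t1 * t2 * t3) / S^2"
    proof -
      have "w X = \<Delta>^2 * (t1 * t2 * t3 * (t1 + t2 + t3)) / S^2"
        unfolding w_def xyz \<alpha>_def \<beta>_def \<gamma>_def using nz by (simp add: field_simps power2_eq_square)
      then show ?thesis by (simp add: t)
    qed
    have \<Delta>: "\<Delta> \<noteq> 0" using gen(1) by (simp add: \<Delta>_def)
    have "\<sigma> X = T"
      unfolding \<sigma>_def w xyz using nz \<Delta>
      by (intro prod_eqI) (simp_all add: \<alpha>_def \<beta>_def \<gamma>_def t1_def[symmetric] t2_def[symmetric] field_simps power2_eq_square)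
    moreover have "w X \<noteq> 0" unfolding w using nz \<Delta> by simp
    ultimately have "G X \<noteq> 0" using G[of X] T(1) by auto
    then show ?thesis by (rule that)
  qed
  \<comment> \<open>A monomial with nonzero coefficient has p at most d - b_i, q at most d - b_j and
    p + q at least b_k. If the degree bound failed there would be none, and \<open>G\<close> would
    be zero.\<close>
  have deg: "b i + b j + b k \<le> 2 * d"
  proof (rule ccontr)
    assume *: "\<not> ?thesis"
    have "G X0 = 0" unfolding G_def
    proof (intro sum.neutral ballI, clarify)
      fix p q assume "p + q \<le> d"
      with * \<phi>0[of p q] have "\<phi> p q = 0" by (cases "\<phi> p q = 0") auto
      then show "\<phi> p q * x X0 ^ (d - b i - p) * y X0 ^ (d - b j - q) * z X0 ^ (p + q - b k) = 0" by simp
    qed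
    with X0 show False by simp
  qed
  have Gb: "bipoly (2 * d - b i - b j - b k) G"
    unfolding G_def[abs_def]
  proof (rule bipoly_sum, clarify)
    fix p q assume pq: "p + q \<le> d"
    show "bipoly (2 * d - b i - b j - b k) (\<lambda>X. \<phi> p q * x X ^ (d - b i - p) * y X ^ (d - b j - q) * z X ^ (p + q - b k))"
    proof (cases "\<phi> p q = 0")
      case True
      then show ?thesis by (simp add: bipoly_zero)
    next
      case False
      have "bipoly (0 + (d - b i - p) * 1 + (d - b j - q) * 1 + (p + q - b k) * 1)
         (\<lambda>X. \<phi> p q * x X ^ (d - b i - p) * y X ^ (d - b j - q) * z X ^ (p + q - b k))"
        by (intro bipoly_mult bipoly_power bipoly_const bip)
      then show ?thesis by (rule bipoly_mono) (use \<phi>0[OF pq False] pq in auto)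
    qed
  qed
  have van0: "x (P j) = 0" "x (P k) = 0" "y (P i) = 0" "y (P k) = 0" "z (P i) = 0" "z (P j) = 0"
    by (simp_all add: x_def y_def z_def)
  have vz: "order_ge x (P j) 1" "order_ge x (P k) 1" "order_ge y (P i) 1" "order_ge y (P k) 1" "order_ge z (P i) 1" "order_ge z (P j) 1"
    by (rule order_ge_of_zero, rule diff, rule van0)+
  have vt: "order_ge (\<lambda>X. \<phi> p q * x X ^ (d - b i - p) * y X ^ (d - b j - q) * z X ^ (p + q - b k)) (P i) (d - b j - b k)"
       "order_ge (\<lambda>X. \<phi> p q * x X ^ (d - b i - p) * y X ^ (d - b j - q) * z X ^ (p + q - b k)) (P j) (d - b i - b k)"
       "order_ge (\<lambda>X. \<phi> p q * x X ^ (d - b i - p) * y X ^ (d - b j - q) * z X ^ (p + q - b k)) (P k) (d - b i - b j)"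
    if pq: "p + q \<le> d" for p q
  proof -
    have "order_ge (\<lambda>X. \<phi> p q * x X ^ (d - b i - p) * y X ^ (d - b j - q) * z X ^ (p + q - b k)) (P i) (d - b j - b k) \<and>
       order_ge (\<lambda>X. \<phi> p q * x X ^ (d - b i - p) * y X ^ (d - b j - q) * z X ^ (p + q - b k)) (P j) (d - b i - b k) \<and>
       order_ge (\<lambda>X. \<phi> p q * x X ^ (d - b i - p) * y X ^ (d - b j - q) * z X ^ (p + q - b k)) (P k) (d - b i - b j)"
    proof (cases "\<phi> p q = 0")
      case True
      then show ?thesis by (simp add: order_ge_zero)
    next
      case False
      note bd = \<phi>0[OF pq False]
      have "order_ge (\<lambda>X. \<phi> p q * x X ^ (d - b i - p) * y X ^ (d - b j - q) * z X ^ (p + q - b k)) (P i) (d - b j - b k)"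
        by (rule order_ge_monomials[OF vz(3,5) cont(1)]) (use bd in auto)
      moreover have "order_ge (\<lambda>X. \<phi> p q * y X ^ (d - b j - q) * x X ^ (d - b i - p) * z X ^ (p + q - b k)) (P j) (d - b i - b k)"
        by (rule order_ge_monomials[OF vz(1,6) cont(2)]) (use bd in auto)
      moreover have "order_ge (\<lambda>X. \<phi> p q * z X ^ (p + q - b k) * x X ^ (d - b i - p) * y X ^ (d - b j - q)) (P k) (d - b i - b j)"
        by (rule order_ge_monomials[OF vz(2,4) cont(3)]) (use bd pq in auto)
      ultimately show ?thesis by (simp add: mult_ac)
    qed
    then show "order_ge (\<lambda>X. \<phi> p q * x X ^ (d - b i - p) * y X ^ (d - b j - q) * z X ^ (p + q - b k)) (P i) (d - b j - b k)"
       "order_ge (\<lambda>X. \<phi> p q * x X ^ (d - b i - p) * y X ^ (d - b j - q) * z X ^ (p + q - b k)) (P j) (d - b i - b k)"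
       "order_ge (\<lambda>X. \<phi> p q * x X ^ (d - b i - p) * y X ^ (d - b j - q) * z X ^ (p + q - b k)) (P k) (d - b i - b j)"
      by blast+
  qed
  have Gv: "order_ge G (P i) (d - b j - b k)" "order_ge G (P j) (d - b i - b k)" "order_ge G (P k) (d - b i - b j)"
    unfolding G_def[abs_def] using vt by (auto intro!: order_ge_sum)
  \<comment> \<open>Near \<open>P l\<close> the sides of the triangle do not vanish, so
    \<open>G\<close> is a continuous function times the pullback under the differentiable map
    \<sigma>.\<close>
  have Gl: "order_ge G (P l) (b l)" if l: "l \<in> I - {i,j,k}" for l
  proof -
    have nz: "x (P l) \<noteq> 0" "y (P l) \<noteq> 0" "z (P l) \<noteq> 0" "w (P l) \<noteq> 0"
      using gen(2-5)[OF l] by (auto simp: x_def y_def z_def w_def)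
    have dw: "w differentiable (at (P l))"
      unfolding w_def[abs_def] by (intro differentiable_add differentiable_mult diff)
    have d\<sigma>: "\<sigma> differentiable (at (P l))"
    proof -
      have "(\<lambda>X. y X * z X / w X) differentiable (at (P l))" "(\<lambda>X. x X * z X / w X) differentiable (at (P l))"
        by (intro differentiable_divide differentiable_mult diff dw nz)+
      then obtain D D' where "((\<lambda>X. y X * z X / w X) has_derivative D) (at (P l))"
        "((\<lambda>X. x X * z X / w X) has_derivative D') (at (P l))"
        unfolding differentiable_def by blast
      from has_derivative_Pair[OF this] show ?thesis
        unfolding \<sigma>_def[abs_def] differentiable_def by blast
    qed
    have v1: "order_ge (\<lambda>X. form_eval d c (\<sigma> X)) (P l) (b l)"
      by (rule order_ge_compose_differentiable[OF _ d\<sigma>]) (use c(2)[of l] l in auto)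
    have "order_ge (\<lambda>X. (w X ^ d * inverse (x X ^ b i * y X ^ b j * z X ^ b k)) * form_eval d c (\<sigma> X)) (P l) (b l)"
      by (rule order_ge_mult_cont[OF v1])
         (intro continuous_intros cont differentiable_imp_isCont[OF dw], use nz in auto)
    moreover have "\<forall>\<^sub>F X in nhds (P l). f X \<noteq> 0" if "isCont f (P l)" "f (P l) \<noteq> 0" for f :: "complex \<times> complex \<Rightarrow> complex"
      using that by (intro tendsto_imp_eventually_ne) (auto simp: isCont_def tendsto_nhds_iff)
    then have "\<forall>\<^sub>F X in nhds (P l). w X \<noteq> 0 \<and> x X \<noteq> 0 \<and> y X \<noteq> 0 \<and> z X \<noteq> 0"
      using nz cont differentiable_imp_isCont[OF dw] by (intro eventually_conj) auto
    then have "\<forall>\<^sub>F X in nhds (P l). (w X ^ d * inverse (x X ^ b i * y X ^ b j * z X ^ b k)) * form_eval d c (\<sigma> X) = G X"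
    proof eventually_elim
      case (elim X)
      then show ?case using G[of X] by (simp add: field_simps)
    qed
    ultimately show ?thesis by (rule order_ge_cong)
  qed
  obtain c' where c': "G = form_eval (2 * d - b i - b j - b k) c'" "nonzero_form (2 * d - b i - b j - b k) c'"
    by (rule bipoly_nonzero_form[OF Gb X0])
  have "order_ge G (P l) ((b(i := d - b j - b k, j := d - b i - b k, k := d - b i - b j)) l)" if "l \<in> I" for l
    using Gv Gl[of l] that ijk by auto
  then have "has_form I (2 * d - b i - b j - b k) (b(i := d - b j - b k, j := d - b i - b k, k := d - b i - b j)) P"
    unfolding has_form_def vanishes_iff_order_ge using c' by blast
  with deg show ?thesis by blast
qed

lemma polyfun_tri_line:
  "polyfun (\<lambda>t. tri (line_at A A' t) (line_at B B' t) (line_at C C' t))"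
  unfolding tri_def by (intro polyfun_intros polyfun_fst_line_at polyfun_snd_line_at)

text \<open>Every configuration is a limit of configurations in general position, and possession of
  a form passes to the limit. Truncated subtraction is intended: a negative transformed multiplicity
  is replaced by 0.\<close>

lemma everywhere_effective_cremona:
  assumes eff: "everywhere_effective I d b" and fin: "finite I"
    and ijk: "i \<in> I" "j \<in> I" "k \<in> I" "i \<noteq> j" "i \<noteq> k" "j \<noteq> k"
  shows "b i + b j + b k \<le> 2 * d"
    "everywhere_effective I (2 * d - b i - b j - b k)
     (b(i := d - b j - b k, j := d - b i - b k, k := d - b i - b j))" (is "everywhere_effective I ?d' ?b'")
proof -
  have "\<exists>Pn. (\<forall>n. b i + b j + b k \<le> 2 * d \<and> has_form I ?d' ?b' (Pn n)) \<and> (\<forall>l. (\<lambda>n. Pn n l) \<longlonglongrightarrow> P l)" for P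
  proof -
    \<comment> \<open>A reference configuration satisfying all genericity conditions: the vertices
      of a triangle and its barycenter. The other points may share the barycenter, since each
      condition involves only one of them.\<close>
    define Q :: "nat \<Rightarrow> complex \<times> complex" where "Q = (\<lambda>l. (1/3,1/3))(i := (1,0), j := (0,1), k := (0,0))"
    define Pt where "Pt t l = line_at (P l) (Q l) t" for t l
    let ?x = "\<lambda>t l. tri (Pt t l) (Pt t j) (Pt t k)"
    let ?y = "\<lambda>t l. tri (Pt t i) (Pt t l) (Pt t k)"
    let ?z = "\<lambda>t l. tri (Pt t i) (Pt t j) (Pt t l)"
    let ?B = "\<lambda>l. {t. ?x t l = 0} \<union> {t. ?y t l = 0} \<union> {t. ?z t l = 0} \<union> {t. ?y t l * ?z t l + ?x t l * ?z t l + ?x t l * ?y t l = 0}"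
    define B where "B = {t. tri (Pt t i) (Pt t j) (Pt t k) = 0} \<union> (\<Union>l\<in>I - {i,j,k}. ?B l)"
    have pf: "polyfun (\<lambda>t. tri (Pt t l) (Pt t l') (Pt t l''))" for l l' l''
      unfolding Pt_def by (rule polyfun_tri_line)
    have Qs: "Q i = (1,0)" "Q j = (0,1)" "Q k = (0,0)" using ijk by (auto simp: Q_def)
    have at1: "Pt 1 l = Q l" for l by (simp add: Pt_def)
    have "finite {t. tri (Pt t i) (Pt t j) (Pt t k) = 0}"
      by (rule polyfun_finite_zeros[OF pf, of 1]) (simp add: at1 Qs tri_def)
    moreover have "finite (?B l)" if "l \<in> I - {i,j,k}" for l
    proof -
      have Ql: "Q l = (1/3,1/3)" using that by (auto simp: Q_def)
      have "finite {t. ?x t l = 0}" "finite {t. ?y t l = 0}" "finite {t. ?z t l = 0}"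
        "finite {t. ?y t l * ?z t l + ?x t l * ?z t l + ?x t l * ?y t l = 0}"
        by (rule polyfun_finite_zeros[of _ 1], intro polyfun_intros pf, simp add: at1 Qs Ql tri_def field_simps)+
      then show ?thesis by blast
    qed
    ultimately have "finite B" unfolding B_def using fin by blast
    then have B: "countable B" by (rule countable_finite)
    have "\<exists>t. t \<notin> B \<and> norm t < inverse (of_nat (Suc n))" for n
      by (rule avoid_countable[OF B, of "inverse (of_nat (Suc n))"]) auto
    then obtain t where t: "\<And>n. t n \<notin> B" "\<And>n. norm (t n) < inverse (of_nat (Suc n))" by metis
    have "b i + b j + b k \<le> 2 * d \<and> has_form I ?d' ?b' (Pt (t n))" for n
      by (rule has_form_cremona_general_position[OF eff ijk]) (use t(1)[of n] in \<open>auto simp: B_def\<close>)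
    moreover have "(\<lambda>n. Pt (t n) l) \<longlonglongrightarrow> P l" for l
      unfolding Pt_def by (rule tendsto_line_at, rule tendsto_0_norm_less_inverse, rule t(2))
    ultimately show ?thesis by (intro exI[of _ "\<lambda>n. Pt (t n)"]) simp
  qed
  then show "b i + b j + b k \<le> 2 * d" "everywhere_effective I ?d' ?b'"
    unfolding everywhere_effective_def by (metis has_form_closed)+
qed

section \<open>Nef classes\<close>

text \<open>Nefness of \<open>d\<close> H minus the sum of the \<open>m i\<close> E_i, tested
  against classes effective at every configuration. These include all effective classes on very
  general points, once negative multiplicities are replaced by 0, and they are stable under Cremona
  transformations and collisions.\<close>

definition nef_on :: "nat set \<Rightarrow> real \<Rightarrow> (nat \<Rightarrow> real) \<Rightarrow> bool" where
  "nef_on I d m \<longleftrightarrow> (\<forall>e b. everywhere_effective I e b \<longrightarrow> (\<Sum>i\<in>I. m i * real (b i)) \<le> d * real e)"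

lemma nef_on_cong: "nef_on I d m \<Longrightarrow> (\<And>i. i \<in> I \<Longrightarrow> m i = m' i) \<Longrightarrow> nef_on I d m'"
  unfolding nef_on_def by simp

lemma nef_on_scale:
  assumes "nef_on I d m" "t \<ge> 0" shows "nef_on I (t * d) (\<lambda>i. t * m i)"
  unfolding nef_on_def
proof (intro allI impI)
  fix e b assume "everywhere_effective I e b"
  then have "t * (\<Sum>i\<in>I. m i * real (b i)) \<le> t * (d * real e)"
    using assms unfolding nef_on_def by (intro mult_left_mono) auto
  then show "(\<Sum>i\<in>I. t * m i * real (b i)) \<le> t * d * real e"
    by (simp add: sum_distrib_left mult.assoc)
qed

lemma nef_on_limit:
  assumes "\<forall>\<^sub>F n in sequentially. nef_on I (d n) (m n)" "d \<longlonglongrightarrow> d'" "\<And>i. i \<in> I \<Longrightarrow> (\<lambda>n. m n i) \<longlonglongrightarrow> m' i"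
  shows "nef_on I d' m'"
  unfolding nef_on_def
proof (intro allI impI)
  fix e b assume *: "everywhere_effective I e b"
  show "(\<Sum>i\<in>I. m' i * real (b i)) \<le> d' * real e"
  proof (rule tendsto_le)
    show "(\<lambda>n. d n * real e) \<longlonglongrightarrow> d' * real e" by (intro tendsto_intros assms)
    show "(\<lambda>n. \<Sum>i\<in>I. m n i * real (b i)) \<longlonglongrightarrow> (\<Sum>i\<in>I. m' i * real (b i))" by (intro tendsto_intros assms)
    show "\<forall>\<^sub>F n in sequentially. (\<Sum>i\<in>I. m n i * real (b i)) \<le> d n * real e"
      using assms(1) by eventually_elim (use * in \<open>auto simp: nef_on_def\<close>)
  qed simp
qed

lemma everywhere_effective_subset: "everywhere_effective I e b \<Longrightarrow> J \<subseteq> I \<Longrightarrow> everywhere_effective J e b"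
  unfolding everywhere_effective_def has_form_def by blast

lemma nef_on_extend:
  assumes "nef_on J d m" "J \<subseteq> I" "finite I" "\<And>i. i \<in> I - J \<Longrightarrow> m i = 0"
  shows "nef_on I d m"
  unfolding nef_on_def
proof (intro allI impI)
  fix e b assume "everywhere_effective I e b"
  then have "(\<Sum>i\<in>J. m i * real (b i)) \<le> d * real e"
    using everywhere_effective_subset assms(1,2) unfolding nef_on_def by blast
  also have "(\<Sum>i\<in>J. m i * real (b i)) = (\<Sum>i\<in>I. m i * real (b i))"
    using assms(2-4) by (intro sum.mono_neutral_left) auto
  finally show "(\<Sum>i\<in>I. m i * real (b i)) \<le> d * real e" .
qed

lemma sum_split3:
  fixes f :: "nat \<Rightarrow> 'a :: comm_monoid_add"
  assumes "finite I" "i \<in> I" "j \<in> I" "k \<in> I" "i \<noteq> j" "i \<noteq> k" "j \<noteq> k"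
  shows "sum f I = f i + (f j + (f k + sum f (I - {i,j,k})))"
proof -
  have "sum f I = f i + sum f (I - {i})" using assms by (intro sum.remove) auto
  also have "sum f (I - {i}) = f j + sum f (I - {i} - {j})" using assms by (intro sum.remove) auto
  also have "sum f (I - {i} - {j}) = f k + sum f (I - {i} - {j} - {k})" using assms by (intro sum.remove) auto
  also have "I - {i} - {j} - {k} = I - {i,j,k}" by auto
  finally show ?thesis .
qed

text \<open>The intersection number is unchanged when both classes are transformed, so the claim for
  \<open>(e, b)\<close> is the hypothesis for its transform. Truncated subtraction can only raise
  the multiplicities of the transform, which is harmless because \<open>m i\<close>,
  \<open>m j\<close>, \<open>m k\<close> are nonnegative.\<close>

lemma nef_on_cremona:
  assumes nef: "nef_on I d m" and fin: "finite I"
    and ijk: "i \<in> I" "j \<in> I" "k \<in> I" "i \<noteq> j" "i \<noteq> k" "j \<noteq> k"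
    and nonneg: "m i \<ge> 0" "m j \<ge> 0" "m k \<ge> 0"
  shows "nef_on I (2 * d - m i - m j - m k) (m(i := d - m j - m k, j := d - m i - m k, k := d - m i - m j))"
  unfolding nef_on_def
proof (intro allI impI)
  fix e b assume eff: "everywhere_effective I e b"
  let ?m = "m(i := d - m j - m k, j := d - m i - m k, k := d - m i - m j)"
  let ?b = "b(i := e - b j - b k, j := e - b i - b k, k := e - b i - b j)"
  let ?R = "\<Sum>l\<in>I - {i,j,k}. m l * real (b l)"
  note cr = everywhere_effective_cremona[OF eff fin ijk]
  have "(\<Sum>l\<in>I. m l * real (?b l)) \<le> d * real (2 * e - b i - b j - b k)"
    using nef cr(2) unfolding nef_on_def by blast
  also have "(\<Sum>l\<in>I. m l * real (?b l)) =
     m i * real (e - b j - b k) + (m j * real (e - b i - b k) + (m k * real (e - b i - b j) + ?R))"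
    using ijk by (subst sum_split3[OF fin ijk]) auto
  also have "real (2 * e - b i - b j - b k) = 2 * real e - real (b i) - real (b j) - real (b k)"
    using cr(1) by simp
  finally have 1: "m i * real (e - b j - b k) + (m j * real (e - b i - b k) + (m k * real (e - b i - b j) + ?R))
     \<le> d * (2 * real e - real (b i) - real (b j) - real (b k))" .
  have 2: "x * (real e - real p - real q) \<le> x * real (e - p - q)" if "x \<ge> 0" for x p q
    using that by (intro mult_left_mono) auto
  have "(\<Sum>l\<in>I. ?m l * real (b l)) = (d - m j - m k) * real (b i) + ((d - m i - m k) * real (b j) + ((d - m i - m j) * real (b k) + ?R))"
    using ijk by (subst sum_split3[OF fin ijk]) auto
  also have "\<dots> \<le> (2 * d - m i - m j - m k) * real e"
    using 1 2[OF nonneg(1), of "b j" "b k"] 2[OF nonneg(2), of "b i" "b k"] 2[OF nonneg(3), of "b i" "b j"]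
    by (simp add: algebra_simps)
  finally show "(\<Sum>l\<in>I. ?m l * real (b l)) \<le> (2 * d - m i - m j - m k) * real e" .
qed

text \<open>When the points over \<open>i\<close> collide, the limit curve acquires multiplicity at
  least the sum of their multiplicities divided by \<open>h i\<close>, rounded up. Pairing
  \<open>m\<close> with these multiplicities bounds the pairing of the split class with
  \<open>b\<close>.\<close>

lemma nef_on_collide:
  assumes nef: "nef_on I d m" and fin: "finite I" "finite J"
    and m: "\<And>i. i \<in> I \<Longrightarrow> m i \<ge> 0"
    and h: "\<And>i. i \<in> I \<Longrightarrow> h i > 0" "\<And>i. i \<in> I \<Longrightarrow> card {j \<in> J. g j = i} = h i ^ 2"
  shows "nef_on J d (\<lambda>j. if g j \<in> I then m (g j) / real (h (g j)) else 0)"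
  unfolding nef_on_def
proof (intro allI impI)
  fix e b assume eff: "everywhere_effective J e b"
  let ?B = "\<lambda>i. \<Sum>j | j \<in> J \<and> g j = i. b j"
  define l where "l i = nat \<lceil>real (?B i) / real (h i)\<rceil>" for i
  have "everywhere_effective I e l"
  proof (rule everywhere_effective_collide[OF eff fin(2) h(2)])
    fix i \<mu> assume i: "i \<in> I" and "\<mu> < l i"
    then have "real \<mu> < real (?B i) / real (h i)" unfolding l_def by linarith
    then have "real (h i) * real \<mu> < real (?B i)" using h(1)[OF i] by (simp add: field_simps)
    then show "h i * \<mu> < ?B i" by (metis of_nat_less_iff of_nat_mult)
  qed auto
  then have le: "(\<Sum>i\<in>I. m i * real (l i)) \<le> d * real e" using nef unfolding nef_on_def by blast
  have "(\<Sum>j\<in>J. (if g j \<in> I then m (g j) / real (h (g j)) else 0) * real (b j))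
     = (\<Sum>j\<in>{j\<in>J. g j \<in> I}. m (g j) / real (h (g j)) * real (b j))"
    using fin(2) by (intro sum.mono_neutral_cong_right) auto
  also have "\<dots> = (\<Sum>i\<in>I. \<Sum>j\<in>{j\<in>{j\<in>J. g j \<in> I}. g j = i}. m (g j) / real (h (g j)) * real (b j))"
    using fin by (intro sum.group[symmetric]) auto
  also have "\<dots> \<le> (\<Sum>i\<in>I. m i * real (l i))"
  proof (rule sum_mono)
    fix i assume i: "i \<in> I"
    have "(\<Sum>j\<in>{j\<in>{j\<in>J. g j \<in> I}. g j = i}. m (g j) / real (h (g j)) * real (b j))
       = (\<Sum>j\<in>{j\<in>J. g j = i}. m i / real (h i) * real (b j))"
      using i by (intro sum.cong) auto
    also have "\<dots> = m i * (real (?B i) / real (h i))"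
      by (simp add: sum_distrib_left sum_divide_distrib)
    also have "\<dots> \<le> m i * real (l i)"
      unfolding l_def by (intro mult_left_mono m i) linarith
    finally show "(\<Sum>j\<in>{j\<in>{j\<in>J. g j \<in> I}. g j = i}. m (g j) / real (h (g j)) * real (b j)) \<le> m i * real (l i)" .
  qed
  also note le
  finally show "(\<Sum>j\<in>J. (if g j \<in> I then m (g j) / real (h (g j)) else 0) * real (b j)) \<le> d * real e" .
qed

section \<open>Isotropic classes orthogonal to K on ten points\<close>

lemma nef_on_nine:
  assumes "finite I" "F \<subseteq> I" "card F = 9"
  shows "nef_on I 3 (\<lambda>i. if i \<in> F then 1 else 0)"
  unfolding nef_on_def
proof (intro allI impI)
  fix e b assume eff: "everywhere_effective I e b"
  have "(\<Sum>j\<in>F. b j) \<le> 3 * e"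
    by (rule everywhere_effective_square_bound[OF eff assms(2)]) (use assms finite_subset in auto)
  then have "real (\<Sum>j\<in>F. b j) \<le> 3 * real e" by linarith
  moreover have "(\<Sum>i\<in>I. (if i \<in> F then 1 else 0) * real (b i)) = (\<Sum>j\<in>F. real (b j))"
    using assms by (intro sum.mono_neutral_cong_right) auto
  ultimately show "(\<Sum>i\<in>I. (if i \<in> F then 1 else 0) * real (b i)) \<le> 3 * real e" by simp
qed

text \<open>Cauchy-Schwarz for the nine entries other than \<open>m i\<close> gives 10 m_i^2 \<le> 6
  d m_i. By the second bound three entries sum to at most 9d/5, so for positive \<open>d\<close> a
  Cremona transformation leaves the degree positive.\<close>

lemma isotropic_multiplicity_bounds:
  fixes m :: "nat \<Rightarrow> real"
  assumes "finite I" "card I = 10" "(\<Sum>i\<in>I. m i) = 3 * d" "(\<Sum>i\<in>I. m i ^ 2) = d ^ 2" "d \<ge> 0" "i \<in> I"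
  shows "0 \<le> m i" "5 * m i \<le> 3 * d"
proof -
  have "(\<Sum>l\<in>I - {i}. m l) ^ 2 \<le> (\<Sum>l\<in>I - {i}. m l ^ 2) * card (I - {i})"
    by (rule sum_squared_le_sum_of_squares)
  moreover have "(\<Sum>l\<in>I - {i}. m l) = 3 * d - m i" "(\<Sum>l\<in>I - {i}. m l ^ 2) = d ^ 2 - m i ^ 2"
    using assms by (simp_all add: sum_diff1)
  ultimately have "(3 * d - m i) ^ 2 \<le> (d ^ 2 - m i ^ 2) * 9" using assms by simp
  then have *: "10 * (m i * m i) \<le> 6 * (d * m i)" by (simp add: power2_eq_square algebra_simps)
  show "0 \<le> m i"
  proof (rule ccontr)
    assume "\<not> 0 \<le> m i"
    then have "m i * m i > 0" "d * m i \<le> 0" using assms(5) by (auto simp: mult_nonneg_nonpos mult_neg_neg)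
    with * show False by linarith
  qed
  then show "5 * m i \<le> 3 * d"
  proof (cases "m i = 0")
    case False
    with \<open>0 \<le> m i\<close> have "m i > 0" by simp
    moreover have "m i * (10 * m i) \<le> m i * (6 * d)" using * by (simp add: algebra_simps)
    ultimately show ?thesis by simp
  qed (use assms(5) in simp)
qed

lemma ex_maximal:
  fixes m :: "'a \<Rightarrow> 'b :: linorder"
  assumes "finite A" "A \<noteq> {}" obtains i where "i \<in> A" "\<And>l. l \<in> A \<Longrightarrow> m l \<le> m i"
proof -
  have "Max (m ` A) \<in> m ` A" using assms by simp
  then obtain i where "i \<in> A" "Max (m ` A) = m i" by auto
  with assms that show ?thesis by (metis Max_ge finite_imageI imageI)
qed

text \<open>With a \<ge> b \<ge> c the three largest entries, the identity \<open>T'\<close> writes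
  0 as a sum of three terms that are nonnegative for a reduced class, so each of them vanishes. This
  forces a = b = c = d/3 and leaves only 0 and c for the other entries; the sum 3d then counts nine
  entries equal to c.\<close>

lemma reduced_isotropic:
  fixes m :: "nat \<Rightarrow> real"
  assumes I: "finite I" "card I \<ge> 3" and d: "d > 0"
    and m: "\<And>i. i \<in> I \<Longrightarrow> m i \<ge> 0" "(\<Sum>i\<in>I. m i) = 3 * d" "(\<Sum>i\<in>I. m i ^ 2) = d ^ 2"
    and red: "\<And>i j k. i \<in> I \<Longrightarrow> j \<in> I \<Longrightarrow> k \<in> I \<Longrightarrow> i \<noteq> j \<Longrightarrow> i \<noteq> k \<Longrightarrow> j \<noteq> k \<Longrightarrow> m i + m j + m k \<le> d"
  obtains F where "F \<subseteq> I" "card F = 9" "\<And>i. i \<in> I \<Longrightarrow> m i = (if i \<in> F then d / 3 else 0)"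
proof -
  have "I \<noteq> {}" using I by auto
  then obtain i where i: "i \<in> I" "\<And>l. l \<in> I \<Longrightarrow> m l \<le> m i" using ex_maximal[OF I(1)] by metis
  have "card (I - {i}) \<ge> 2" using I i by simp
  then have "I - {i} \<noteq> {}" by (metis card.empty not_numeral_le_zero)
  then obtain j where j: "j \<in> I - {i}" "\<And>l. l \<in> I - {i} \<Longrightarrow> m l \<le> m j"
    using ex_maximal[of "I - {i}"] I(1) by (metis finite_Diff)
  have "card (I - {i} - {j}) \<ge> 1" using I i j by simp
  then have "I - {i} - {j} \<noteq> {}" by (metis card.empty not_one_le_zero)
  then obtain k where k: "k \<in> I - {i} - {j}" "\<And>l. l \<in> I - {i} - {j} \<Longrightarrow> m l \<le> m k"
    using ex_maximal[of "I - {i} - {j}"] I(1) by (metis finite_Diff)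
  have ijk: "i \<in> I" "j \<in> I" "k \<in> I" "i \<noteq> j" "i \<noteq> k" "j \<noteq> k" using i j k by auto
  define a b c where "a = m i" "b = m j" "c = m k"
  have ord: "a \<ge> b" "b \<ge> c" "c \<ge> 0" "a + b + c \<le> d"
    using i(2)[OF ijk(2)] j(2)[of k] m(1)[OF ijk(3)] red[OF ijk] ijk by (auto simp: a_b_c_def)
  let ?R = "I - {i,j,k}"
  have le_c: "m l \<le> c" if "l \<in> ?R" for l using k(2)[of l] that by (auto simp: a_b_c_def)
  have s1: "(\<Sum>l\<in>?R. m l) = 3 * d - a - b - c" using sum_split3[OF I(1) ijk, of m] m(2) by (simp add: a_b_c_def)
  have s2: "(\<Sum>l\<in>?R. m l ^ 2) = d ^ 2 - a ^ 2 - b ^ 2 - c ^ 2"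
    using sum_split3[OF I(1) ijk, of "\<lambda>l. m l ^ 2"] m(3) by (simp add: a_b_c_def)
  have nn: "0 \<le> m l * (c - m l)" if "l \<in> ?R" for l using le_c[OF that] m(1)[of l] that by simp
  have T: "(\<Sum>l\<in>?R. m l * (c - m l)) = c * (3 * d - a - b - c) - (d ^ 2 - a ^ 2 - b ^ 2 - c ^ 2)"
    unfolding s1[symmetric] s2[symmetric] sum_distrib_left sum_subtractf[symmetric]
    by (intro sum.cong) (auto simp: power2_eq_square algebra_simps)
  have T': "(\<Sum>l\<in>?R. m l * (c - m l)) + (d - (a + b + c)) * (d + (a + b + c) - 3 * c) + 2 * (a * b - c * c) = 0"
    unfolding T by (simp add: power2_eq_square algebra_simps)
  have p1: "(\<Sum>l\<in>?R. m l * (c - m l)) \<ge> 0" by (intro sum_nonneg nn)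
  have p2: "(d - (a + b + c)) * (d + (a + b + c) - 3 * c) \<ge> 0" using ord by (intro mult_nonneg_nonneg) auto
  have p3: "a * b - c * c \<ge> 0" using ord by (simp add: mult_mono)
  have "A = 0 \<and> B = 0 \<and> C = 0" if "A + B + 2 * C = 0" "A \<ge> 0" "B \<ge> 0" "C \<ge> 0" for A B C :: real
    using that by auto
  from this[OF T' p1 p2 p3] have z1: "(\<Sum>l\<in>?R. m l * (c - m l)) = 0"
    and z2: "(d - (a + b + c)) * (d + (a + b + c) - 3 * c) = 0" and z3: "a * b = c * c"
    by auto
  have "c > 0"
  proof (rule ccontr)
    assume "\<not> c > 0"
    with ord have c0: "c = 0" by simp
    with z3 ord have b0: "b = 0" by (metis antisym mult_eq_0_iff)
    have "m l = 0" if "l \<in> ?R" for l using le_c[OF that] m(1)[of l] that c0 by (metis DiffD1 antisym)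
    then have "3 * d = a + b + c" using s1 by simp
    with ord d show False by linarith
  qed
  have bc: "b = c"
  proof (rule ccontr)
    assume "b \<noteq> c"
    with ord have "c < b" "c < a" by auto
    with \<open>c > 0\<close> have "c * c < a * b" by (intro mult_strict_mono) auto
    with z3 show False by simp
  qed
  with z3 \<open>c > 0\<close> have ac: "a = c" by simp
  have dc: "d = 3 * c" using z2 ac bc \<open>c > 0\<close> ord by (auto simp: mult_eq_0_iff)
  have "m l = 0 \<or> m l = c" if "l \<in> ?R" for l
  proof -
    have "\<forall>l\<in>?R. m l * (c - m l) = 0"
      using z1 nn I(1) by (subst (asm) sum_nonneg_eq_0_iff) auto
    with that show ?thesis by auto
  qed
  then have dich: "m l = 0 \<or> m l = c" if "l \<in> I" for l
    using that ac bc by (cases "l \<in> {i,j,k}") (auto simp: a_b_c_def)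
  let ?F = "{l \<in> I. m l = c}"
  have "(\<Sum>l\<in>I. m l) = (\<Sum>l\<in>?F. c)"
    using I(1) dich by (intro sum.mono_neutral_cong_right) auto
  with m(2) have "real (card ?F) * c = 9 * c" by (simp add: dc)
  with \<open>c > 0\<close> have "card ?F = 9" by simp
  show ?thesis
  proof (rule that[of ?F])
    show "m l = (if l \<in> ?F then d / 3 else 0)" if "l \<in> I" for l
      using dich[OF that] that dc by auto
  qed (use \<open>card ?F = 9\<close> in auto)
qed

text \<open>Descent on the degree, which is integral. A triple of multiplicities with sum above
  \<open>d\<close> permits a transformation to smaller degree within the same kind of classes, and
  nefness is carried back because the transformation is an involution. Without such a triple the
  class is reduced.\<close>

lemma nef_on_integral_isotropic:
  fixes d :: nat and m :: "nat \<Rightarrow> int"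
  assumes I: "finite I" "card I = 10"
    and d: "d > 0" and m: "(\<Sum>i\<in>I. m i) = 3 * int d" "(\<Sum>i\<in>I. m i ^ 2) = int d ^ 2"
  shows "nef_on I (real d) (\<lambda>i. real_of_int (m i))"
  using d m
proof (induction d arbitrary: m rule: less_induct)
  case (less d m)
  have "real_of_int (\<Sum>i\<in>I. m i) = real_of_int (3 * int d)" using less.prems(2) by simp
  then have S: "(\<Sum>i\<in>I. real_of_int (m i)) = 3 * real d" by simp
  have "real_of_int (\<Sum>i\<in>I. m i ^ 2) = real_of_int (int d ^ 2)" using less.prems(3) by simp
  then have Q: "(\<Sum>i\<in>I. real_of_int (m i) ^ 2) = real d ^ 2" by simp
  note bd = isotropic_multiplicity_bounds[OF I S Q, simplified]
  show ?case
  proof (cases "\<exists>i\<in>I. \<exists>j\<in>I. \<exists>k\<in>I. i \<noteq> j \<and> i \<noteq> k \<and> j \<noteq> k \<and> m i + m j + m k > int d")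
    case True
    then obtain i j k where ijk: "i \<in> I" "j \<in> I" "k \<in> I" "i \<noteq> j" "i \<noteq> k" "j \<noteq> k" and gt: "m i + m j + m k > int d"
      by blast
    define d' where "d' = nat (2 * int d - m i - m j - m k)"
    define m' where "m' = m(i := int d - m j - m k, j := int d - m i - m k, k := int d - m i - m j)"
    \<comment> \<open>This keeps the new degree 2d - m_i - m_j - m_k positive.\<close>
    have "5 * real_of_int (m i + m j + m k) \<le> 9 * real d"
      using bd(2)[OF ijk(1)] bd(2)[OF ijk(2)] bd(2)[OF ijk(3)] by simp
    then have "5 * (m i + m j + m k) \<le> 9 * int d" by linarith
    then have d': "int d' = 2 * int d - m i - m j - m k" "d' > 0" "d' < d"
      using gt less.prems(1) by (auto simp: d'_def)
    have vals: "m' i = int d - m j - m k" "m' j = int d - m i - m k" "m' k = int d - m i - m j"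
      "\<And>l. l \<in> I - {i,j,k} \<Longrightarrow> m' l = m l"
      using ijk by (auto simp: m'_def)
    have s1: "(\<Sum>l\<in>I. m' l) = 3 * int d'"
      using sum_split3[OF I(1) ijk, of m] sum_split3[OF I(1) ijk, of m'] less.prems(2)
      by (simp add: vals d')
    have s2: "(\<Sum>l\<in>I. m' l ^ 2) = int d' ^ 2"
    proof -
      have R: "(\<Sum>l\<in>I - {i,j,k}. m' l ^ 2) = (\<Sum>l\<in>I - {i,j,k}. m l ^ 2)" by (simp add: vals)
      show ?thesis
        using sum_split3[OF I(1) ijk, of "\<lambda>l. m l ^ 2"] sum_split3[OF I(1) ijk, of "\<lambda>l. m' l ^ 2"] less.prems(3)
        unfolding R vals d' by (simp add: power2_eq_square algebra_simps)
    qed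
    have nef: "nef_on I (real d') (\<lambda>i. real_of_int (m' i))"
      using less.IH[OF d'(3) d'(2) s1 s2] .
    have "real_of_int (\<Sum>i\<in>I. m' i) = real_of_int (3 * int d')" using s1 by simp
    then have S': "(\<Sum>i\<in>I. real_of_int (m' i)) = 3 * real d'" by simp
    have "real_of_int (\<Sum>i\<in>I. m' i ^ 2) = real_of_int (int d' ^ 2)" using s2 by simp
    then have Q': "(\<Sum>i\<in>I. real_of_int (m' i) ^ 2) = real d' ^ 2" by simp
    \<comment> \<open>The new class is isotropic and orthogonal to K as well, so its multiplicities
      are nonnegative, as \<open>nef_on_cremona\<close> requires for the way back.\<close>
    have nonneg: "real_of_int (m' l) \<ge> 0" if "l \<in> I" for l
      using isotropic_multiplicity_bounds(1)[OF I S' Q' _ that] by simp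
    have rd: "real d' = 2 * real d - real_of_int (m i) - real_of_int (m j) - real_of_int (m k)"
      using d'(1) by linarith
    have N: "nef_on I (2 * real d' - real_of_int (m' i) - real_of_int (m' j) - real_of_int (m' k))
      ((\<lambda>l. real_of_int (m' l))(i := real d' - real_of_int (m' j) - real_of_int (m' k),
         j := real d' - real_of_int (m' i) - real_of_int (m' k), k := real d' - real_of_int (m' i) - real_of_int (m' j)))"
      by (rule nef_on_cremona[OF nef I(1) ijk]) (use nonneg ijk in auto)
    have eq: "2 * real d' - real_of_int (m' i) - real_of_int (m' j) - real_of_int (m' k) = real d"
      by (simp add: vals rd)
    show ?thesis
    proof (rule nef_on_cong[OF N[unfolded eq]])
      fix l assume "l \<in> I"
      then show "((\<lambda>l. real_of_int (m' l))(i := real d' - real_of_int (m' j) - real_of_int (m' k),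
         j := real d' - real_of_int (m' i) - real_of_int (m' k), k := real d' - real_of_int (m' i) - real_of_int (m' j))) l
         = real_of_int (m l)"
        using ijk vals(4)[of l] by (auto simp: vals(1-3) rd)
    qed
  next
    case False
    have "\<exists>F. F \<subseteq> I \<and> card F = 9 \<and> (\<forall>i\<in>I. real_of_int (m i) = (if i \<in> F then real d / 3 else 0))"
    proof (rule reduced_isotropic[OF I(1) _ _ _ S Q])
      fix i j k assume "i \<in> I" "j \<in> I" "k \<in> I" "i \<noteq> j" "i \<noteq> k" "j \<noteq> k"
      with False have "m i + m j + m k \<le> int d" by (meson not_less)
      then show "real_of_int (m i) + real_of_int (m j) + real_of_int (m k) \<le> real d" by linarith
    qed (use I less.prems bd in auto)
    then obtain F where F: "F \<subseteq> I" "card F = 9" "\<And>i. i \<in> I \<Longrightarrow> real_of_int (m i) = (if i \<in> F then real d / 3 else 0)"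
      by blast
    have "nef_on I (real d / 3 * 3) (\<lambda>i. real d / 3 * (if i \<in> F then 1 else 0))"
      by (intro nef_on_scale nef_on_nine I F) auto
    then have "nef_on I (real d) (\<lambda>i. real d / 3 * (if i \<in> F then 1 else 0))" by simp
    then show ?thesis by (rule nef_on_cong) (use F in auto)
  qed
qed

text \<open>With \<open>u\<close> the isotropic vector \<open>3H - \<Sum>\<^sub>i\<^sub>\<noteq>\<^sub>z E\<^sub>i\<close>, the map \<open>y \<mapsto> 2(y\<cdot>u)y - (y\<cdot>y)u\<close> sends integral
  vectors orthogonal to \<open>K\<close> to isotropic ones; here \<open>y\<cdot>u = y\<^sub>z\<close>. Applied to roundings of \<open>N v\<close> for isotropic
  \<open>v\<close>, it yields integral isotropic vectors whose directions converge to that of \<open>v\<close>.\<close>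

lemma nef_on_isotropic:
  fixes d :: real and m :: "nat \<Rightarrow> real"
  assumes I: "finite I" "card I = 10"
    and d: "d > 0" and m: "(\<Sum>i\<in>I. m i) = 3 * d" "(\<Sum>i\<in>I. m i ^ 2) = d ^ 2"
  shows "nef_on I d m"
proof -
  have nonneg: "m i \<ge> 0" if "i \<in> I" for i
    using isotropic_multiplicity_bounds(1)[OF I m _ that] d by simp
  \<comment> \<open>The approximating vectors, divided by N^2, converge to 18 m_z times the given
    one, so \<open>m z\<close> has to be nonzero, and positive to keep the degrees positive.\<close>
  obtain z where z: "z \<in> I" "m z > 0"
  proof -
    have "\<not> (\<forall>i\<in>I. m i \<le> 0)" using sum_nonpos[of I m] m(1) d by auto
    then show ?thesis using that by auto
  qed
  define k where "k n i = \<lfloor>real (Suc n) * m i\<rfloor>" for n i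
  \<comment> \<open>The factor 3 makes the sum of the entries divisible by 3, so that the vector of
    degree \<open>Y n\<close> with entries \<open>y n\<close> is integral and orthogonal to K. Its
    self-intersection is \<open>q n\<close>.\<close>
  define y where "y n i = 3 * k n i" for n i
  define Y where "Y n = (\<Sum>i\<in>I. k n i)" for n
  define q where "q n = Y n ^ 2 - (\<Sum>i\<in>I. y n i ^ 2)" for n
  define D where "D n = 2 * y n z * Y n - 3 * q n" for n
  define M where "M n i = 2 * y n z * y n i - (if i = z then 0 else q n)" for n i
  have sy: "(\<Sum>i\<in>I. y n i) = 3 * Y n" for n by (simp add: y_def Y_def sum_distrib_left)
  have card: "card (I - {z}) = 9" using I z by simp
  have sM: "(\<Sum>i\<in>I. M n i) = 3 * D n" for n
  proof -
    have "(\<Sum>i\<in>I. M n i) = 2 * y n z * (3 * Y n) - (\<Sum>i\<in>I. if i = z then 0 else q n)"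
      by (simp add: M_def sum_subtractf sum_distrib_left[symmetric] sy)
    also have "(\<Sum>i\<in>I. if i = z then 0 else q n) = (\<Sum>i\<in>I - {z}. q n)"
      using I by (intro sum.mono_neutral_cong_right) auto
    finally show ?thesis by (simp add: card D_def)
  qed
  have sM2: "(\<Sum>i\<in>I. M n i ^ 2) = D n ^ 2" for n
  proof -
    have "(\<Sum>i\<in>I. M n i ^ 2) = M n z ^ 2 + (\<Sum>i\<in>I - {z}. M n i ^ 2)"
      using I z by (intro sum.remove) auto
    also have "(\<Sum>i\<in>I - {z}. M n i ^ 2) = (\<Sum>i\<in>I - {z}. 4 * y n z ^ 2 * y n i ^ 2 - 4 * y n z * q n * y n i + q n ^ 2)"
      by (intro sum.cong refl) (auto simp: M_def power2_eq_square algebra_simps)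
    also have "\<dots> = 4 * y n z ^ 2 * (\<Sum>i\<in>I - {z}. y n i ^ 2) - 4 * y n z * q n * (\<Sum>i\<in>I - {z}. y n i) + 9 * q n ^ 2"
      by (simp add: sum.distrib sum_subtractf sum_distrib_left card)
    also have "(\<Sum>i\<in>I - {z}. y n i ^ 2) = Y n ^ 2 - q n - y n z ^ 2"
      using I z by (simp add: sum_diff1 q_def)
    also have "(\<Sum>i\<in>I - {z}. y n i) = 3 * Y n - y n z"
      using I z by (simp add: sum_diff1 sy)
    finally show ?thesis by (simp add: M_def D_def power2_eq_square algebra_simps)
  qed
  have lk: "(\<lambda>n. real_of_int (k n i) / real (Suc n)) \<longlonglongrightarrow> m i" for i
  proof (rule Lim_transform2)
    show "(\<lambda>n. m i) \<longlonglongrightarrow> m i" by simp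
    show "(\<lambda>n. m i - real_of_int (k n i) / real (Suc n)) \<longlonglongrightarrow> 0"
    proof (rule Lim_null_comparison[OF _ LIMSEQ_inverse_real_of_nat], intro always_eventually allI)
      fix n
      have "m i - real_of_int (k n i) / real (Suc n) = (real (Suc n) * m i - real_of_int (k n i)) * inverse (real (Suc n))"
        by (simp add: field_simps)
      moreover have "\<bar>real (Suc n) * m i - real_of_int (k n i)\<bar> \<le> 1" unfolding k_def by linarith
      then have "\<bar>real (Suc n) * m i - real_of_int (k n i)\<bar> * inverse (real (Suc n)) \<le> 1 * inverse (real (Suc n))"
        by (intro mult_right_mono) auto
      ultimately show "norm (m i - real_of_int (k n i) / real (Suc n)) \<le> inverse (real (Suc n))"
        by (simp add: abs_mult)
    qed
  qed
  let ?N = "\<lambda>n. real (Suc n)"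
  have ly: "(\<lambda>n. real_of_int (y n i) / ?N n) \<longlonglongrightarrow> 3 * m i" for i
    using tendsto_mult[OF tendsto_const[of 3] lk[of i]] by (simp add: y_def)
  have lY: "(\<lambda>n. real_of_int (Y n) / ?N n) \<longlonglongrightarrow> 3 * d"
  proof -
    have "(\<lambda>n. \<Sum>i\<in>I. real_of_int (k n i) / ?N n) \<longlonglongrightarrow> (\<Sum>i\<in>I. m i)" by (intro tendsto_sum lk)
    then show ?thesis by (simp add: Y_def m sum_divide_distrib)
  qed
  have lq: "(\<lambda>n. real_of_int (q n) / ?N n ^ 2) \<longlonglongrightarrow> 0"
  proof -
    have "(\<lambda>n. (real_of_int (Y n) / ?N n) ^ 2 - (\<Sum>i\<in>I. (real_of_int (y n i) / ?N n) ^ 2))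
        \<longlonglongrightarrow> (3 * d) ^ 2 - (\<Sum>i\<in>I. (3 * m i) ^ 2)"
      by (intro tendsto_intros ly lY)
    moreover have "(3 * d) ^ 2 - (\<Sum>i\<in>I. (3 * m i) ^ 2) = 0"
      by (simp add: power_mult_distrib sum_distrib_left[symmetric] m)
    moreover have "(real_of_int (Y n) / ?N n) ^ 2 - (\<Sum>i\<in>I. (real_of_int (y n i) / ?N n) ^ 2)
        = real_of_int (q n) / ?N n ^ 2" for n
      by (simp only: q_def power_divide sum_divide_distrib[symmetric] diff_divide_distrib[symmetric] of_int_diff of_int_power of_int_sum)
    ultimately show ?thesis by simp
  qed
  have lD: "(\<lambda>n. real_of_int (D n) / ?N n ^ 2) \<longlonglongrightarrow> 2 * (3 * m z) * (3 * d) - 3 * 0"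
  proof -
    have "(\<lambda>n. 2 * (real_of_int (y n z) / ?N n) * (real_of_int (Y n) / ?N n) - 3 * (real_of_int (q n) / ?N n ^ 2))
       \<longlonglongrightarrow> 2 * (3 * m z) * (3 * d) - 3 * 0" by (intro tendsto_intros ly lY lq)
    moreover have "2 * (real_of_int (y n z) / ?N n) * (real_of_int (Y n) / ?N n) - 3 * (real_of_int (q n) / ?N n ^ 2)
       = real_of_int (D n) / ?N n ^ 2" for n
      by (simp add: D_def power2_eq_square diff_divide_distrib del: of_nat_Suc)
    ultimately show ?thesis by simp
  qed
  have lM: "(\<lambda>n. real_of_int (M n i) / ?N n ^ 2) \<longlonglongrightarrow> 2 * (3 * m z) * (3 * m i) - (if i = z then 0 else 1) * 0" for i
  proof -
    have "(\<lambda>n. 2 * (real_of_int (y n z) / ?N n) * (real_of_int (y n i) / ?N n) - (if i = z then 0 else 1) * (real_of_int (q n) / ?N n ^ 2))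
       \<longlonglongrightarrow> 2 * (3 * m z) * (3 * m i) - (if i = z then 0 else 1) * 0" by (intro tendsto_intros ly lq)
    moreover have "2 * (real_of_int (y n z) / ?N n) * (real_of_int (y n i) / ?N n) - (if i = z then 0 else 1) * (real_of_int (q n) / ?N n ^ 2)
       = real_of_int (M n i) / ?N n ^ 2" for n
      by (simp add: M_def power2_eq_square diff_divide_distrib del: of_nat_Suc)
    ultimately show ?thesis by simp
  qed
  have "\<forall>\<^sub>F n in sequentially. real_of_int (D n) / ?N n ^ 2 > 0"
    by (rule order_tendstoD(1)[OF lD]) (use z d in simp)
  then have "\<forall>\<^sub>F n in sequentially. nef_on I (real_of_int (D n) / ?N n ^ 2) (\<lambda>i. real_of_int (M n i) / ?N n ^ 2)"
  proof eventually_elim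
    case (elim n)
    then have "D n > 0" by (simp add: zero_less_divide_iff del: of_nat_Suc)
    then have "nef_on I (real (nat (D n))) (\<lambda>i. real_of_int (M n i))"
      by (intro nef_on_integral_isotropic I) (auto simp: sM sM2)
    from nef_on_scale[OF this, of "1 / ?N n ^ 2"] \<open>D n > 0\<close> show ?case by simp
  qed
  from nef_on_limit[OF this lD lM] have "nef_on I (18 * m z * d) (\<lambda>i. 18 * m z * m i)"
    by (simp add: mult.assoc)
  from nef_on_scale[OF this, of "1 / (18 * m z)"] z(2) show ?thesis by simp
qed

section \<open>Wonderful rays\<close>

lemma sqrt_nonsquare_irrational:
  fixes n :: nat
  assumes "\<And>m. m ^ 2 \<noteq> n" shows "sqrt (real n) \<notin> \<rat>"
proof
  assume "sqrt (real n) \<in> \<rat>"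
  then obtain a b :: nat where ab: "b \<noteq> 0" "\<bar>sqrt (real n)\<bar> = real a / real b" "coprime a b"
    by (rule Rats_abs_nat_div_natE)
  then have "real n = (real a / real b) ^ 2" by (metis power2_abs real_sqrt_pow2 of_nat_0_le_iff)
  then have "real (a ^ 2) = real (n * b ^ 2)" using ab(1) by (simp add: field_simps)
  then have eq: "a ^ 2 = n * b ^ 2" by (rule of_nat_eq_iff[THEN iffD1])
  then have "b ^ 2 dvd a ^ 2" by simp
  then have "b dvd a" by simp
  with ab(3) have "b = 1" by (metis coprime_common_divisor dvd_refl nat_dvd_1_iff_1)
  with eq assms[of a] show False by simp
qed

lemma sqrt_irrational_between:
  fixes n :: nat
  assumes "a ^ 2 < n" "n < (Suc a) ^ 2" shows "sqrt (real n) \<notin> \<rat>"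
proof (rule sqrt_nonsquare_irrational)
  fix m
  have "a < m" if "a ^ 2 < m ^ 2" using that by (rule power_less_imp_less_base) simp
  moreover have "m < Suc a" if "m ^ 2 < (Suc a) ^ 2" using that by (rule power_less_imp_less_base) simp
  ultimately show "m ^ 2 \<noteq> n" using assms by auto
qed

definition ray_vec :: "nat \<Rightarrow> real \<Rightarrow> (nat \<Rightarrow> real) \<Rightarrow> nat \<Rightarrow> real" where
  "ray_vec s d m i = (if i = 0 then d else if i \<le> s then - m i else 0)"

definition ray :: "nat \<Rightarrow> real \<Rightarrow> (nat \<Rightarrow> real) \<Rightarrow> (nat \<Rightarrow> real) set" where
  "ray s d m = {(\<lambda>i. t * ray_vec s d m i) | t. t \<ge> 0}"

lemma inter_scale: "inter s (\<lambda>i. t * v i) w = t * inter s v w"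
  by (simp add: inter_def sum_distrib_left algebra_simps)

lemma inter_scale_right: "inter s v (\<lambda>i. t * w i) = t * inter s v w"
  by (simp add: inter_def sum_distrib_left algebra_simps)

lemma inter_ray_vec: "inter s (ray_vec s d m) w = d * w 0 + (\<Sum>i=1..s. m i * w i)"
  by (simp add: inter_def ray_vec_def sum_negf)

text \<open>An effective class may have negative multiplicities, which \<open>nat\<close> replaces
  by 0; since \<open>m i\<close> is nonnegative, this only strengthens the inequality given by
  \<open>nef_on\<close>. An integral vector on the ray would make the ratio \<open>m j / d\<close>
  of two coordinates rational.\<close>

lemma wonderful_ray_ray:
  assumes d: "d > 0" and nef: "nef_on {1..s} d m" and m: "\<And>i. i \<in> {1..s} \<Longrightarrow> m i \<ge> 0"
    and sq: "(\<Sum>i=1..s. m i ^ 2) = d ^ 2" and irr: "j \<in> {1..s}" "m j / d \<notin> \<rat>"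
  shows "wonderful_ray s (ray s d m)"
  unfolding wonderful_ray_def
proof (intro conjI)
  have "ray_vec s d m 0 = d" by (simp add: ray_vec_def)
  with d have "ray_vec s d m \<noteq> (\<lambda>_. 0)" by (metis less_irrefl)
  moreover have "in_N s (ray_vec s d m)" by (simp add: in_N_def ray_vec_def)
  ultimately show "is_ray s (ray s d m)" unfolding is_ray_def ray_def by blast
  show "nef_ray s (ray s d m)"
    unfolding nef_ray_def
  proof (intro ballI allI impI)
    fix x D assume "x \<in> ray s d m" and D: "effective_class s D"
    then obtain t where t: "t \<ge> 0" "x = (\<lambda>i. t * ray_vec s d m i)" unfolding ray_def by blast
    have iD: "D i \<in> \<int>" for i using D by (simp add: effective_class_def integral_vec_def)
    have D0: "real (nat \<lfloor>D 0\<rfloor>) = D 0"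
      using iD[of 0] D by (auto simp: effective_class_def elim!: Ints_cases)
    have Di: "- D i \<le> real (nat \<lfloor>- D i\<rfloor>)" for i
      using iD[of i] by (auto elim!: Ints_cases)
    have "(\<Sum>i=1..s. m i * real (nat \<lfloor>- D i\<rfloor>)) \<le> d * real (nat \<lfloor>D 0\<rfloor>)"
      using nef effective_class_imp_everywhere[OF D] unfolding nef_on_def by blast
    moreover have "(\<Sum>i=1..s. m i * (- D i)) \<le> (\<Sum>i=1..s. m i * real (nat \<lfloor>- D i\<rfloor>))"
      by (intro sum_mono mult_left_mono Di m)
    ultimately have "inter s (ray_vec s d m) D \<ge> 0" by (simp add: inter_ray_vec D0 sum_negf)
    then show "inter s x D \<ge> 0" unfolding t(2) inter_scale using t(1) by simp
  qed
  show "\<not> rational_ray s (ray s d m)"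
  proof
    assume "rational_ray s (ray s d m)"
    then obtain t where t: "t \<ge> 0" "(\<lambda>i. t * ray_vec s d m i) \<noteq> (\<lambda>_. 0)"
      and int: "\<And>i. t * ray_vec s d m i \<in> \<int>"
      unfolding rational_ray_def ray_def integral_vec_def by blast
    have "t \<noteq> 0" using t(2) by auto
    have "t * d \<in> \<rat>" "- (t * m j) \<in> \<rat>"
      using int[of 0] int[of j] irr(1) Ints_subset_Rats by (auto simp: ray_vec_def)
    then have "- (- (t * m j)) / (t * d) \<in> \<rat>" by (simp only: Rats_divide Rats_minus_iff)
    with \<open>t \<noteq> 0\<close> irr(2) show False by simp
  qed
  have "inter s (ray_vec s d m) (ray_vec s d m) = 0"
    unfolding inter_ray_vec using sq by (simp add: ray_vec_def sum_negf power2_eq_square)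
  then show "self_int_zero s (ray s d m)"
    unfolding self_int_zero_def ray_def by (auto simp: inter_scale inter_scale_right)
qed

lemma ray_dot:
  assumes "x \<in> ray s d m" "x \<noteq> (\<lambda>_. 0)"
  obtains t where "t > 0" "\<And>w. inter s x w = t * inter s (ray_vec s d m) w"
proof -
  from assms(1) obtain t where t: "t \<ge> 0" "x = (\<lambda>i. t * ray_vec s d m i)" unfolding ray_def by blast
  with assms(2) have "t \<noteq> 0" by auto
  with t show ?thesis by (intro that[of t]) (auto simp: inter_scale)
qed

lemma ray_dot_canonical:
  assumes "(\<Sum>i=1..s. m i) > 3 * d" shows "ray_dot_pos s (ray s d m) (canonical s)"
proof -
  have "inter s (ray_vec s d m) (canonical s) = (\<Sum>i=1..s. m i) - 3 * d"
    unfolding inter_ray_vec by (simp add: canonical_def)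
  with assms show ?thesis unfolding ray_dot_pos_def by (auto elim!: ray_dot)
qed

lemma ray_defernex_negative:
  assumes "(\<Sum>i=1..s. m i) > sqrt (real s - 1) * d" shows "defernex_negative s (ray s d m)"
proof -
  have "inter s (ray_vec s d m) (defernex s) = sqrt (real s - 1) * d - (\<Sum>i=1..s. m i)"
    unfolding inter_ray_vec by (simp add: defernex_def sum_negf)
  with assms show ?thesis
    unfolding defernex_negative_def ray_dot_neg_def by (auto elim!: ray_dot simp: mult_pos_neg)
qed

section \<open>Splitting points and explicit rays\<close>

lemma ex_fibers:
  assumes "finite I" "finite J" "card J = (\<Sum>i\<in>I. n i)"
  obtains g :: "nat \<Rightarrow> nat" where "\<And>j. j \<in> J \<Longrightarrow> g j \<in> I" "\<And>i. i \<in> I \<Longrightarrow> card {j \<in> J. g j = i} = n i"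
proof -
  have "card J = card (SIGMA i:I. {..<n i})" using assms by (simp add: card_SigmaI)
  then obtain f where f: "bij_betw f J (SIGMA i:I. {..<n i})"
    using finite_same_card_bij[OF assms(2), of "SIGMA i:I. {..<n i}"] assms(1) by auto
  show ?thesis
  proof (rule that[of "\<lambda>j. fst (f j)"])
    show "fst (f j) \<in> I" if "j \<in> J" for j using bij_betw_apply[OF f that] by auto
    fix i assume i: "i \<in> I"
    have "bij_betw f {j \<in> J. fst (f j) = i} ({i} \<times> {..<n i})"
      using f i unfolding bij_betw_def
      by (auto simp: inj_on_def image_iff) (metis (no_types, lifting) SigmaE SigmaI fst_conv image_iff lessThan_iff mem_Sigma_iff)+
    then show "card {j \<in> J. fst (f j) = i} = n i"
      by (simp add: bij_betw_same_card card_cartesian_product)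
  qed
qed

text \<open>The h_i^2 points of multiplicity m_i / h_i that replace the point \<open>i\<close>
  contribute m_i^2 to the sum of squares, as before, but m_i h_i to the sum. Points left over among
  the \<open>s\<close> get multiplicity 0.\<close>

lemma wonderful_ray_collision:
  assumes nef: "nef_on I d m" and I: "finite I" and m: "\<And>i. i \<in> I \<Longrightarrow> m i \<ge> 0"
    and h: "\<And>i. i \<in> I \<Longrightarrow> h i > 0" "(\<Sum>i\<in>I. h i ^ 2) \<le> s"
    and d: "d > 0" and sq: "(\<Sum>i\<in>I. m i ^ 2) = d ^ 2" and irr: "k \<in> I" "m k / d \<notin> \<rat>"
  obtains M where "wonderful_ray s (ray s d M)" "(\<Sum>j=1..s. M j) = (\<Sum>i\<in>I. m i * real (h i))"
proof -
  define J where "J = {1..\<Sum>i\<in>I. h i ^ 2}"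
  have J: "finite J" "card J = (\<Sum>i\<in>I. h i ^ 2)" "J \<subseteq> {1..s}" using h(2) by (auto simp: J_def)
  obtain g :: "nat \<Rightarrow> nat" where g: "\<And>j. j \<in> J \<Longrightarrow> g j \<in> I" "\<And>i. i \<in> I \<Longrightarrow> card {j \<in> J. g j = i} = h i ^ 2"
    using ex_fibers[OF I J(1,2)] by blast
  define M where "M j = (if j \<in> J then m (g j) / real (h (g j)) else 0)" for j
  have "nef_on J d (\<lambda>j. if g j \<in> I then m (g j) / real (h (g j)) else 0)"
    by (rule nef_on_collide[OF nef I J(1) m h(1) g(2)])
  then have "nef_on J d M" by (rule nef_on_cong) (simp add: M_def g)
  then have nefM: "nef_on {1..s} d M" by (rule nef_on_extend[OF _ J(3)]) (auto simp: M_def)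
  have fib: "(\<Sum>j=1..s. F (M j)) = (\<Sum>i\<in>I. real (h i ^ 2) * F (m i / real (h i)))" if "F 0 = 0" for F :: "real \<Rightarrow> real"
  proof -
    have "(\<Sum>j=1..s. F (M j)) = (\<Sum>j\<in>J. F (m (g j) / real (h (g j))))"
      using J(3) that by (intro sum.mono_neutral_cong_right) (auto simp: M_def)
    also have "\<dots> = (\<Sum>i\<in>I. \<Sum>j\<in>{j\<in>J. g j = i}. F (m (g j) / real (h (g j))))"
      using I J(1) g(1) by (intro sum.group[symmetric]) auto
    also have "\<dots> = (\<Sum>i\<in>I. \<Sum>j\<in>{j\<in>J. g j = i}. F (m i / real (h i)))"
      by (intro sum.cong) auto
    also have "\<dots> = (\<Sum>i\<in>I. real (h i ^ 2) * F (m i / real (h i)))"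
      by (intro sum.cong) (simp_all add: g(2))
    finally show ?thesis .
  qed
  have sumM: "(\<Sum>j=1..s. M j) = (\<Sum>i\<in>I. m i * real (h i))"
    using fib[of "\<lambda>x. x"] h(1) by (auto simp: power2_eq_square intro!: sum.cong)
  have sqM: "(\<Sum>j=1..s. M j ^ 2) = d ^ 2"
  proof -
    have "(\<Sum>j=1..s. M j ^ 2) = (\<Sum>i\<in>I. real (h i ^ 2) * (m i / real (h i)) ^ 2)"
      by (rule fib) simp
    also have "\<dots> = (\<Sum>i\<in>I. m i ^ 2)"
      by (intro sum.cong) (use h(1) in \<open>auto simp: power_divide\<close>)
    finally show ?thesis using sq by simp
  qed
  have hk: "h k > 0" by (rule h(1)[OF irr(1)])
  have "{j \<in> J. g j = k} \<noteq> {}"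
    using g(2)[OF irr(1)] hk by (metis card.empty less_irrefl zero_less_power)
  then obtain j where j: "j \<in> J" "g j = k" by blast
  have "M j / d \<notin> \<rat>"
  proof
    assume "M j / d \<in> \<rat>"
    then have "real (h k) * (M j / d) \<in> \<rat>" by (intro Rats_mult Rats_of_nat)
    with irr(2) hk j show False by (simp add: M_def)
  qed
  moreover have "M i \<ge> 0" if "i \<in> {1..s}" for i
    using m g(1) h(1) by (auto simp: M_def)
  moreover have "j \<in> {1..s}" using j J(3) by blast
  ultimately have "wonderful_ray s (ray s d M)" by (intro wonderful_ray_ray[OF d nefM _ sqM])
  then show ?thesis using sumM by (rule that)
qed

lemma sum_lessThan_10: "(\<Sum>i<10::nat. f i) = f 0 + f 1 + f 2 + f 3 + f 4 + f 5 + f 6 + f 7 + f 8 + f 9"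
  by (simp add: eval_nat_numeral)

lemma sum_lessThan_11: "(\<Sum>i<11::nat. f i) = f 0 + f 1 + f 2 + f 3 + f 4 + f 5 + f 6 + f 7 + f 8 + f 9 + f 10"
  by (simp add: eval_nat_numeral)

lemma isotropic_10_nef:
  fixes d :: real and m :: "nat \<Rightarrow> real"
  assumes "d > 0" "(\<Sum>i<10. m i) = 3 * d" "(\<Sum>i<10. m i ^ 2) = d ^ 2"
  shows "nef_on {..<10} d m" "\<And>i. i < 10 \<Longrightarrow> m i \<ge> 0"
  using nef_on_isotropic[of "{..<10}" d m] isotropic_multiplicity_bounds(1)[of "{..<10}" m d] assms by auto

text \<open>In degree 10 the isotropic vectors orthogonal to K lie at squared distance 10 from the
  vector with all entries 3. Here this distance is spread over two entries as plus and minus sqrt 5.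
  The condition \<open>h 0 = h 1\<close> cancels the square roots in the sum of the m_i h_i.\<close>

lemma wonderful_ray_sqrt5:
  fixes h :: "nat \<Rightarrow> nat"
  assumes "\<And>i. i < 10 \<Longrightarrow> h i > 0" "(\<Sum>i<10. h i ^ 2) \<le> s" "h 0 = h 1"
  obtains M where "wonderful_ray s (ray s 10 M)" "(\<Sum>j=1..s. M j) = 3 * real (\<Sum>i<10. h i)"
proof -
  define m where "m = (\<lambda>i::nat. if i = 0 then 3 + sqrt 5 else if i = 1 then 3 - sqrt 5 else 3)"
  have m: "(\<Sum>i<10. m i) = 3 * 10" "(\<Sum>i<10. m i ^ 2) = 10 ^ 2"
    by (simp_all add: sum_lessThan_10 m_def power2_eq_square algebra_simps)
  note nef = isotropic_10_nef[of 10, OF _ m]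
  have irr: "m 0 / 10 \<notin> \<rat>"
  proof
    assume "m 0 / 10 \<in> \<rat>"
    then have "m 0 / 10 * 10 - 3 \<in> \<rat>" by (intro Rats_diff Rats_mult) auto
    moreover have "m 0 / 10 * 10 - 3 = sqrt (real 5)" by (simp add: m_def add_divide_distrib)
    ultimately show False using sqrt_irrational_between[of 2 5] by simp
  qed
  have sum: "(\<Sum>i<10. m i * real (h i)) = 3 * real (\<Sum>i<10. h i)"
    using assms(3) by (simp add: sum_lessThan_10 m_def algebra_simps)
  obtain M where "wonderful_ray s (ray s 10 M)" "(\<Sum>j=1..s. M j) = (\<Sum>i<10. m i * real (h i))"
    by (rule wonderful_ray_collision[of "{..<10}" 10 m h s 0]) (use nef m irr assms in auto)
  then show ?thesis using that sum by metis
qed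

lemma wonderful_ray_exists:
  assumes "s \<ge> 10" shows "\<exists>R. wonderful_ray s R"
proof -
  obtain M where "wonderful_ray s (ray s 10 M)"
    by (rule wonderful_ray_sqrt5[of "\<lambda>_. 1" s]) (use assms in auto)
  then show ?thesis ..
qed

lemma wonderful_ray_canonical_positive_exists:
  assumes "s \<ge> 13" shows "\<exists>R. wonderful_ray s R \<and> ray_dot_pos s R (canonical s)"
proof -
  \<comment> \<open>This uses 9 + 4 = 13 points, and the sum of the multiplicities becomes 33, more
    than 3 times the degree 10.\<close>
  define h where "h = (\<lambda>i::nat. if i = 9 then 2 else 1 :: nat)"
  have h: "(\<Sum>i<10. h i ^ 2) \<le> s" "(\<Sum>i<10. h i) = 11"
    using assms by (simp_all add: sum_lessThan_10 h_def)
  obtain M where "wonderful_ray s (ray s 10 M)" "(\<Sum>j=1..s. M j) = 3 * real (\<Sum>i<10. h i)"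
    by (rule wonderful_ray_sqrt5[of h s]) (use h(1) in \<open>auto simp: h_def\<close>)
  then show ?thesis using ray_dot_canonical[of 10 M s] h(2) by auto
qed

text \<open>The isotropic vector of degree \<open>1\<close> orthogonal to \<open>K\<close> that maximizes \<open>\<Sum> m\<^sub>i h\<^sub>i\<close> is
  \<open>m\<^sub>i = 3/10 + \<lambda> (h\<^sub>i - S/10)\<close> with \<open>S = \<Sum> h\<^sub>i\<close>, \<open>\<lambda> = 1 / sqrt (10 s - S\<^sup>2)\<close>, the maximum being
  \<open>(3 S + sqrt (10 s - S\<^sup>2)) / 10\<close>. A slightly smaller irrational \<open>\<lambda>\<close> is compensated
  in the directions of two equal entries of \<open>h\<close>.\<close>

lemma defernex_negative_criterion:
  fixes h :: "nat \<Rightarrow> nat"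
  assumes h: "\<And>i. i < 10 \<Longrightarrow> h i > 0" "(\<Sum>i<10. h i ^ 2) = s" "(\<Sum>i<10. h i) = S"
    and ab: "h 8 = h 9" "10 * h 0 \<noteq> S"
    and q: "q = 10 * real s - real S ^ 2" "q > 0"
    and big: "10 * sqrt (real s - 1) < 3 * real S + sqrt q"
  shows "\<exists>R. wonderful_ray s R \<and> defernex_negative s R"
proof -
  \<comment> \<open>At slope \<open>l\<close> the sum of the m_i h_i is (3S + l q) / 10, which
    exceeds sqrt(s - 1) once \<open>l\<close> is above \<open>lo\<close>. By \<open>big\<close>
    there is room between \<open>lo\<close> and the maximal slope 1 / sqrt q, hence an irrational
    slope.\<close>
  define lo where "lo = max 0 ((10 * sqrt (real s - 1) - 3 * real S) / q)"
  have "1 / sqrt q = sqrt q / q" using q(2) by (simp add: real_div_sqrt field_simps)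
  moreover have "(10 * sqrt (real s - 1) - 3 * real S) / q < sqrt q / q"
    using big q(2) by (intro divide_strict_right_mono) auto
  ultimately have "lo < 1 / sqrt q" using q(2) by (simp add: lo_def)
  then have "uncountable ({lo<..<1 / sqrt q} - \<rat>)"
    by (intro uncountable_minus_countable countable_rat) (simp add: uncountable_open_interval)
  then have "{lo<..<1 / sqrt q} - \<rat> \<noteq> {}" by force
  then have "\<exists>l. l \<in> {lo<..<1 / sqrt q} - \<rat>" by blast
  then obtain l where l: "lo < l" "l < 1 / sqrt q" "l \<notin> \<rat>" by auto
  have "l > 0" using l(1) by (simp add: lo_def)
  have "(l * sqrt q) ^ 2 < 1 ^ 2"
    using l(2) \<open>l > 0\<close> q(2) by (intro power_strict_mono) (auto simp: field_simps)
  then have lq: "l ^ 2 * q < 1" using q(2) by (simp add: power_mult_distrib)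
  \<comment> \<open>The entries \<open>v\<close> have sum of squares 9/10 + l^2 q / 10. Moving
    entries 8 and 9 by plus and minus \<eta> adds 2 \<eta>^2, which restores the value 1.\<close>
  define \<eta> where "\<eta> = sqrt ((1 - l ^ 2 * q) / 20)"
  have \<eta>: "\<eta> ^ 2 = (1 - l ^ 2 * q) / 20" unfolding \<eta>_def using lq by simp
  define v where "v i = 3 / 10 + l * (real (h i) - real S / 10)" for i
  define m where "m i = v i + (if i = 8 then \<eta> else if i = 9 then - \<eta> else 0)" for i
  have rS: "(\<Sum>i<10. real (h i)) = real S" using h(3) by (metis of_nat_sum)
  have rs: "(\<Sum>i<10. real (h i) ^ 2) = real s" using h(2) by (metis (mono_tags, lifting) of_nat_power of_nat_sum sum.cong)
  have sv: "(\<Sum>i<10. v i) = 3"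
    by (simp add: v_def sum.distrib sum_subtractf sum_distrib_left[symmetric] rS)
  have svh: "(\<Sum>i<10. v i * real (h i)) = 3 / 10 * real S + l * q / 10"
  proof -
    have "(\<Sum>i<10. v i * real (h i)) = (\<Sum>i<10. (3 / 10 - l * real S / 10) * real (h i) + l * real (h i) ^ 2)"
      by (intro sum.cong) (auto simp: v_def power2_eq_square algebra_simps)
    also have "\<dots> = (3 / 10 - l * real S / 10) * real S + l * real s"
      by (simp add: sum.distrib sum_distrib_left[symmetric] rS rs)
    finally show ?thesis by (simp add: q power2_eq_square field_simps)
  qed
  have sv2: "(\<Sum>i<10. v i ^ 2) = 9 / 10 + l ^ 2 * q / 10"
  proof -
    have "(\<Sum>i<10. v i ^ 2) = (\<Sum>i<10. (3 / 10 - l * real S / 10) * v i + l * (v i * real (h i)))"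
      by (intro sum.cong) (auto simp: v_def power2_eq_square algebra_simps)
    also have "\<dots> = (3 / 10 - l * real S / 10) * 3 + l * (3 / 10 * real S + l * q / 10)"
      by (simp add: sum.distrib sum_distrib_left[symmetric] sv svh)
    finally show ?thesis by (simp add: power2_eq_square algebra_simps)
  qed
  have v89: "v 8 = v 9" using ab by (simp add: v_def)
  have "(\<Sum>i<10. m i) = (\<Sum>i<10. v i)" by (simp add: sum_lessThan_10 m_def)
  then have m1: "(\<Sum>i<10. m i) = 3 * 1" using sv by simp
  have "(\<Sum>i<10. m i ^ 2) = (\<Sum>i<10. v i ^ 2) + 2 * \<eta> ^ 2"
    by (simp add: sum_lessThan_10 m_def v89 power2_eq_square algebra_simps)
  then have m2: "(\<Sum>i<10. m i ^ 2) = 1 ^ 2" using sv2 \<eta> by (simp add: field_simps)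
  have mh: "(\<Sum>i<10. m i * real (h i)) = (\<Sum>i<10. v i * real (h i))"
    using ab by (simp add: sum_lessThan_10 m_def algebra_simps)
  note nef = isotropic_10_nef[OF zero_less_one m1 m2]
  have irr: "m 0 / 1 \<notin> \<rat>"
  proof
    assume "m 0 / 1 \<in> \<rat>"
    then have "(m 0 - 3 / 10) / (real (h 0) - real S / 10) \<in> \<rat>"
      by (intro Rats_divide Rats_diff) auto
    moreover have "real (h 0) - real S / 10 \<noteq> 0"
    proof
      assume "real (h 0) - real S / 10 = 0"
      then have "real (10 * h 0) = real S" by simp
      with ab(2) show False by (metis of_nat_eq_iff)
    qed
    ultimately show False using l(3) by (simp add: m_def v_def)
  qed
  obtain M where M: "wonderful_ray s (ray s 1 M)" "(\<Sum>j=1..s. M j) = (\<Sum>i<10. m i * real (h i))"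
    by (rule wonderful_ray_collision[of "{..<10}" 1 m h s 0]) (use nef m2 irr h in auto)
  have "(10 * sqrt (real s - 1) - 3 * real S) / q < l" using l(1) by (simp add: lo_def)
  then have "10 * sqrt (real s - 1) - 3 * real S < l * q" using q(2) by (simp add: field_simps)
  then have "sqrt (real s - 1) * 1 < (\<Sum>j=1..s. M j)"
    unfolding M(2) mh svh by simp
  with M(1) show ?thesis using ray_defernex_negative by blast
qed

text \<open>For S = 3k and s = k^2 + c one has q = k^2 + 10c, and the criterion reads 10 sqrt(k^2 +
  c - 1) < 9k + sqrt(k^2 + 10c). Squaring twice reduces it to |45c - 50| < 30k, that is 40 < 30k for
  c = 2 and 130 < 30k for c = 4; the latter holds from k = 5 on.\<close>

lemma defernex_negative_near_square:
  fixes h :: "nat \<Rightarrow> nat"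
  assumes "\<And>i. i < 10 \<Longrightarrow> h i > 0" "(\<Sum>i<10. h i) = 3 * k" "h 8 = h 9" "10 * h 0 > 3 * k"
    and s: "(\<Sum>i<10. h i ^ 2) = s" "(s = k ^ 2 + 2 \<and> k \<ge> 4) \<or> (s = k ^ 2 + 4 \<and> k \<ge> 5)"
  shows "\<exists>R. wonderful_ray s R \<and> defernex_negative s R"
proof -
  define c where "c = real s - real k ^ 2"
  have c: "c = 2 \<and> k \<ge> 4 \<or> c = 4 \<and> k \<ge> 5" using s(2) by (auto simp: c_def)
  define x where "x = sqrt (real k ^ 2 + 10 * c)"
  have x: "x \<ge> 0" "x ^ 2 = real k ^ 2 + 10 * c" using c by (auto simp: x_def)
  have "real k \<ge> 4" using c by auto
  have kk: "(real k)\<^sup>2 \<ge> 16" "c = 4 \<Longrightarrow> (real k)\<^sup>2 \<ge> 25"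
    using power_mono[of 4 "real k" 2] power_mono[of 5 "real k" 2] c by auto
  have "(9 * real k ^ 2 + 45 * c - 50) ^ 2 < (9 * real k * x) ^ 2"
    unfolding power_mult_distrib x(2) using c kk by (auto simp: power2_eq_square algebra_simps)
  then have "9 * real k ^ 2 + 45 * c - 50 < 9 * real k * x"
    by (rule power2_less_imp_less) (use x in simp)
  then have "(10 * sqrt (real s - 1)) ^ 2 < (9 * real k + x) ^ 2"
    using c unfolding power2_sum x(2) power_mult_distrib by (auto simp: c_def algebra_simps)
  then have "10 * sqrt (real s - 1) < 9 * real k + x" by (rule power2_less_imp_less) (use x in simp)
  then have big: "10 * sqrt (real s - 1) < 3 * real (3 * k) + sqrt (real k ^ 2 + 10 * c)" by (simp add: x_def)
  show ?thesis
    by (rule defernex_negative_criterion[OF assms(1) s(1) assms(2,3) _ _ _ big])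
       (use assms(4) c kk in \<open>auto simp: c_def power_mult_distrib\<close>)
qed

text \<open>The entries are \<open>k div 4\<close> times the multiplicities of the isotropic class \<open>(4; 2\<^sup>2, 1\<^sup>8)\<close>, plus those of a class \<open>D\<close>
  of degree \<open>k mod 4\<close> orthogonal to it and to \<open>K\<close> with \<open>D\<^sup>2 = -2\<close>, respectively \<open>D\<^sup>2 = -4\<close>.\<close>

lemma ex_entries_square_plus_2:
  assumes "k \<ge> 4"
  obtains xs :: "nat list" where "length xs = 10" "\<And>x. x \<in> set xs \<Longrightarrow> x > 0" "(\<Sum>i<10. xs ! i) = 3 * k"
    "xs ! 8 = xs ! 9" "10 * (xs ! 0) > 3 * k" "(\<Sum>i<10. (xs ! i) ^ 2) = k ^ 2 + 2"
proof -
  \<comment> \<open>One less than the quotient, so that every entry below is visibly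
    positive.\<close>
  define j where "j = k div 4 - 1"
  have "k = 4 * (j + 1) + k mod 4" "k mod 4 < 4" using assms by (auto simp: j_def)
  then consider "k = 4 * (j + 1)" | "k = 4 * (j + 1) + 1" | "k = 4 * (j + 1) + 2" | "k = 4 * (j + 1) + 3"
    by linarith
  then show ?thesis
  proof cases
    case 1
    show ?thesis
      by (rule that[of "[2*j+3,2*j+1,j+1,j+1,j+1,j+1,j+1,j+1,j+1,j+1]"])
         (auto simp: 1 sum_lessThan_10 power2_eq_square algebra_simps)
  next
    case 2
    show ?thesis
      by (rule that[of "[2*j+3,2*j+2,j+2,j+2,j+1,j+1,j+1,j+1,j+1,j+1]"])
         (auto simp: 2 sum_lessThan_10 power2_eq_square algebra_simps)
  next
    case 3
    show ?thesis
      by (rule that[of "[2*j+3,2*j+3,j+2,j+2,j+2,j+2,j+1,j+1,j+1,j+1]"])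
         (auto simp: 3 sum_lessThan_10 power2_eq_square algebra_simps)
  next
    case 4
    show ?thesis
      by (rule that[of "[2*j+4,2*j+3,j+2,j+2,j+2,j+2,j+2,j+2,j+1,j+1]"])
         (auto simp: 4 sum_lessThan_10 power2_eq_square algebra_simps)
  qed
qed

lemma ex_entries_square_plus_4:
  assumes "k \<ge> 5"
  obtains xs :: "nat list" where "length xs = 10" "\<And>x. x \<in> set xs \<Longrightarrow> x > 0" "(\<Sum>i<10. xs ! i) = 3 * k"
    "xs ! 8 = xs ! 9" "10 * (xs ! 0) > 3 * k" "(\<Sum>i<10. (xs ! i) ^ 2) = k ^ 2 + 4"
proof -
  define j where "j = (k - 5) div 4"
  have "k - 5 = 4 * j + (k - 5) mod 4" "(k - 5) mod 4 < 4" by (auto simp: j_def)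
  then consider "k = 4 * j + 5" | "k = 4 * j + 6" | "k = 4 * j + 7" | "k = 4 * j + 8"
    using assms by linarith
  then show ?thesis
  proof cases
    case 1
    show ?thesis
      by (rule that[of "[2*j+3,2*j+2,j+3,j+1,j+1,j+1,j+1,j+1,j+1,j+1]"])
         (auto simp: 1 sum_lessThan_10 power2_eq_square algebra_simps)
  next
    case 2
    show ?thesis
      by (rule that[of "[2*j+3,2*j+3,j+3,j+2,j+2,j+1,j+1,j+1,j+1,j+1]"])
         (auto simp: 2 sum_lessThan_10 power2_eq_square algebra_simps)
  next
    case 3
    show ?thesis
      by (rule that[of "[2*j+4,2*j+3,j+3,j+2,j+2,j+2,j+2,j+1,j+1,j+1]"])
         (auto simp: 3 sum_lessThan_10 power2_eq_square algebra_simps)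
  next
    case 4
    show ?thesis
      by (rule that[of "[2*j+5,2*j+3,j+3,j+1,j+2,j+2,j+2,j+2,j+2,j+2]"])
         (auto simp: 4 sum_lessThan_10 power2_eq_square algebra_simps)
  qed
qed

lemma defernex_negative_square_plus_2:
  assumes "k \<ge> 4" shows "\<exists>R. wonderful_ray (k ^ 2 + 2) R \<and> defernex_negative (k ^ 2 + 2) R"
proof -
  obtain xs where xs: "length xs = 10" "\<And>x. x \<in> set xs \<Longrightarrow> x > 0" "(\<Sum>i<10. xs ! i) = 3 * k"
    "xs ! 8 = xs ! 9" "10 * (xs ! 0) > 3 * k" "(\<Sum>i<10. (xs ! i) ^ 2) = k ^ 2 + 2"
    using ex_entries_square_plus_2[OF assms] by metis
  show ?thesis
    by (rule defernex_negative_near_square[of "(!) xs" k]) (use xs assms in auto)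
qed

lemma defernex_negative_square_plus_4:
  assumes "k \<ge> 5" shows "\<exists>R. wonderful_ray (k ^ 2 + 4) R \<and> defernex_negative (k ^ 2 + 4) R"
proof -
  obtain xs where xs: "length xs = 10" "\<And>x. x \<in> set xs \<Longrightarrow> x > 0" "(\<Sum>i<10. xs ! i) = 3 * k"
    "xs ! 8 = xs ! 9" "10 * (xs ! 0) > 3 * k" "(\<Sum>i<10. (xs ! i) ^ 2) = k ^ 2 + 4"
    using ex_entries_square_plus_4[OF assms] by metis
  show ?thesis
    by (rule defernex_negative_near_square[of "(!) xs" k]) (use xs assms in auto)
qed

text \<open>For h = (2, 1, ..., 1) one has S = 11 and q = 9, and the criterion becomes 10 sqrt 12 <
  36.\<close>

lemma defernex_negative_13: "\<exists>R. wonderful_ray 13 R \<and> defernex_negative 13 R"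
proof -
  have "sqrt 12 < (3.5 :: real)" by (rule real_less_lsqrt) (auto simp: power2_eq_square)
  then show ?thesis
    using defernex_negative_criterion[of "\<lambda>i. if i = 0 then 2 else 1" 13 11 9]
    by (simp add: sum_lessThan_10)
qed

text \<open>An isotropic class on ten points is viewed on eleven points with multiplicity 0 at the
  last, and transformed at the points 0, 1 and 10. All eleven multiplicities can then be split; the
  eleventh is 10 - m0_0 - m0_1, nonnegative by \<open>bd\<close>. Rationality of \<open>m0 0\<close>
  and \<open>m0 1\<close> makes the new degree rational, so the irrational entry \<open>m0 2\<close>
  keeps the ray irrational.\<close>

lemma defernex_negative_14_20:
  fixes m0 :: "nat \<Rightarrow> real" and h :: "nat \<Rightarrow> nat"
  assumes m0: "(\<Sum>i<10. m0 i) = 3 * 10" "(\<Sum>i<10. m0 i ^ 2) = 10 ^ 2" "m0 10 = 0"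
    and irr: "m0 2 \<notin> \<rat>" "m0 0 \<in> \<rat>" "m0 1 \<in> \<rat>"
    and bd: "m0 0 + m0 1 \<le> 10"
    and h: "\<And>i. i < 11 \<Longrightarrow> h i > 0" "(\<Sum>i<11. h i ^ 2) = s"
    and m: "m = m0(0 := 10 - m0 1, 1 := 10 - m0 0, 10 := 10 - m0 0 - m0 1)"
    and big: "sqrt (real s - 1) * (20 - m0 0 - m0 1) < (\<Sum>i<11. m i * real (h i))"
  shows "\<exists>R. wonderful_ray s R \<and> defernex_negative s R"
proof -
  note nef = isotropic_10_nef[of 10, OF _ m0(1,2), simplified]
  have nn: "m0 i \<ge> 0" if "i < 11" for i using nef(2)[of i] m0(3) that by (cases "i = 10") auto
  have "nef_on {..<11} 10 m0"
    by (rule nef_on_extend[OF nef(1)]) (use m0(3) in \<open>auto simp: less_Suc_eq eval_nat_numeral\<close>)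
  from nef_on_cremona[OF this, of 0 1 10] nn m0(3)
  have nefm: "nef_on {..<11} (20 - m0 0 - m0 1) m" by (simp add: m)
  have m_nn: "m i \<ge> 0" if "i < 11" for i
    using nn[OF that] nn[of 0] nn[of 1] bd by (auto simp: m)
  have "(\<Sum>i<11. m i ^ 2) = (\<Sum>i<10. m0 i ^ 2) - m0 0 ^ 2 - m0 1 ^ 2 + (10 - m0 1) ^ 2 + (10 - m0 0) ^ 2 + (10 - m0 0 - m0 1) ^ 2"
    by (simp add: sum_lessThan_11 sum_lessThan_10 m)
  then have sq: "(\<Sum>i<11. m i ^ 2) = (20 - m0 0 - m0 1) ^ 2"
    unfolding m0(2) by (simp add: power2_eq_square algebra_simps)
  have "m 2 / (20 - m0 0 - m0 1) \<notin> \<rat>"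
  proof
    assume "m 2 / (20 - m0 0 - m0 1) \<in> \<rat>"
    then have "m 2 / (20 - m0 0 - m0 1) * (20 - m0 0 - m0 1) \<in> \<rat>"
      using irr by (intro Rats_mult Rats_diff) auto
    with irr(1) bd show False by (simp add: m)
  qed
  then obtain M where M: "wonderful_ray s (ray s (20 - m0 0 - m0 1) M)" "(\<Sum>j=1..s. M j) = (\<Sum>i<11. m i * real (h i))"
    using wonderful_ray_collision[OF nefm, of h s 2] m_nn h sq bd by auto
  with big show ?thesis using ray_defernex_negative[of s] by metis
qed

lemma Rats_affine_irrational:
  assumes "x \<notin> \<rat>" "a \<in> \<rat>" "b \<in> \<rat>" "b \<noteq> 0" shows "a + x / b \<notin> \<rat>"
proof
  assume "a + x / b \<in> \<rat>"
  then have "(a + x / b - a) * b \<in> \<rat>" using assms by (intro Rats_mult Rats_diff) auto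
  with assms show False by simp
qed

lemma defernex_negative_14: "\<exists>R. wonderful_ray 14 R \<and> defernex_negative 14 R"
proof -
  \<comment> \<open>Beside the entries 11/2 and 3/2 the remaining eight share the sum 23 equally,
    except for the deviation sqrt 11 / 4 that brings the sum of squares to 100. The transformed
    class has degree 13 and multiplicities 17/2, 9/2 and 3 at the points 0, 1 and 10; with
    \<open>h\<close> doubling the point 0, the weighted sum is 34/2 + 9/2 + 3 + 23 = 47.5.\<close>
  define m0 :: "nat \<Rightarrow> real" where "m0 = (\<lambda>i. if i = 0 then 11/2 else if i = 1 then 3/2 else
    if i = 2 then 23/8 + sqrt 11 / 4 else if i = 3 then 23/8 - sqrt 11 / 4 else if i = 10 then 0 else 23/8)"
  have irr: "m0 2 \<notin> \<rat>"
    using sqrt_irrational_between[of 3 11] Rats_affine_irrational[of "sqrt 11" "23/8" 4] by (simp add: m0_def)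
  have root: "sqrt 13 < (47.5 / 13 :: real)" by (rule real_less_lsqrt) (auto simp: power2_eq_square)
  show ?thesis
    by (rule defernex_negative_14_20[of m0 "\<lambda>i. if i = 0 then 2 else 1", OF _ _ _ irr _ _ _ _ _ refl])
       (use root in \<open>simp_all add: sum_lessThan_10 sum_lessThan_11 m0_def power2_eq_square algebra_simps\<close>)
qed

lemma defernex_negative_20: "\<exists>R. wonderful_ray 20 R \<and> defernex_negative 20 R"
proof -
  \<comment> \<open>Beside 1 and 3/2 the remaining eight entries share the sum 55/2, with the
    deviation sqrt 71 / 8 fixing the sum of squares. The transformed class has degree 17.5 and
    multiplicities 17/2, 9 and 15/2 at the points 0, 1 and 10; these three are doubled by
    \<open>h\<close>, and the weighted sum is 50 + 55/2 = 77.5.\<close>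
  define m0 :: "nat \<Rightarrow> real" where "m0 = (\<lambda>i. if i = 0 then 1 else if i = 1 then 3/2 else
    if i = 2 then 55/16 + sqrt 71 / 8 else if i = 3 then 55/16 - sqrt 71 / 8 else if i = 10 then 0 else 55/16)"
  have irr: "m0 2 \<notin> \<rat>"
    using sqrt_irrational_between[of 8 71] Rats_affine_irrational[of "sqrt 71" "55/16" 8] by (simp add: m0_def)
  have root: "sqrt 19 < (77.5 / 17.5 :: real)" by (rule real_less_lsqrt) (auto simp: power2_eq_square)
  show ?thesis
    by (rule defernex_negative_14_20[of m0 "\<lambda>i. if i \<in> {0,1,10} then 2 else 1", OF _ _ _ irr _ _ _ _ _ refl])
       (use root in \<open>simp_all add: sum_lessThan_10 sum_lessThan_11 m0_def power2_eq_square algebra_simps\<close>)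
qed

theorem mainTheorem1:
  shows "(\<forall>s::nat. s \<ge> 10 \<longrightarrow> (\<exists>R. wonderful_ray s R)) \<and>
         (\<forall>s::nat. s \<ge> 13 \<longrightarrow> (\<exists>R. wonderful_ray s R \<and> ray_dot_pos s R (canonical s))) \<and>
         (\<forall>s::nat. (s = 14 \<or> (s \<ge> 13 \<and> (\<exists>k::nat. s - 4 = k ^ 2)) \<or> (s \<ge> 18 \<and> (\<exists>k::nat. s - 2 = k ^ 2)))
             \<longrightarrow> (\<exists>R. wonderful_ray s R \<and> defernex_negative s R))"
proof (intro conjI allI impI)
  fix s :: nat
  assume "s = 14 \<or> (s \<ge> 13 \<and> (\<exists>k::nat. s - 4 = k ^ 2)) \<or> (s \<ge> 18 \<and> (\<exists>k::nat. s - 2 = k ^ 2))"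
  then consider "s = 14" | k where "s \<ge> 13" "s - 4 = k ^ 2" | k where "s \<ge> 18" "s - 2 = k ^ 2" by blast
  then show "\<exists>R. wonderful_ray s R \<and> defernex_negative s R"
  proof cases
    case 1
    then show ?thesis using defernex_negative_14 by simp
  next
    case (2 k)
    then have s: "s = k ^ 2 + 4" "k ^ 2 \<ge> 3 ^ 2" by auto
    then have "k \<ge> 3" using power2_le_imp_le[of 3 k] by simp
    \<comment> \<open>The values 3 and 4 give s = 13 and s = 20, where the estimate for k^2 + 4
      fails and separate classes are used.\<close>
    then consider "k = 3" | "k = 4" | "k \<ge> 5" by linarith
    then show ?thesis
      using s(1) defernex_negative_13 defernex_negative_20 defernex_negative_square_plus_4[of k] by cases auto
  next
    case (3 k)
    then have s: "s = k ^ 2 + 2" "k ^ 2 \<ge> 4 ^ 2" by auto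
    then have "k \<ge> 4" using power2_le_imp_le[of 4 k] by simp
    then show ?thesis using s(1) defernex_negative_square_plus_2 by blast
  qed
qed (auto intro: wonderful_ray_exists wonderful_ray_canonical_positive_exists)

end
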